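(* Let $S\subseteq\mathbb{R}^d$ be closed. Let $\rho>0$ and $\tau\ge 0$ satisfy $\rho+\tau>1$, and let $\eta=\frac{\alpha}{3\rho\sqrt{d}L_0}$. Let $w^1\in S\cap\overline{B}_\beta$, $K\in\mathbb{Z}_{>0}$ and $M\in\mathbb{Z}_{>0}$ be arbitrary, and let $w^R$ be the output of the Stochastic Projected Algorithm (SPA) run with inputs $w^1,\eta,K,M$. Let $w_\alpha^*$ and $w^*$ be minimizers of $f_\alpha$ and $f$, respectively, over $S\cap\overline{B}_\beta$, and let $\Delta$ be any real number with $\Delta\ge f_\alpha(w^1)-f_\alpha(w_\alpha^* )$. Then $$\mathbb{E}\big[\mathrm{dist}(0,\nabla f_\alpha(w^R)+N(w^R,S\cap\overline{B}_\beta))^2\big]\le C_1\frac{2\alpha^{-1}\sqrt{d}L_0\Delta}{K}+C_2\frac{\upsilon Q}{M},$$ where $$C_1:=\frac{2(1+3\rho)}{\tau+\rho-1}+3\rho,\qquad C_2:=\frac{4(1+3\rho)}{\tau+\rho-1}\Big(\frac12+\frac23\frac{M\tau}{\rho^2}\Big)+3,$$ and $\upsilon:=d$ if SPA uses update (1), $\upsilon:=1$ if SPA uses update (2). Moreover, $$f_\alpha(w^1)-f_\alpha(w_\alpha^* )\le\min\Big(2\beta\sqrt{d}L_0,\ f(w^1)-f(w^* )+\alpha L_0\sqrt{\tfrac d3}\Big).$$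
   Context: Notation: $\overline{B}_r:=\{z\in\mathbb{R}^d:|z_i|\le r,\ i=1,\dots,d\}$. Setting: $\alpha>0$, $\beta>0$, $\kappa>\beta+\frac{\alpha}{2}$. $\xi$ is a random vector in $\mathbb{R}^p$ with law $P_\xi$. $F:\overline{B}_\kappa\times\mathbb{R}^p\to\mathbb{R}$ is Borel measurable, $F(w,\xi)$ is integrable for each $w$, and $F(\cdot,\xi)$ is continuous on $\overline{B}_\kappa$ for each $\xi\in\mathbb{R}^p$. There is a measurable function $L_0(\cdot)$ on $\mathbb{R}^p$ with $|F(w,\xi)-F(w',\xi)|\le L_0(\xi)\|w-w'\|_2$ for all $w,w'\in\overline{B}_\kappa$ and all $\xi$ outside a $P_\xi$-null Borel set. Set $Q:=\mathbb{E}[L_0(\xi)^2]<\infty$, $L_0:=\mathbb{E}[L_0(\xi)]$ with $L_0>0$, and $f(w):=\mathbb{E}[F(w,\xi)]$. The random vector $u$ is uniform on $\overline{B}_{\alpha/2}$ with law $P_u$, independent of $\xi$, and $f_\alpha(w):=\mathbb{E}[f(w+u)]$. (If the Lipschitz condition holds for all $w,w'\in\mathbb{R}^d$, the case $\beta=\infty$, i.e. $\overline{B}_\beta=\overline{B}_\kappa=\mathbb{R}^d$, is allowed.) Gradient estimators: $\widetilde{\nabla}F:\overline{B}_{\beta+\alpha/2}\times\mathbb{R}^p\to\mathbb{R}^d$ is a Borel measurable function such that for every $w\in\overline{B}_\beta$, $\widetilde{\nabla}F(w+u,\xi)=\nabla F(w+u,\xi)$ (gradient in the first argument) for $P_u\times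 P_\xi$-almost every $(u,\xi)$. The finite difference $dF(w,u,\xi)\in\mathbb{R}^d$ has $i$-th component $dF_i:=F(w_1+u_1,\dots,w_{i-1}+u_{i-1},w_i+\frac\alpha2,w_{i+1}+u_{i+1},\dots,w_d+u_d,\xi)-F(w_1+u_1,\dots,w_{i-1}+u_{i-1},w_i-\frac\alpha2,w_{i+1}+u_{i+1},\dots,w_d+u_d,\xi)$. Algorithm SPA: inputs $w^1\in S\cap\overline{B}_\beta$, $\eta>0$, $K,M\in\mathbb{Z}_{>0}$. Draw $R$ uniformly from $\{2,\dots,K+1\}$ (independently of everything else). For $k=1,\dots,R-1$: draw independent samples $u^{k,i}\sim P_u$, $\xi^{k,i}\sim P_\xi$, $i=1,\dots,M$, and set either (1) $w^{k+1}\in\Pi_{S\cap\overline{B}_\beta}\big(w^k-\frac{\eta}{M\alpha}\sum_{i=1}^M dF(w^k,u^{k,i},\xi^{k,i})\big)$, or (2) $w^{k+1}\in\Pi_{S\cap\overline{B}_\beta}\big(w^k-\frac{\eta}{M}\sum_{i=1}^M\widetilde{\nabla}F(w^k+u^{k,i},\xi^{k,i})\big)$, the same option being used throughout. Output $w^R$. Here $\Pi_A(x)$ is the (set-valued) Euclidean projection onto a closed set $A$; a Borel measurable selection of it is used. Normal cone: for $w\in A$, $\widehat N(w,A):=\{y:\limsup_{x\to w,\,x\in A}\frac{\langle y,x-w\rangle}{\|x-w\|_2}\le0\}$, and $N(w,A)$ (Mordukhovich normal cone) is the set of limits $y$ of sequences $y_k\in\widehat N(x_k,A)$ with $x_k\in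 A$, $x_k\to w$. $\mathrm{dist}$ is Euclidean distance. *)

theory Defs
  imports "HOL-Probability.Probability"
begin

text \<open>The radius is extended real so that \<open>cube \<infinity> = UNIV\<close>.\<close>

definition cube :: "ereal \<Rightarrow> (real ^ 'd) set" where
  "cube r = {z. \<forall>i. ereal \<bar>z $ i\<bar> \<le> r}"

definition cube_law :: "real \<Rightarrow> (real ^ 'd) measure" where
  "cube_law \<alpha> = uniform_measure lborel (cube (ereal (\<alpha> / 2)))"

definition expected :: "(real ^ 'p) measure \<Rightarrow> (real ^ 'd \<Rightarrow> real ^ 'p \<Rightarrow> real) \<Rightarrow> real ^ 'd \<Rightarrow> real" where
  "expected P F w = (\<integral>x. F w x \<partial>P)"

text \<open>\<open>cube_law \<alpha>\<close> is a measure on the whole space, while the functions that are smoothed are only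
  meaningful (and only known to be measurable) on a cube around the origin.  Hence the expectation
  is written as an integral over the support of \<open>cube_law \<alpha>\<close>, which has full measure.\<close>

definition smoothed :: "real \<Rightarrow> (real ^ 'd \<Rightarrow> real) \<Rightarrow> real ^ 'd \<Rightarrow> real" where
  "smoothed \<alpha> f w = (LINT v:cube (ereal (\<alpha> / 2))|cube_law \<alpha>. f (w + v))"

definition gradient :: "('a::real_inner \<Rightarrow> real) \<Rightarrow> 'a \<Rightarrow> 'a" where
  "gradient f w = (THE D. GDERIV f w :> D)"

definition finite_diff ::
  "real \<Rightarrow> (real ^ 'd \<Rightarrow> real ^ 'p \<Rightarrow> real) \<Rightarrow> real ^ 'd \<Rightarrow> real ^ 'd \<Rightarrow> real ^ 'p \<Rightarrow> real ^ 'd" where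
  "finite_diff \<alpha> F w u x =
    (\<chi> i. F (\<chi> j. if j = i then w $ i + \<alpha> / 2 else w $ j + u $ j) x
        - F (\<chi> j. if j = i then w $ i - \<alpha> / 2 else w $ j + u $ j) x)"

definition proj_set :: "'a::metric_space set \<Rightarrow> 'a \<Rightarrow> 'a set" where
  "proj_set A x = {y. is_arg_min (dist x) (\<lambda>z. z \<in> A) y}"

text \<open>At an isolated point \<open>w\<close> of \<open>A\<close> the filter \<open>at w within A\<close> is trivial, the upper limit is
  \<open>-\<infinity>\<close>, and the regular normal cone is the whole space.\<close>

definition regular_normal_cone :: "'a::real_inner \<Rightarrow> 'a set \<Rightarrow> 'a set" where
  "regular_normal_cone w A =
    {y. Limsup (at w within A) (\<lambda>x. ereal (inner y (x - w) / norm (x - w))) \<le> 0}"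

definition normal_cone :: "'a::real_inner \<Rightarrow> 'a set \<Rightarrow> 'a set" where
  "normal_cone w A =
    {y. \<exists>xs ys. (\<forall>k::nat. xs k \<in> A \<and> ys k \<in> regular_normal_cone (xs k) A)
          \<and> xs \<longlonglongrightarrow> w \<and> ys \<longlonglongrightarrow> y}"

datatype spa_update = Finite_Difference | Gradient_Estimate

text \<open>The point that is projected in one iteration, for the samples \<open>(u i, x i)\<close>, \<open>i = 1, \<dots>, M\<close>.\<close>

fun spa_step ::
  "spa_update \<Rightarrow> real \<Rightarrow> (real ^ 'd \<Rightarrow> real ^ 'p \<Rightarrow> real) \<Rightarrow> (real ^ 'd \<Rightarrow> real ^ 'p \<Rightarrow> real ^ 'd) \<Rightarrow>
   real \<Rightarrow> nat \<Rightarrow> real ^ 'd \<Rightarrow> (nat \<Rightarrow> real ^ 'd) \<Rightarrow> (nat \<Rightarrow> real ^ 'p) \<Rightarrow> real ^ 'd" where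
  "spa_step Finite_Difference \<alpha> F G \<eta> M w u x =
     w - (\<eta> / (real M * \<alpha>)) *\<^sub>R (\<Sum>i=1..M. finite_diff \<alpha> F w (u i) (x i))"
| "spa_step Gradient_Estimate \<alpha> F G \<eta> M w u x =
     w - (\<eta> / real M) *\<^sub>R (\<Sum>i=1..M. G (w + u i) (x i))"

end

theory Submission
  imports Defs
begin

text \<open>With \<open>l = 2 \<surd>d L\<^sub>0 / \<alpha>\<close>, the smoothed function is differentiable with \<open>l\<close>-Lipschitz gradient, because
  its partial derivatives are averages of \<open>(f (w + \<alpha>/2 e\<^sub>i + v) - f (w - \<alpha>/2 e\<^sub>i + v)) / \<alpha>\<close> over the
  coordinates of \<open>v\<close> other than the \<open>i\<close>-th; hence both estimators are unbiased.  The residual of a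
  projected step is an element of the normal cone, and its squared distance to \<open>-\<nabla>f\<^sub>\<alpha>\<close> is at most a
  multiple of the decrease of \<open>f\<^sub>\<alpha>\<close> plus multiples of the squared error and the squared norm of the
  estimator.  The decreases telescope along every sample path, and the random index averages the
  remaining second moments.\<close>

section \<open>One projected step\<close>

text \<open>The output is the point reached after a step, but the estimator is unbiased at the point
  before it, and the new point depends on the same samples. Hence no expectation is taken at the new
  point: a deterministic inequality bounds the residual there by quantities at the old point and by
  the estimator \<open>g\<close>, and these are averaged over a batch independent of the old point.
  The set may be nonconvex, so the projection yields only that \<open>p\<close> is at least as close
  to the trial point as \<open>w\<close>. With \<open>\<eta> = 2 / (3 * \<rho> * l)\<close> this
  gains \<open>3/4 * \<rho> * l\<close> times the squared step length, against
  \<open>3/4 * l\<close> lost to curvature and noise. If \<rho> is at most 1, the deficit is paid by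
  the second moment of \<open>g\<close>, which averaging does not reduce; this is the term
  \<open>M * \<tau> / \<rho>^2\<close> of \<open>C2\<close>. \<open>F\<close> and \<open>G\<close>
  are controlled only on cubes, and \<open>F\<close> is differentiable only at almost every
  perturbed point. Extension by zero makes Fubini applicable, and dominated convergence gives the
  gradient. The distance to the limiting normal cone carries no measurability statement, so it is
  replaced pathwise by a measurable majorant before independence is used.\<close>

lemma GDERIV_unique:
  assumes "GDERIV f w :> D" "GDERIV f w :> E"
  shows "D = E"
proof -
  have "(\<lambda>h. inner h D) = (\<lambda>h. inner h E)"
    using assms has_derivative_unique unfolding gderiv_def by blast
  then have "\<forall>h. inner h D = inner h E"
    by (auto dest: fun_cong)
  then show ?thesis
    by (simp only: vector_eq_ldot)
qed

lemma gradient_eqI: "GDERIV f w :> D \<Longrightarrow> gradient f w = D"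
  unfolding gradient_def by (blast intro: the_equality GDERIV_unique)

lemma GDERIV_along_line:
  assumes "GDERIV f (w + t *\<^sub>R h) :> D"
  shows "((\<lambda>t. f (w + t *\<^sub>R h)) has_real_derivative inner h D) (at t)"
proof -
  have "((\<lambda>t. w + t *\<^sub>R h) has_derivative (\<lambda>s. s *\<^sub>R h)) (at t)"
    by (auto intro!: derivative_eq_intros)
  from has_derivative_compose[OF this assms[unfolded gderiv_def]]
  have "((\<lambda>t. f (w + t *\<^sub>R h)) has_derivative (\<lambda>s. inner (s *\<^sub>R h) D)) (at t)"
    by (simp add: o_def)
  then show ?thesis
    by (simp add: has_field_derivative_def mult.commute[of _ "inner h D"])
qed

text \<open>A mean value argument along the segment: \<open>\<psi>\<close> is \<open>f\<close> minus
  its tangent at \<open>w\<close> minus a parabola of curvature \<open>l\<close>, and the Lipschitz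
  bound makes its derivative nonpositive. It is applied on a convex cube, since the feasible set may
  not contain the segment from \<open>w\<close> to \<open>p\<close>.\<close>

lemma GDERIV_Lipschitz_descent:
  fixes f :: "'a::real_inner \<Rightarrow> real"
  assumes "convex B" "w \<in> B" "p \<in> B"
    and g: "\<And>z. z \<in> B \<Longrightarrow> GDERIV f z :> g z"
    and lip: "\<And>z z'. z \<in> B \<Longrightarrow> z' \<in> B \<Longrightarrow> norm (g z - g z') \<le> l * norm (z - z')"
  shows "f p \<le> f w + inner (g w) (p - w) + l / 2 * (norm (p - w))\<^sup>2"
proof -
  define h where "h = p - w"
  define \<psi> where "\<psi> t = f (w + t *\<^sub>R h) - t * inner h (g w) - l / 2 * (norm h)\<^sup>2 * t\<^sup>2" for t :: real
  have "\<psi> 1 \<le> \<psi> 0"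
  proof (rule DERIV_nonpos_imp_nonincreasing[of 0 1 \<psi>])
    fix t :: real assume t: "0 \<le> t" "t \<le> 1"
    have z: "w + t *\<^sub>R h \<in> B"
      using convexD_alt[OF assms(1-3) t] by (simp add: h_def algebra_simps)
    have D: "(\<psi> has_real_derivative inner h (g (w + t *\<^sub>R h)) - inner h (g w)
        - l * (norm h)\<^sup>2 * t) (at t)"
      unfolding \<psi>_def
      by (rule derivative_eq_intros GDERIV_along_line[OF g[OF z]] refl | simp)+
    have "inner h (g (w + t *\<^sub>R h)) - inner h (g w) = inner h (g (w + t *\<^sub>R h) - g w)"
      by (simp add: inner_diff_right)
    also have "\<dots> \<le> norm h * norm (g (w + t *\<^sub>R h) - g w)"
      by (rule norm_cauchy_schwarz)
    also have "\<dots> \<le> norm h * (l * norm ((w + t *\<^sub>R h) - w))"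
      by (intro mult_left_mono lip z assms) auto
    also have "\<dots> = l * (norm h)\<^sup>2 * t"
      using t by (simp add: power2_eq_square)
    finally show "\<exists>y. (\<psi> has_real_derivative y) (at t) \<and> y \<le> 0"
      using D by force
  qed simp
  then show ?thesis
    by (simp add: \<psi>_def h_def inner_commute algebra_simps)
qed

text \<open>In the direction \<open>D\<close> itself the difference quotient tends to the square of
  \<open>norm D\<close>, while the local Lipschitz bound keeps it below
  \<open>l * norm D\<close>.\<close>

lemma GDERIV_norm_le:
  fixes f :: "'a::real_inner \<Rightarrow> real"
  assumes D: "GDERIV f z :> D" and U: "open U" "z \<in> U" and l: "0 \<le> l"
    and lip: "\<And>y. y \<in> U \<Longrightarrow> \<bar>f y - f z\<bar> \<le> l * norm (y - z)"
  shows "norm D \<le> l"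
proof (cases "D = 0")
  case False
  define \<phi> where "\<phi> t = f (z + t *\<^sub>R D)" for t :: real
  have "(\<phi> has_real_derivative (norm D)\<^sup>2) (at 0)"
    using GDERIV_along_line[of f z 0 D D] D unfolding \<phi>_def by (simp add: power2_norm_eq_inner)
  then have lim: "((\<lambda>t. (\<phi> t - \<phi> 0) / t) \<longlongrightarrow> (norm D)\<^sup>2) (at 0)"
    by (simp add: has_field_derivative_iff)
  have "((\<lambda>t::real. z + t *\<^sub>R D) \<longlongrightarrow> z + 0 *\<^sub>R D) (at 0)"
    by (intro tendsto_intros)
  then have "\<forall>\<^sub>F t in at (0::real). z + t *\<^sub>R D \<in> U"
    using U topological_tendstoD by fastforce
  then have "\<forall>\<^sub>F t in at 0. (\<phi> t - \<phi> 0) / t \<le> l * norm D"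
    using eventually_neq_at_within[of 0]
  proof eventually_elim
    case (elim t)
    have "\<bar>\<phi> t - \<phi> 0\<bar> / \<bar>t\<bar> \<le> l * norm D"
      using lip[OF elim(1)] elim(2) by (simp add: \<phi>_def divide_simps ac_simps)
    then show ?case
      by (simp flip: abs_divide)
  qed
  then have "(norm D)\<^sup>2 \<le> l * norm D"
    by (intro tendsto_upperbound[OF lim]) auto
  then show ?thesis
    using False by (simp add: power2_eq_square)
qed (use l in simp)

section \<open>Projections and the normal cone\<close>

text \<open>Expanding the distance from \<open>x\<close> to \<open>z\<close> around \<open>p\<close>
  gives \<open>inner (x - p) (z - p)\<close> at most half the square of \<open>norm (z - p)\<close>.
  The quotient defining the regular cone is therefore of order \<open>norm (z - p)\<close> and
  cannot have a positive upper limit, also when \<open>A\<close> is nonconvex. Constant sequences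
  pass to the limiting cone.\<close>

lemma proximal_normal:
  fixes x p :: "'a::real_inner"
  assumes p: "p \<in> proj_set A x" and c: "0 \<le> c"
  shows "c *\<^sub>R (x - p) \<in> normal_cone p A"
proof -
  have pA: "p \<in> A" and min: "\<And>z. z \<in> A \<Longrightarrow> dist x p \<le> dist x z"
    using p by (force simp: proj_set_def is_arg_min_linorder)+
  have le: "inner (x - p) (z - p) \<le> (norm (z - p))\<^sup>2 / 2" if "z \<in> A" for z
  proof -
    have "(norm (x - p))\<^sup>2 \<le> (norm ((x - p) - (z - p)))\<^sup>2"
      using min[OF that] by (intro power_mono) (auto simp: dist_norm)
    then show ?thesis
      by (simp add: power2_norm_eq_inner inner_diff inner_commute)
  qed
  define q where "q z = inner (c *\<^sub>R (x - p)) (z - p) / norm (z - p)" for z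
  have q: "q z \<le> c / 2 * norm (z - p)" if "z \<in> A" "z \<noteq> p" for z
    using mult_left_mono[OF le[OF that(1)] c] that(2)
    by (simp add: q_def divide_simps power2_eq_square mult_ac)
  have "Limsup (at p within A) (\<lambda>z. ereal (q z)) \<le> 0"
  \<comment> \<open>At an isolated point the upper limit is minus infinity; evaluating the upper
    limit of the majorant needs a nontrivial filter.\<close>
  proof (cases "at p within A = bot")
    case False
    have ev: "\<forall>\<^sub>F z in at p within A. ereal (q z) \<le> ereal (c / 2 * norm (z - p))"
      unfolding eventually_at_filter using q by (auto intro: always_eventually)
    have "((\<lambda>z. ereal (c / 2 * norm (z - p))) \<longlongrightarrow> ereal (c / 2 * norm (p - p))) (at p within A)"
      by (intro tendsto_intros)
    then have "Limsup (at p within A) (\<lambda>z. ereal (c / 2 * norm (z - p))) = 0"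
      using lim_imp_Limsup[OF False] by (metis cancel_comm_monoid_add_class.diff_cancel mult_zero_right norm_zero zero_ereal_def)
    then show ?thesis
      using Limsup_mono[OF ev] by simp
  qed simp
  then have "c *\<^sub>R (x - p) \<in> regular_normal_cone p A"
    by (simp add: regular_normal_cone_def q_def)
  then show ?thesis
    unfolding normal_cone_def using pA
    by (intro CollectI exI[of _ "\<lambda>_. p"] exI[of _ "\<lambda>_. c *\<^sub>R (x - p)"]) auto
qed

text \<open>One element of the shifted cone suffices for an upper bound; with
  \<open>c = 1 / \<eta>\<close> it is the rescaled residual of the projection.\<close>

lemma infdist_gradient_normal_cone_le:
  fixes x p :: "'a::real_inner"
  assumes "p \<in> proj_set A x" "0 \<le> c"
  shows "infdist 0 ((\<lambda>y. a + y) ` normal_cone p A) \<le> norm (a + c *\<^sub>R (x - p))"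
  using infdist_le[OF imageI[OF proximal_normal[OF assms], of "\<lambda>y. a + y"], of 0] by simp

text \<open>One projected step \<open>p\<close> from \<open>w\<close>.  With \<open>s = p - w\<close>, minimality of \<open>p\<close> cancels the term
  \<open>\<parallel>s\<parallel>\<^sup>2 / \<eta>\<^sup>2\<close> in the square of \<open>\<nabla>f p - (w - p - \<eta> g) / \<eta>\<close>; the remaining \<open>\<parallel>s\<parallel>\<^sup>2\<close> is absorbed
  by the decrease of \<open>f\<close> when \<open>\<rho> > 1\<close>, and a multiple \<open>\<tau>\<close> of it is paid for by
  \<open>\<parallel>s\<parallel> \<le> 2 \<eta> \<parallel>g\<parallel>\<close> otherwise.\<close>

lemma projected_step_bound:
  fixes f :: "'a::real_inner \<Rightarrow> real"
  assumes p: "p \<in> proj_set A (w - \<eta> *\<^sub>R g)" and w: "w \<in> A"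
    and descent: "f p \<le> f w + inner m (p - w) + l / 2 * (norm (p - w))\<^sup>2"
    and ascent: "f p + inner m' (w - p) \<le> f w + l / 2 * (norm (p - w))\<^sup>2"
    and lip: "norm (m' - m) \<le> l * norm (p - w)"
    and l: "l > 0" and \<rho>: "\<rho> > 0" and \<tau>: "\<tau> \<ge> 0" "\<rho> + \<tau> > 1"
    and \<eta>: "\<eta> = 2 / (3 * \<rho> * l)"
  shows "(infdist 0 ((\<lambda>y. m' + y) ` normal_cone p A))\<^sup>2
    \<le> (2 * (1 + 3 * \<rho>) / (\<tau> + \<rho> - 1) + 3 * \<rho>) * l * (f w - f p)
      + (2 * (1 + 3 * \<rho>) / (\<tau> + \<rho> - 1) + 3) * (norm (m - g))\<^sup>2
      + 2 * (1 + 3 * \<rho>) / (\<tau> + \<rho> - 1) * (4 / 3 * (\<tau> / \<rho>\<^sup>2)) * (norm g)\<^sup>2"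
proof -
  define s where "s = p - w"
  define D where "D = (norm s)\<^sup>2"
  define V where "V = (norm (m - g))\<^sup>2"
  define N where "N = (norm g)\<^sup>2"
  define T where "T = \<tau> + \<rho> - 1"
  have T: "T > 0" and \<eta>0: "\<eta> > 0" and D0: "D \<ge> 0" and V0: "V \<ge> 0"
    using l \<rho> \<tau> \<eta> by (auto simp: T_def D_def V_def)
  \<comment> \<open>Doubled, this is the factor \<open>3 * \<rho> * l\<close> that becomes the
    summand \<open>3 * \<rho>\<close> of \<open>C1\<close>.\<close>
  have \<eta>inv: "1 / \<eta> = 3 * \<rho> * l / 2"
    by (simp add: \<eta>)
  have "(norm (w - \<eta> *\<^sub>R g - p))\<^sup>2 \<le> (norm (w - \<eta> *\<^sub>R g - w))\<^sup>2"
    using p w by (intro power_mono) (auto simp: proj_set_def is_arg_min_linorder dist_norm)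
  moreover have "w - \<eta> *\<^sub>R g - p = - (s + \<eta> *\<^sub>R g)"
    by (simp add: s_def)
  ultimately have "(norm (s + \<eta> *\<^sub>R g))\<^sup>2 \<le> (norm (\<eta> *\<^sub>R g))\<^sup>2"
    by (simp only: norm_minus_cancel) simp
  then have D1: "D + 2 * \<eta> * inner g s \<le> 0"
    unfolding D_def power2_norm_eq_inner inner_add_left inner_add_right inner_scaleR_left inner_scaleR_right
    by (simp add: inner_commute algebra_simps)
  then have gs: "2 / \<eta> * inner g s \<le> - (D / \<eta>\<^sup>2)"
    using \<eta>0 by (simp add: field_simps power2_eq_square)
  have "D \<le> 2 * \<eta> * (norm g * norm s)"
  proof -
    have "- inner g s \<le> norm g * norm s"
      using norm_cauchy_schwarz[of "- g" s] by simp
    then have "2 * \<eta> * (- inner g s) \<le> 2 * \<eta> * (norm g * norm s)"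
      using \<eta>0 by (intro mult_left_mono) auto
    then show ?thesis using D1 by simp
  qed
  then have "norm s \<le> 2 * \<eta> * norm g"
    by (cases "norm s = 0") (use \<eta>0 in \<open>auto simp: D_def power2_eq_square\<close>)
  then have "D \<le> (2 * \<eta> * norm g)\<^sup>2"
    unfolding D_def by (intro power_mono) auto
  then have D2: "D \<le> 16 / (9 * \<rho>\<^sup>2 * l\<^sup>2) * N"
    by (simp add: \<eta> N_def power_mult_distrib power_divide)
  \<comment> \<open>The balance of multiples of \<open>l * D\<close>: the descent inequality costs
    1/2, Young's inequality for \<open>inner (m - g) s\<close> costs 1/4, and the projection gains
    \<open>3/4 * \<rho>\<close>. Adding \<open>3/4 * \<tau>\<close> times \<open>l * D\<close>,
    bounded through \<open>D2\<close>, turns \<open>\<rho> - 1\<close> into the positive number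
    \<open>T\<close>.\<close>
  have key: "3 / 4 * l * T * D \<le> f w - f p + V / l + 4 / 3 * (\<tau> / \<rho>\<^sup>2) * N / l"
  proof -
    have "inner (m - g) s \<le> norm (m - g) * norm s"
      by (rule norm_cauchy_schwarz)
    also have "\<dots> \<le> V / l + l / 4 * D"
    proof -
      have "0 \<le> (norm (m - g) - l / 2 * norm s)\<^sup>2 / l"
        using l by simp
      also have "\<dots> = V / l + l / 4 * D - norm (m - g) * norm s"
        using l by (simp add: V_def D_def power2_eq_square field_simps)
      finally show ?thesis by simp
    qed
    finally have 1: "inner m s \<le> inner g s + V / l + l / 4 * D"
      by (simp add: inner_diff_left)
    have 2: "inner g s \<le> - (3 / 4 * \<rho> * l * D)"
    proof -
      have "2 * inner g s \<le> - (1 / \<eta>) * D"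
        using D1 \<eta>0 by (simp add: field_simps)
      then show ?thesis unfolding \<eta>inv by simp
    qed
    have 3: "3 / 4 * l * \<tau> * D \<le> 3 / 4 * l * \<tau> * (16 / (9 * \<rho>\<^sup>2 * l\<^sup>2) * N)"
      using D2 l \<tau> by (intro mult_left_mono) auto
    have 4: "3 / 4 * l * \<tau> * (16 / (9 * \<rho>\<^sup>2 * l\<^sup>2) * N) = 4 / 3 * (\<tau> / \<rho>\<^sup>2) * N / l"
      using l \<rho> by (simp add: field_simps power2_eq_square)
    have 5: "f p \<le> f w + inner m s + l / 2 * D"
      using descent by (simp add: s_def D_def)
    have "3 / 4 * l * T * D = 3 / 4 * l * \<tau> * D + 3 / 4 * \<rho> * l * D - 3 / 4 * l * D"
      by (simp add: T_def field_simps)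
    then show ?thesis
      using 1 2 3 4 5 by linarith
  qed
  have "(infdist 0 ((\<lambda>y. m' + y) ` normal_cone p A))\<^sup>2
      \<le> (norm (m' + (1 / \<eta>) *\<^sub>R (w - \<eta> *\<^sub>R g - p)))\<^sup>2"
    using infdist_gradient_normal_cone_le[OF p, of "1 / \<eta>" m'] \<eta>0 by (intro power_mono) (auto simp: infdist_nonneg)
  also have "m' + (1 / \<eta>) *\<^sub>R (w - \<eta> *\<^sub>R g - p) = (m' - g) - (1 / \<eta>) *\<^sub>R s"
    using \<eta>0 by (simp add: s_def algebra_simps)
  also have "(norm \<dots>)\<^sup>2 = (norm (m' - g))\<^sup>2 + D / \<eta>\<^sup>2 + 2 / \<eta> * inner g s - 2 / \<eta> * inner m' s"
    unfolding D_def power2_norm_eq_inner inner_diff_left inner_diff_right inner_scaleR_left inner_scaleR_right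
    using \<eta>0 by (simp add: inner_commute power2_eq_square field_simps)
  also have "\<dots> \<le> (norm (m' - g))\<^sup>2 - 2 / \<eta> * inner m' s"
    using gs by simp
  finally have dist1: "(infdist 0 ((\<lambda>y. m' + y) ` normal_cone p A))\<^sup>2
      \<le> (norm (m' - g))\<^sup>2 - 2 / \<eta> * inner m' s" .
  \<comment> \<open>The cross term involves the gradient at the new point, so the smoothness
    inequality expanded at \<open>p\<close> is the one that bounds it.\<close>
  have dist2: "- (2 / \<eta> * inner m' s) \<le> 3 * \<rho> * l * (f w - f p + l / 2 * D)"
  proof -
    have "- inner m' s \<le> f w - f p + l / 2 * D"
      using ascent by (simp add: s_def D_def inner_diff)
    then have "2 / \<eta> * (- inner m' s) \<le> 2 / \<eta> * (f w - f p + l / 2 * D)"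
      using \<eta>0 by (intro mult_left_mono) auto
    moreover have "2 / \<eta> = 3 * \<rho> * l"
      using \<eta>inv by simp
    ultimately show ?thesis by simp
  qed
  have dist3: "(norm (m' - g))\<^sup>2 \<le> 3 / 2 * l\<^sup>2 * D + 3 * V"
  proof -
    have "norm (m' - g) \<le> l * norm s + norm (m - g)"
      using norm_triangle_ineq[of "m' - m" "m - g"] lip by (simp add: s_def)
    then have "(norm (m' - g))\<^sup>2 \<le> (l * norm s + norm (m - g))\<^sup>2"
      by (intro power_mono) auto
    \<comment> \<open>The difference of the two sides is half the square of
      \<open>l * norm s - 2 * norm (m - g)\<close>.\<close>
    also have "\<dots> \<le> 3 / 2 * (l * norm s)\<^sup>2 + 3 * V"
      using zero_le_power2[of "l * norm s - 2 * norm (m - g)"]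
      by (simp add: V_def power2_sum power2_diff algebra_simps)
    finally show ?thesis
      by (simp add: D_def power_mult_distrib)
  qed
  have "3 * \<rho> * l * (f w - f p + l / 2 * D) = 3 * \<rho> * l * (f w - f p) + 3 / 2 * \<rho> * l\<^sup>2 * D"
    by (simp add: distrib_left power2_eq_square)
  moreover have "3 / 2 * (1 + \<rho>) * l\<^sup>2 * D = 3 / 2 * l\<^sup>2 * D + 3 / 2 * \<rho> * l\<^sup>2 * D"
    by (simp add: algebra_simps)
  \<comment> \<open>This weakening only brings the coefficient to the form
    \<open>1 + 3 * \<rho>\<close> of the claimed constants.\<close>
  moreover have "3 / 2 * (1 + \<rho>) * l\<^sup>2 * D \<le> 3 / 2 * (1 + 3 * \<rho>) * l\<^sup>2 * D"
    using \<rho> D0 by (intro mult_right_mono mult_left_mono) auto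
  ultimately have dist: "(infdist 0 ((\<lambda>y. m' + y) ` normal_cone p A))\<^sup>2
      \<le> 3 / 2 * (1 + 3 * \<rho>) * l\<^sup>2 * D + 3 * V + 3 * \<rho> * l * (f w - f p)"
    using dist1 dist2 dist3 by linarith
  \<comment> \<open>Chosen so that \<open>c * l\<close> times the left side of \<open>key\<close> is
    the remaining multiple of \<open>D\<close>.\<close>
  define c where "c = 2 * (1 + 3 * \<rho>) / T"
  have "3 / 2 * (1 + 3 * \<rho>) * l\<^sup>2 * D = c * l * (3 / 4 * l * T * D)"
    using T by (simp add: c_def field_simps power2_eq_square)
  also have "\<dots> \<le> c * l * (f w - f p + V / l + 4 / 3 * (\<tau> / \<rho>\<^sup>2) * N / l)"
    using key T l \<rho> by (intro mult_left_mono) (auto simp: c_def)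
  also have "\<dots> = c * l * (f w - f p) + c * V + c * (4 / 3 * (\<tau> / \<rho>\<^sup>2)) * N"
    using l by (simp add: distrib_left)
  finally have "3 / 2 * (1 + 3 * \<rho>) * l\<^sup>2 * D
      \<le> c * l * (f w - f p) + c * V + c * (4 / 3 * (\<tau> / \<rho>\<^sup>2)) * N" .
  with dist show ?thesis
    unfolding V_def[symmetric] N_def[symmetric] T_def[symmetric] c_def[symmetric] distrib_right
    by linarith
qed

section \<open>Independent samples and random iterates\<close>

text \<open>Independence of generated sigma-algebras includes that their members are events. This is
  where the measurability of the random index comes from.\<close>

lemma (in prob_space) random_variable_of_indep_set:
  assumes ind: "indep_set (sets (vimage_algebra (space M) X S)) \<B>"
    and X: "X \<in> space M \<rightarrow> space S"
  shows "X \<in> M \<rightarrow>\<^sub>M S"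
proof (rule measurableI)
  fix B assume "B \<in> sets S"
  moreover have "sets (vimage_algebra (space M) X S) \<subseteq> events"
    using ind unfolding indep_set_def indep_sets_def by (metis (lifting) UNIV_I bool.case(1))
  ultimately show "X -` B \<inter> space M \<in> events"
    using in_vimage_algebra[of B S X "space M"] by auto
qed (use X in auto)

text \<open>Independence makes the joint law a product, and Tonelli then integrates the second
  variable with the first frozen. It serves twice: for the past against the current batch, and for
  the random index against all samples.\<close>

lemma (in prob_space) nn_integral_indep_set:
  assumes [measurable]: "X \<in> M \<rightarrow>\<^sub>M S" "Y \<in> M \<rightarrow>\<^sub>M T"
    and ind: "indep_set (sets (vimage_algebra (space M) X S)) (sets (vimage_algebra (space M) Y T))"
    and [measurable]: "(\<lambda>(x, y). \<Phi> x y) \<in> borel_measurable (S \<Otimes>\<^sub>M T)"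
  shows "(\<integral>\<^sup>+\<omega>. \<Phi> (X \<omega>) (Y \<omega>) \<partial>M) = (\<integral>\<^sup>+\<omega>. \<integral>\<^sup>+\<omega>'. \<Phi> (X \<omega>) (Y \<omega>') \<partial>M \<partial>M)"
proof -
  interpret X: prob_space "distr M S X" by (rule prob_space_distr) measurable
  interpret Y: prob_space "distr M T Y" by (rule prob_space_distr) measurable
  have eq: "distr M S X \<Otimes>\<^sub>M distr M T Y = distr M (S \<Otimes>\<^sub>M T) (\<lambda>\<omega>. (X \<omega>, Y \<omega>))"
  proof (rule pair_measure_eqI)
    fix A B assume "A \<in> sets (distr M S X)" "B \<in> sets (distr M T Y)"
    then have AB[measurable]: "A \<in> sets S" "B \<in> sets T" by simp_all
    have "prob ((X -` A \<inter> space M) \<inter> (Y -` B \<inter> space M)) = prob (X -` A \<inter> space M) * prob (Y -` B \<inter> space M)"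
      by (rule indep_setD[OF ind]) (use AB in \<open>auto intro: in_vimage_algebra\<close>)
    moreover have "(\<lambda>\<omega>. (X \<omega>, Y \<omega>)) -` (A \<times> B) \<inter> space M = (X -` A \<inter> space M) \<inter> (Y -` B \<inter> space M)"
      by auto
    ultimately show "emeasure (distr M S X) A * emeasure (distr M T Y) B
        = emeasure (distr M (S \<Otimes>\<^sub>M T) (\<lambda>\<omega>. (X \<omega>, Y \<omega>))) (A \<times> B)"
      by (simp add: emeasure_distr emeasure_eq_measure ennreal_mult)
  qed (simp_all add: X.sigma_finite_measure_axioms Y.sigma_finite_measure_axioms)
  have "(\<integral>\<^sup>+\<omega>. \<Phi> (X \<omega>) (Y \<omega>) \<partial>M) = (\<integral>\<^sup>+p. (\<lambda>(x, y). \<Phi> x y) p \<partial>distr M (S \<Otimes>\<^sub>M T) (\<lambda>\<omega>. (X \<omega>, Y \<omega>)))"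
    by (subst nn_integral_distr) simp_all
  also have "\<dots> = (\<integral>\<^sup>+p. (\<lambda>(x, y). \<Phi> x y) p \<partial>(distr M S X \<Otimes>\<^sub>M distr M T Y))"
    by (simp add: eq)
  also have "\<dots> = (\<integral>\<^sup>+x. \<integral>\<^sup>+y. \<Phi> x y \<partial>distr M T Y \<partial>distr M S X)"
    by (subst Y.nn_integral_fst[symmetric]) simp_all
  also have "\<dots> = (\<integral>\<^sup>+\<omega>. \<integral>\<^sup>+\<omega>'. \<Phi> (X \<omega>) (Y \<omega>') \<partial>M \<partial>M)"
    by (subst nn_integral_distr, measurable, intro nn_integral_cong, subst nn_integral_distr)
      (auto dest: measurable_space)
  finally show ?thesis .
qed

lemma (in prob_space) integrable_of_square_norm:
  fixes X :: "'a \<Rightarrow> 'b::euclidean_space"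
  assumes [measurable]: "X \<in> borel_measurable M" and sq: "integrable M (\<lambda>\<omega>. (norm (X \<omega>))\<^sup>2)"
  shows "integrable M X"
proof -
  have "integrable M (\<lambda>\<omega>. norm (X \<omega>))"
    by (rule square_integrable_imp_integrable) (use sq in auto)
  then show ?thesis
    by (simp add: integrable_norm_iff)
qed

text \<open>After centering, independence removes the cross terms and leaves a sum of variances,
  each at most \<open>q\<close>; this gives the factor \<open>1 / card I\<close>. The uncentered
  second moment keeps the mean and is bounded only by \<open>q\<close>.\<close>

lemma (in prob_space) second_moments_average:
  fixes X :: "'i \<Rightarrow> 'a \<Rightarrow> 'b::euclidean_space"
  assumes ind: "indep_vars (\<lambda>_. borel) X I" and I: "finite I" "I \<noteq> {}"
    and sq: "\<And>i. i \<in> I \<Longrightarrow> integrable M (\<lambda>\<omega>. (norm (X i \<omega>))\<^sup>2)"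
    and q: "\<And>i. i \<in> I \<Longrightarrow> expectation (\<lambda>\<omega>. (norm (X i \<omega>))\<^sup>2) \<le> q"
    and m: "\<And>i. i \<in> I \<Longrightarrow> expectation (X i) = m"
  defines "S \<equiv> \<lambda>\<omega>. (1 / real (card I)) *\<^sub>R (\<Sum>i\<in>I. X i \<omega>)"
  shows "integrable M (\<lambda>\<omega>. (norm (m - S \<omega>))\<^sup>2)"
    and "expectation (\<lambda>\<omega>. (norm (m - S \<omega>))\<^sup>2) \<le> q / card I"
    and "integrable M (\<lambda>\<omega>. (norm (S \<omega>))\<^sup>2)"
    and "expectation (\<lambda>\<omega>. (norm (S \<omega>))\<^sup>2) \<le> q"
proof -
  let ?n = "real (card I)"
  have n: "?n > 0" using I by (simp add: card_gt_0_iff)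
  have rv[measurable]: "X i \<in> borel_measurable M" if "i \<in> I" for i
    using ind that by (auto simp: indep_vars_def)
  have int: "integrable M (X i)" if "i \<in> I" for i
    using integrable_of_square_norm[OF rv sq] that by simp
  define Y where "Y i \<omega> = X i \<omega> - m" for i \<omega>
  have Ysq_eq: "(norm (Y i \<omega>))\<^sup>2 = (norm (X i \<omega>))\<^sup>2 - 2 * inner (X i \<omega>) m + (norm m)\<^sup>2" for i \<omega>
    unfolding Y_def power2_norm_eq_inner inner_diff_left inner_diff_right by (simp add: inner_commute)
  have Ysq: "integrable M (\<lambda>\<omega>. inner (Y i \<omega>) (Y i \<omega>))" "expectation (\<lambda>\<omega>. inner (Y i \<omega>) (Y i \<omega>)) \<le> q"
    if "i \<in> I" for i
  proof -
    show "integrable M (\<lambda>\<omega>. inner (Y i \<omega>) (Y i \<omega>))"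
      unfolding power2_norm_eq_inner[symmetric] Ysq_eq using sq int that by auto
    have "expectation (\<lambda>\<omega>. inner (Y i \<omega>) (Y i \<omega>)) = expectation (\<lambda>\<omega>. (norm (X i \<omega>))\<^sup>2) - (norm m)\<^sup>2"
      unfolding power2_norm_eq_inner[symmetric] Ysq_eq using sq int m that
      by (simp add: prob_space power2_norm_eq_inner)
    then show "expectation (\<lambda>\<omega>. inner (Y i \<omega>) (Y i \<omega>)) \<le> q"
      using q[OF that] zero_le_power2[of "norm m"] by linarith
  qed
  have cross: "integrable M (\<lambda>\<omega>. inner (Y i \<omega>) (Y j \<omega>))" "expectation (\<lambda>\<omega>. inner (Y i \<omega>) (Y j \<omega>)) = 0"
    if ij: "i \<in> I" "j \<in> I" "i \<noteq> j" for i j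
  proof -
    \<comment> \<open>Independence factors expectations of real products, so the inner product is
      expanded in an orthonormal basis; each coordinate has mean zero.\<close>
    have *: "integrable M (\<lambda>\<omega>. inner (Y i \<omega>) b * inner (Y j \<omega>) b)
        \<and> expectation (\<lambda>\<omega>. inner (Y i \<omega>) b * inner (Y j \<omega>) b) = 0" for b
    proof -
      have "indep_vars (\<lambda>_. borel) (\<lambda>k \<omega>. inner (X k \<omega> - m) b) {i, j}"
        by (rule indep_vars_compose2[OF indep_vars_subset[OF ind]]) (use ij in auto)
      then have ind': "indep_vars (\<lambda>_. borel) (\<lambda>k \<omega>. inner (Y k \<omega>) b) {i, j}"
        by (simp add: Y_def)
      have int': "integrable M (\<lambda>\<omega>. inner (Y k \<omega>) b)" if "k \<in> {i, j}" for k
        using int ij that by (auto simp: Y_def)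
      have "expectation (\<lambda>\<omega>. inner (Y i \<omega>) b) = 0"
        using int[OF ij(1)] m[OF ij(1)] by (simp add: Y_def prob_space)
      then show ?thesis
        using indep_vars_integrable[OF _ ind' int'] indep_vars_lebesgue_integral[OF _ ind' int'] ij(3)
        by simp
    qed
    have eq: "(\<lambda>\<omega>. inner (Y i \<omega>) (Y j \<omega>))
        = (\<lambda>\<omega>. \<Sum>b\<in>Basis. inner (Y i \<omega>) b * inner (Y j \<omega>) b)"
      by (intro ext euclidean_inner)
    show "integrable M (\<lambda>\<omega>. inner (Y i \<omega>) (Y j \<omega>))"
      by (subst eq) (use * in auto)
    show "expectation (\<lambda>\<omega>. inner (Y i \<omega>) (Y j \<omega>)) = 0"
      by (subst eq, subst Bochner_Integration.integral_sum) (use * in auto)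
  qed
  have int2: "integrable M (\<lambda>\<omega>. inner (Y i \<omega>) (Y j \<omega>))" if "i \<in> I" "j \<in> I" for i j
    using cross(1) Ysq(1) that by metis
  have mS: "m - S \<omega> = - (1 / ?n) *\<^sub>R (\<Sum>i\<in>I. Y i \<omega>)" for \<omega>
  proof -
    have "(1 / ?n) *\<^sub>R (\<Sum>i\<in>I. Y i \<omega>) = S \<omega> - (1 / ?n * ?n) *\<^sub>R m"
      unfolding S_def Y_def sum_subtractf sum_constant_scaleR scaleR_diff_right scaleR_scaleR ..
    then show ?thesis
      using n by simp
  qed
  have V_eq: "(norm (m - S \<omega>))\<^sup>2 = (1 / ?n)\<^sup>2 * (\<Sum>i\<in>I. \<Sum>j\<in>I. inner (Y i \<omega>) (Y j \<omega>))" for \<omega>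
    unfolding mS by (simp add: power_mult_distrib power_divide)
      (simp add: power2_norm_eq_inner inner_sum_left inner_sum_right inner_commute)
  show "integrable M (\<lambda>\<omega>. (norm (m - S \<omega>))\<^sup>2)"
    unfolding V_eq using int2 by auto
  have "expectation (\<lambda>\<omega>. (norm (m - S \<omega>))\<^sup>2)
      = (1 / ?n)\<^sup>2 * (\<Sum>i\<in>I. \<Sum>j\<in>I. expectation (\<lambda>\<omega>. inner (Y i \<omega>) (Y j \<omega>)))"
    unfolding V_eq using int2 by simp
  also have "(\<Sum>i\<in>I. \<Sum>j\<in>I. expectation (\<lambda>\<omega>. inner (Y i \<omega>) (Y j \<omega>)))
      = (\<Sum>i\<in>I. \<Sum>j\<in>I. if i = j then expectation (\<lambda>\<omega>. inner (Y i \<omega>) (Y i \<omega>)) else 0)"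
    using cross(2) by (intro sum.cong refl) auto
  also have "\<dots> = (\<Sum>i\<in>I. expectation (\<lambda>\<omega>. inner (Y i \<omega>) (Y i \<omega>)))"
    using I by simp
  also have "\<dots> \<le> ?n * q"
    using Ysq(2) by (intro sum_bounded_above) auto
  finally have "expectation (\<lambda>\<omega>. (norm (m - S \<omega>))\<^sup>2) \<le> (1 / ?n)\<^sup>2 * (?n * q)"
    by (simp add: mult_left_mono)
  then show "expectation (\<lambda>\<omega>. (norm (m - S \<omega>))\<^sup>2) \<le> q / card I"
    using n by (simp add: power2_eq_square)
  \<comment> \<open>Convexity of the squared norm, by Cauchy-Schwarz against the constant vector
    1.\<close>
  have Sle: "(norm (S \<omega>))\<^sup>2 \<le> (1 / ?n) * (\<Sum>i\<in>I. (norm (X i \<omega>))\<^sup>2)" for \<omega>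
  proof -
    have "(norm (\<Sum>i\<in>I. X i \<omega>))\<^sup>2 \<le> (\<Sum>i\<in>I. norm (X i \<omega>))\<^sup>2"
      by (intro power_mono norm_sum) simp
    also have "\<dots> \<le> ?n * (\<Sum>i\<in>I. (norm (X i \<omega>))\<^sup>2)"
      using Cauchy_Schwarz_ineq_sum[of "\<lambda>_. 1" "\<lambda>i. norm (X i \<omega>)" I] by simp
    finally have "(1 / ?n)\<^sup>2 * (norm (\<Sum>i\<in>I. X i \<omega>))\<^sup>2 \<le> (1 / ?n)\<^sup>2 * (?n * (\<Sum>i\<in>I. (norm (X i \<omega>))\<^sup>2))"
      by (intro mult_left_mono) auto
    then show ?thesis
      using n by (simp add: S_def power_mult_distrib power2_eq_square)
  qed
  have int3: "integrable M (\<lambda>\<omega>. (1 / ?n) * (\<Sum>i\<in>I. (norm (X i \<omega>))\<^sup>2))"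
    using sq by auto
  have [measurable]: "S \<in> borel_measurable M"
    unfolding S_def by measurable
  show S2: "integrable M (\<lambda>\<omega>. (norm (S \<omega>))\<^sup>2)"
  proof (rule Bochner_Integration.integrable_bound[OF int3])
    show "AE \<omega> in M. norm ((norm (S \<omega>))\<^sup>2) \<le> norm ((1 / ?n) * (\<Sum>i\<in>I. (norm (X i \<omega>))\<^sup>2))"
      using order_trans[OF Sle abs_ge_self] by (simp only: real_norm_def abs_power2) simp
  qed measurable
  have "expectation (\<lambda>\<omega>. (norm (S \<omega>))\<^sup>2) \<le> expectation (\<lambda>\<omega>. (1 / ?n) * (\<Sum>i\<in>I. (norm (X i \<omega>))\<^sup>2))"
    by (intro integral_mono S2 int3 Sle)
  also have "\<dots> = (1 / ?n) * (\<Sum>i\<in>I. expectation (\<lambda>\<omega>. (norm (X i \<omega>))\<^sup>2))"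
    using sq by simp
  also have "\<dots> \<le> (1 / ?n) * (?n * q)"
    using q by (intro mult_left_mono sum_bounded_above) auto
  finally show "expectation (\<lambda>\<omega>. (norm (S \<omega>))\<^sup>2) \<le> q"
    using n by simp
qed

section \<open>Batch averages and the iteration as a function of the samples\<close>

definition avg :: "nat \<Rightarrow> ('a::real_vector \<Rightarrow> 'b \<Rightarrow> 'a) \<Rightarrow> 'a \<Rightarrow> (nat \<Rightarrow> 'b) \<Rightarrow> 'a" where
  "avg M e w \<zeta> = (1 / real M) *\<^sub>R (\<Sum>i=1..M. e w (\<zeta> i))"

text \<open>The argument counts completed steps, so \<open>iterate ... k\<close> is the algorithm's
  point number \<open>k + 1\<close>; the step leading to \<open>Suc k\<close> uses row
  \<open>Suc k\<close> of the samples. Having the whole array \<open>z\<close> as an argument makes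
  a path a measurable function on a product space.\<close>

primrec iterate ::
  "(nat \<Rightarrow> 'a \<Rightarrow> 'a) \<Rightarrow> real \<Rightarrow> nat \<Rightarrow> ('a::real_vector \<Rightarrow> 'b \<Rightarrow> 'a) \<Rightarrow> 'a \<Rightarrow> (nat \<times> nat \<Rightarrow> 'b) \<Rightarrow> nat \<Rightarrow> 'a"
where
  "iterate sel \<eta> M e w z 0 = w"
| "iterate sel \<eta> M e w z (Suc k) = sel (Suc k)
     (iterate sel \<eta> M e w z k - \<eta> *\<^sub>R avg M e (iterate sel \<eta> M e w z k) (\<lambda>i. z (Suc k, i)))"

lemma avg_cong:
  "(\<And>i. i \<in> {1..M} \<Longrightarrow> \<zeta> i = \<zeta>' i) \<Longrightarrow> avg M e w \<zeta> = avg M e w \<zeta>'"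
  unfolding avg_def by (metis (no_types, lifting) sum.cong)

text \<open>Nonanticipation: after \<open>n\<close> steps only the first \<open>n\<close> rows have
  been read. This permits restriction to finite products and separates the past from the next
  batch.\<close>

lemma iterate_cong:
  assumes "\<And>k i. k \<in> {1..n} \<Longrightarrow> i \<in> {1..M} \<Longrightarrow> z (k, i) = z' (k, i)"
  shows "iterate sel \<eta> M e w z n = iterate sel \<eta> M e w z' n"
  using assms
proof (induction n)
  case (Suc n)
  have "iterate sel \<eta> M e w z n = iterate sel \<eta> M e w z' n"
    by (rule Suc.IH) (use Suc.prems in auto)
  moreover have "avg M e v (\<lambda>i. z (Suc n, i)) = avg M e v (\<lambda>i. z' (Suc n, i))" for v
    by (rule avg_cong) (use Suc.prems in auto)
  ultimately show ?case by simp
qed simp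

lemma iterate_mem:
  "w \<in> A \<Longrightarrow> (\<And>k x. sel k x \<in> A) \<Longrightarrow> iterate sel \<eta> M e w z n \<in> A"
  by (cases n) auto

lemma measurable_avg:
  fixes e :: "'a::euclidean_space \<Rightarrow> 'b \<Rightarrow> 'a"
  assumes e: "(\<lambda>(w, s). e w s) \<in> borel_measurable (borel \<Otimes>\<^sub>M N)"
    and X: "X \<in> borel_measurable L" and Z: "\<And>i. i \<in> {1..M} \<Longrightarrow> Z i \<in> L \<rightarrow>\<^sub>M N"
  shows "(\<lambda>x. avg M e (X x) (\<lambda>i. Z i x)) \<in> borel_measurable L"
proof -
  have "(\<lambda>x. e (X x) (Z i x)) \<in> borel_measurable L" if "i \<in> {1..M}" for i
    using measurable_compose[OF measurable_Pair[OF X Z[OF that]] e] by simp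
  then show ?thesis
    unfolding avg_def by (intro borel_measurable_scaleR borel_measurable_sum) auto
qed

lemma measurable_iterate:
  fixes e :: "'a::euclidean_space \<Rightarrow> 'b \<Rightarrow> 'a"
  assumes e: "(\<lambda>(w, s). e w s) \<in> borel_measurable (borel \<Otimes>\<^sub>M N)"
    and sel: "\<And>k. sel k \<in> borel_measurable borel"
    and J: "{1..n} \<times> {1..M} \<subseteq> J"
  shows "(\<lambda>z. iterate sel \<eta> M e w z n) \<in> borel_measurable (PiM J (\<lambda>_. N))"
  using J
proof (induction n)
  case (Suc n)
  have IH: "(\<lambda>z. iterate sel \<eta> M e w z n) \<in> borel_measurable (PiM J (\<lambda>_. N))"
    by (rule Suc.IH) (use Suc.prems in auto)
  have "(\<lambda>z. avg M e (iterate sel \<eta> M e w z n) (\<lambda>i. z (Suc n, i))) \<in> borel_measurable (PiM J (\<lambda>_. N))"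
    using Suc.prems by (intro measurable_avg[OF e IH] measurable_component_singleton) auto
  with IH show ?case
    by (auto intro!: measurable_compose[OF _ sel])
qed simp

text \<open>The iterate reads the rows up to \<open>k\<close> and the batch is row
  \<open>k + 1\<close>; these disjoint blocks are independent. The iterate can therefore be frozen
  at a point of \<open>A\<close>, where a bound uniform over \<open>A\<close> is available.\<close>

lemma (in prob_space) nn_integral_iterate_le:
  fixes e :: "'c::euclidean_space \<Rightarrow> 'b \<Rightarrow> 'c"
  assumes ind: "indep_vars (\<lambda>_. N) Z ({1..K} \<times> {1..n})"
    and e: "(\<lambda>(w, s). e w s) \<in> borel_measurable (borel \<Otimes>\<^sub>M N)"
    and sel: "\<And>k. sel k \<in> borel_measurable borel" "\<And>k x. sel k x \<in> A" and w: "w \<in> A"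
    and \<Psi>: "(\<lambda>(w, \<zeta>). \<Psi> w \<zeta>) \<in> borel_measurable (borel \<Otimes>\<^sub>M PiM {1..n} (\<lambda>_. N))"
    and le: "\<And>w. w \<in> A \<Longrightarrow> (\<integral>\<^sup>+\<omega>. \<Psi> w (\<lambda>i\<in>{1..n}. Z (Suc k, i) \<omega>) \<partial>M) \<le> c"
    and k: "Suc k \<le> K"
  shows "(\<integral>\<^sup>+\<omega>. \<Psi> (iterate sel \<eta> n e w (\<lambda>j. Z j \<omega>) k) (\<lambda>i\<in>{1..n}. Z (Suc k, i) \<omega>) \<partial>M) \<le> c"
proof -
  define P B where "P = {1..k} \<times> {1..n}" and "B = {Suc k} \<times> {1..n}"
  define \<Phi> where "\<Phi> x y = \<Psi> (iterate sel \<eta> n e w x k) (\<lambda>i\<in>{1..n}. y (Suc k, i))" for x y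
  have ind2: "indep_var (PiM P (\<lambda>_. N)) (\<lambda>\<omega>. \<lambda>j\<in>P. Z j \<omega>) (PiM B (\<lambda>_. N)) (\<lambda>\<omega>. \<lambda>j\<in>B. Z j \<omega>)"
    by (rule indep_var_restrict[OF ind]) (use k in \<open>auto simp: P_def B_def\<close>)
  have 1: "(\<lambda>p. iterate sel \<eta> n e w (fst p) k) \<in> borel_measurable (PiM P (\<lambda>_. N) \<Otimes>\<^sub>M PiM B (\<lambda>_. N))"
    by (rule measurable_compose[OF measurable_fst measurable_iterate[OF e sel(1)]]) (simp add: P_def)
  have 2: "(\<lambda>p. \<lambda>i\<in>{1..n}. snd p (Suc k, i)) \<in> (PiM P (\<lambda>_. N) \<Otimes>\<^sub>M PiM B (\<lambda>_. N)) \<rightarrow>\<^sub>M PiM {1..n} (\<lambda>_. N)"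
    by (intro measurable_restrict measurable_compose[OF measurable_snd measurable_component_singleton])
      (auto simp: B_def)
  have \<Phi>: "(\<lambda>(x, y). \<Phi> x y) \<in> borel_measurable (PiM P (\<lambda>_. N) \<Otimes>\<^sub>M PiM B (\<lambda>_. N))"
    using measurable_compose[OF measurable_Pair[OF 1 2] \<Psi>] by (simp add: \<Phi>_def case_prod_beta)
  have B: "(\<lambda>i\<in>{1..n}. (\<lambda>j\<in>B. Z j \<omega>) (Suc k, i)) = (\<lambda>i\<in>{1..n}. Z (Suc k, i) \<omega>)" for \<omega>
    by (auto simp: B_def)
  have P: "iterate sel \<eta> n e w (\<lambda>j\<in>P. Z j \<omega>) k = iterate sel \<eta> n e w (\<lambda>j. Z j \<omega>) k" for \<omega>
    by (rule iterate_cong) (auto simp: P_def)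
  have "(\<integral>\<^sup>+\<omega>. \<Phi> (\<lambda>j\<in>P. Z j \<omega>) (\<lambda>j\<in>B. Z j \<omega>) \<partial>M)
      = (\<integral>\<^sup>+\<omega>. \<integral>\<^sup>+\<omega>'. \<Phi> (\<lambda>j\<in>P. Z j \<omega>) (\<lambda>j\<in>B. Z j \<omega>') \<partial>M \<partial>M)"
    by (rule nn_integral_indep_set[OF _ _ _ \<Phi>])
      (use ind2[unfolded indep_var_eq] in \<open>auto simp: sets_vimage_algebra\<close>)
  also have "\<dots> \<le> (\<integral>\<^sup>+\<omega>. c \<partial>M)"
    unfolding \<Phi>_def B P by (intro nn_integral_mono le iterate_mem[OF w sel(2)])
  also have "\<dots> = c"
    by (simp add: emeasure_space_1)
  finally show ?thesis
    unfolding \<Phi>_def B P .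
qed

text \<open>The decrease of \<open>\<phi>\<close> telescopes along every path, so that only the second moments of the
  estimator have to be integrated.\<close>

lemma (in prob_space) nn_integral_random_iterate_le:
  fixes e :: "'c::euclidean_space \<Rightarrow> 'b \<Rightarrow> 'c" and H \<phi> :: "'c \<Rightarrow> real" and m :: "'c \<Rightarrow> 'c"
  assumes ind: "indep_vars (\<lambda>_. N) Z ({1..K} \<times> {1..n})"
    and e: "(\<lambda>(w, s). e w s) \<in> borel_measurable (borel \<Otimes>\<^sub>M N)"
    and sel: "\<And>k. sel k \<in> borel_measurable borel" "\<And>k x. sel k x \<in> A"
    and A: "closed A" "w \<in> A"
    and cont: "continuous_on A \<phi>" "continuous_on A m"
    and moments: "\<And>v j. v \<in> A \<Longrightarrow> j \<in> {1..K} \<times> {1..n} \<Longrightarrow> integrable M (\<lambda>\<omega>. (norm (e v (Z j \<omega>)))\<^sup>2)"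
      "\<And>v j. v \<in> A \<Longrightarrow> j \<in> {1..K} \<times> {1..n} \<Longrightarrow> expectation (\<lambda>\<omega>. (norm (e v (Z j \<omega>)))\<^sup>2) \<le> q"
      "\<And>v j. v \<in> A \<Longrightarrow> j \<in> {1..K} \<times> {1..n} \<Longrightarrow> expectation (\<lambda>\<omega>. e v (Z j \<omega>)) = m v"
    and H0: "\<And>p. 0 \<le> H p"
    and step: "\<And>k v g. v \<in> A \<Longrightarrow> H (sel k (v - \<eta> *\<^sub>R g))
        \<le> c * (\<phi> v - \<phi> (sel k (v - \<eta> *\<^sub>R g))) + a * (norm (m v - g))\<^sup>2 + b * (norm g)\<^sup>2"
    and \<Delta>: "\<And>v. v \<in> A \<Longrightarrow> \<phi> w - \<phi> v \<le> \<Delta>"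
    and nonneg: "0 \<le> c" "0 \<le> a" "0 \<le> b" "0 \<le> q" and KM: "K > 0" "n > 0"
    and R: "indep_set (sets (vimage_algebra (space M) R (count_space UNIV)))
        (sets (vimage_algebra (space M) (\<lambda>\<omega>. \<lambda>j\<in>{1..K} \<times> {1..n}. Z j \<omega>) (PiM ({1..K} \<times> {1..n}) (\<lambda>_. N))))"
      "distr M (count_space UNIV) R = measure_pmf (pmf_of_set {2..K + 1})"
  shows "(\<integral>\<^sup>+\<omega>. ennreal (H (iterate sel \<eta> n e w (\<lambda>j. Z j \<omega>) (R \<omega> - 1))) \<partial>M)
    \<le> ennreal (c * \<Delta> / real K + (a * (q / real n) + b * q))"
proof -
  define J where "J = {1..K} \<times> {1..n}"
  let ?N = "PiM J (\<lambda>_. N)"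
  define it where "it = iterate sel \<eta> n e w"
  define ba :: "nat \<Rightarrow> (nat \<times> nat \<Rightarrow> 'b) \<Rightarrow> nat \<Rightarrow> 'b" where "ba k z = (\<lambda>i\<in>{1..n}. z (Suc k, i))" for k z
  \<comment> \<open>\<open>m\<close> and \<open>\<phi>\<close> are continuous only on the closed set
    \<open>A\<close>; the indicators make them Borel on the whole space and change nothing along the
    iterates.\<close>
  define \<Psi> where "\<Psi> v \<zeta> = a * (norm (indicator A v *\<^sub>R m v - avg n e v \<zeta>))\<^sup>2 + b * (norm (avg n e v \<zeta>))\<^sup>2"
    for v \<zeta>
  \<comment> \<open>The measurable majorant of \<open>H\<close> at iterate \<open>k + 1\<close>,
    obtained by inserting the step inequality; \<open>H\<close> itself is never split or transported
    by independence.\<close>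
  define h where "h k z = c * (indicator A (it z k) *\<^sub>R \<phi> (it z k) - indicator A (it z (Suc k)) *\<^sub>R \<phi> (it z (Suc k)))
    + \<Psi> (it z k) (ba k z)" for k z
  define s where "s = a * (q / real n) + b * q"
  have itA: "it z k \<in> A" for z k
    unfolding it_def by (rule iterate_mem) (use A sel in auto)
  have s0: "0 \<le> s"
    using nonneg by (simp add: s_def)
  have \<Delta>0: "0 \<le> \<Delta>"
    using \<Delta>[OF A(2)] by simp
  have \<Psi>0: "0 \<le> \<Psi> v \<zeta>" for v \<zeta>
    using nonneg by (simp add: \<Psi>_def)
  have it_Suc: "it z (Suc k) = sel (Suc k) (it z k - \<eta> *\<^sub>R avg n e (it z k) (ba k z))" for z k
  proof -
    have "avg n e v (ba k z) = avg n e v (\<lambda>i. z (Suc k, i))" for v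
      by (rule avg_cong) (simp add: ba_def)
    then show ?thesis by (simp add: it_def)
  qed
  have Hh: "H (it z (Suc k)) \<le> h k z" for z k
    using step[of "it z k" "Suc k" "avg n e (it z k) (ba k z)"] itA[of z k] itA[of z "Suc k"]
    by (simp add: h_def \<Psi>_def it_Suc)
  \<comment> \<open>The sign comes from \<open>H\<close>, since \<open>\<phi>\<close> may increase
    in a single step. It allows real sums and \<open>ennreal\<close> sums to be exchanged.\<close>
  have h0: "0 \<le> h k z" for z k
    using H0 Hh order_trans by blast
  have [measurable]: "A \<in> sets borel"
    using A by auto
  have m_meas[measurable]: "(\<lambda>v. indicator A v *\<^sub>R m v) \<in> borel_measurable borel"
    and \<phi>_meas[measurable]: "(\<lambda>v. indicator A v *\<^sub>R \<phi> v) \<in> borel_measurable borel"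
    by (intro borel_measurable_continuous_on_indicator cont; simp)+
  have it_meas[measurable]: "(\<lambda>z. it z k) \<in> borel_measurable ?N" if "k \<le> K" for k
    unfolding it_def by (rule measurable_iterate[OF e sel(1)]) (use that in \<open>auto simp: J_def\<close>)
  have ba_meas[measurable]: "ba k \<in> ?N \<rightarrow>\<^sub>M PiM {1..n} (\<lambda>_. N)" if "k < K" for k
    unfolding ba_def using that
    by (intro measurable_restrict measurable_component_singleton) (auto simp: J_def)
  have avg_meas: "(\<lambda>p. avg n e (fst p) (snd p)) \<in> borel_measurable (borel \<Otimes>\<^sub>M PiM {1..n} (\<lambda>_. N))"
    by (rule measurable_avg[OF e measurable_fst])
      (auto intro!: measurable_compose[OF measurable_snd measurable_component_singleton])
  have \<Psi>_meas: "(\<lambda>(v, \<zeta>). \<Psi> v \<zeta>) \<in> borel_measurable (borel \<Otimes>\<^sub>M PiM {1..n} (\<lambda>_. N))"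
    unfolding \<Psi>_def case_prod_beta using avg_meas measurable_compose[OF measurable_fst m_meas] by measurable
  have \<Psi>'_meas: "(\<lambda>z. \<Psi> (it z k) (ba k z)) \<in> borel_measurable ?N" if "k < K" for k
    using measurable_compose[OF measurable_Pair[OF it_meas ba_meas] \<Psi>_meas, of k k] that by simp
  have h_meas: "h k \<in> borel_measurable ?N" if "k < K" for k
    unfolding h_def
    by (intro borel_measurable_add borel_measurable_times borel_measurable_diff borel_measurable_const
        \<Psi>'_meas measurable_compose[OF it_meas \<phi>_meas]) (use that in auto)
  have ZM: "(\<lambda>\<omega>. \<lambda>j\<in>J. Z j \<omega>) \<in> M \<rightarrow>\<^sub>M ?N"
    using ind unfolding J_def by (auto intro!: measurable_restrict simp: indep_vars_def)
  have RM: "R \<in> M \<rightarrow>\<^sub>M count_space UNIV"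
    by (rule random_variable_of_indep_set[OF R(1)]) simp

  have noise: "(\<integral>\<^sup>+\<omega>. ennreal (\<Psi> v (\<lambda>i\<in>{1..n}. Z (Suc k, i) \<omega>)) \<partial>M) \<le> ennreal s"
    if v: "v \<in> A" and k: "Suc k \<le> K" for v k
  proof -
    have J: "(Suc k, i) \<in> {1..K} \<times> {1..n}" if "i \<in> {1..n}" for i
      using k that by auto
    have ind': "indep_vars (\<lambda>_. borel) (\<lambda>i \<omega>. e v (Z (Suc k, i) \<omega>)) {1..n}"
    proof -
      \<comment> \<open>Singleton blocks carry independence from the array indexed by pairs to the
        single row indexed by \<open>i\<close>.\<close>
      have "indep_vars (\<lambda>i. PiM {(Suc k, i)} (\<lambda>_. N)) (\<lambda>i \<omega>. \<lambda>j\<in>{(Suc k, i)}. Z j \<omega>) {1..n}"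
        by (rule indep_vars_restrict[OF ind]) (use k in \<open>auto simp: disjoint_family_on_def\<close>)
      moreover have "(\<lambda>f. e v (f (Suc k, i))) \<in> borel_measurable (PiM {(Suc k, i)} (\<lambda>_. N))" for i
      proof (rule measurable_compose[where g = "e v"])
        show "(\<lambda>f. f (Suc k, i)) \<in> PiM {(Suc k, i)} (\<lambda>_. N) \<rightarrow>\<^sub>M N"
          by (rule measurable_component_singleton) simp
        show "e v \<in> borel_measurable N"
          using measurable_Pair2[OF e, of v] by simp
      qed
      ultimately have "indep_vars (\<lambda>_. borel) (\<lambda>i \<omega>. e v ((\<lambda>j\<in>{(Suc k, i)}. Z j \<omega>) (Suc k, i))) {1..n}"
        by (rule indep_vars_compose2[where Y = "\<lambda>i f. e v (f (Suc k, i))"])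
      then show ?thesis by simp
    qed
    define X where "X \<omega> = (1 / real (card {1..n})) *\<^sub>R (\<Sum>i\<in>{1..n}. e v (Z (Suc k, i) \<omega>))" for \<omega>
    have S: "integrable M (\<lambda>\<omega>. (norm (m v - X \<omega>))\<^sup>2)"
      "expectation (\<lambda>\<omega>. (norm (m v - X \<omega>))\<^sup>2) \<le> q / card {1..n}"
      "integrable M (\<lambda>\<omega>. (norm (X \<omega>))\<^sup>2)" "expectation (\<lambda>\<omega>. (norm (X \<omega>))\<^sup>2) \<le> q"
      unfolding X_def
      by (rule second_moments_average[OF ind' _ _ moments[OF v J]]; use KM in simp)+
    have X_eq: "avg n e v (\<lambda>i\<in>{1..n}. Z (Suc k, i) \<omega>) = X \<omega>" for \<omega>
      by (simp add: X_def avg_def)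
    have "(\<integral>\<^sup>+\<omega>. ennreal (\<Psi> v (\<lambda>i\<in>{1..n}. Z (Suc k, i) \<omega>)) \<partial>M)
        = ennreal (expectation (\<lambda>\<omega>. a * (norm (m v - X \<omega>))\<^sup>2 + b * (norm (X \<omega>))\<^sup>2))"
      unfolding \<Psi>_def X_eq using v S nonneg
      by (subst nn_integral_eq_integral) auto
    also have "\<dots> \<le> ennreal s"
    proof (rule ennreal_leI)
      have "expectation (\<lambda>\<omega>. a * (norm (m v - X \<omega>))\<^sup>2 + b * (norm (X \<omega>))\<^sup>2)
          = a * expectation (\<lambda>\<omega>. (norm (m v - X \<omega>))\<^sup>2) + b * expectation (\<lambda>\<omega>. (norm (X \<omega>))\<^sup>2)"
        using S by simp
      also have "\<dots> \<le> s"
        unfolding s_def using S nonneg by (intro add_mono mult_left_mono) auto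
      finally show "expectation (\<lambda>\<omega>. a * (norm (m v - X \<omega>))\<^sup>2 + b * (norm (X \<omega>))\<^sup>2) \<le> s" .
    qed
    finally show ?thesis .
  qed
  have noise': "(\<integral>\<^sup>+\<omega>. ennreal (\<Psi> (it (\<lambda>j\<in>J. Z j \<omega>) k) (ba k (\<lambda>j\<in>J. Z j \<omega>))) \<partial>M) \<le> ennreal s" if k: "k < K" for k
  proof -
    have "it (\<lambda>j\<in>J. Z j \<omega>) k = it (\<lambda>j. Z j \<omega>) k" for \<omega>
      unfolding it_def by (rule iterate_cong) (use k in \<open>auto simp: J_def\<close>)
    moreover have "ba k (\<lambda>j\<in>J. Z j \<omega>) = (\<lambda>i\<in>{1..n}. Z (Suc k, i) \<omega>)" for \<omega>
      using k by (auto simp: ba_def J_def)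
    moreover have "(\<integral>\<^sup>+\<omega>. ennreal (\<Psi> (it (\<lambda>j. Z j \<omega>) k) (\<lambda>i\<in>{1..n}. Z (Suc k, i) \<omega>)) \<partial>M) \<le> ennreal s"
      unfolding it_def
      by (rule nn_integral_iterate_le[OF ind e sel A(2), where \<Psi> = "\<lambda>v \<zeta>. ennreal (\<Psi> v \<zeta>)"])
        (use k noise \<Psi>_meas in \<open>auto simp: case_prod_beta\<close>)
    ultimately show ?thesis by simp
  qed
  have total: "(\<Sum>k<K. \<integral>\<^sup>+\<omega>. ennreal (h k (\<lambda>j\<in>J. Z j \<omega>)) \<partial>M) \<le> ennreal (c * \<Delta> + real K * s)"
  proof -
    have tel: "(\<Sum>k<K. h k z) \<le> c * \<Delta> + (\<Sum>k<K. \<Psi> (it z k) (ba k z))" for z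
    proof -
      have "(\<Sum>k<K. h k z) = c * (\<Sum>k<K. \<phi> (it z k) - \<phi> (it z (Suc k))) + (\<Sum>k<K. \<Psi> (it z k) (ba k z))"
        using itA by (simp add: h_def sum.distrib sum_distrib_left)
      also have "(\<Sum>k<K. \<phi> (it z k) - \<phi> (it z (Suc k))) = \<phi> w - \<phi> (it z K)"
        by (subst sum_lessThan_telescope') (simp add: it_def)
      finally show ?thesis
        using mult_left_mono[OF \<Delta>[OF itA] nonneg(1)] by simp
    qed
    have "(\<Sum>k<K. \<integral>\<^sup>+\<omega>. ennreal (h k (\<lambda>j\<in>J. Z j \<omega>)) \<partial>M) = (\<integral>\<^sup>+\<omega>. (\<Sum>k<K. ennreal (h k (\<lambda>j\<in>J. Z j \<omega>))) \<partial>M)"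
      by (rule nn_integral_sum[symmetric]) (use measurable_compose[OF ZM h_meas] in auto)
    also have "\<dots> = (\<integral>\<^sup>+\<omega>. ennreal (\<Sum>k<K. h k (\<lambda>j\<in>J. Z j \<omega>)) \<partial>M)"
      using h0 by (simp add: sum_ennreal)
    also have "\<dots> \<le> (\<integral>\<^sup>+\<omega>. ennreal (c * \<Delta>)
        + (\<Sum>k<K. ennreal (\<Psi> (it (\<lambda>j\<in>J. Z j \<omega>) k) (ba k (\<lambda>j\<in>J. Z j \<omega>)))) \<partial>M)"
      using tel \<Psi>0 \<Delta>0 nonneg
      by (intro nn_integral_mono) (simp add: sum_ennreal ennreal_leI sum_nonneg flip: ennreal_plus)
    also have "\<dots> = ennreal (c * \<Delta>)
        + (\<Sum>k<K. \<integral>\<^sup>+\<omega>. ennreal (\<Psi> (it (\<lambda>j\<in>J. Z j \<omega>) k) (ba k (\<lambda>j\<in>J. Z j \<omega>))) \<partial>M)"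
      using measurable_compose[OF ZM \<Psi>'_meas]
      by (subst nn_integral_add, simp, simp, subst nn_integral_sum) (auto simp: emeasure_space_1)
    also have "\<dots> \<le> ennreal (c * \<Delta>) + (\<Sum>k<K. ennreal s)"
      by (intro add_mono sum_mono noise') auto
    also have "\<dots> = ennreal (c * \<Delta> + real K * s)"
      using s0 \<Delta>0 nonneg by (subst sum_ennreal) (simp_all flip: ennreal_plus)
    finally show ?thesis .
  qed

  \<comment> \<open>The point number \<open>r\<close> is iterate \<open>r - 1\<close>, which is
    majorized by \<open>h (r - 2)\<close>. The value 0 off the range of the random index makes
    \<open>\<Phi> r\<close> measurable for every natural number \<open>r\<close>.\<close>
  define \<Phi> where "\<Phi> r z = (if r \<in> {2..K + 1} then ennreal (h (r - 2) z) else 0)" for r z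
  have \<Phi>_meas: "(\<lambda>(r, z). \<Phi> r z) \<in> borel_measurable (count_space UNIV \<Otimes>\<^sub>M ?N)"
  proof (rule measurable_pair_measure_countable1)
    show "(\<lambda>z. case (r, z) of (r, z) \<Rightarrow> \<Phi> r z) \<in> borel_measurable ?N" for r
      using h_meas[of "r - 2"] by (cases "r \<in> {2..K + 1}") (auto simp: \<Phi>_def)
  qed simp
  have "AE \<omega> in M. R \<omega> \<in> {2..K + 1}"
  proof -
    have "AE r in distr M (count_space UNIV) R. r \<in> {2..K + 1}"
      unfolding R(2) by (rule AE_pmfI) (use KM in simp)
    then show ?thesis
      using AE_distrD[OF RM] by blast
  qed
  then have "(\<integral>\<^sup>+\<omega>. ennreal (H (it (\<lambda>j. Z j \<omega>) (R \<omega> - 1))) \<partial>M) \<le> (\<integral>\<^sup>+\<omega>. \<Phi> (R \<omega>) (\<lambda>j\<in>J. Z j \<omega>) \<partial>M)"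
  proof (intro nn_integral_mono_AE, eventually_elim)
    case (elim \<omega>)
    have "it (\<lambda>j. Z j \<omega>) (R \<omega> - 1) = it (\<lambda>j\<in>J. Z j \<omega>) (Suc (R \<omega> - 2))"
    proof -
      have "R \<omega> - 1 = Suc (R \<omega> - 2)" using elim by auto
      moreover have "it (\<lambda>j. Z j \<omega>) (R \<omega> - 1) = it (\<lambda>j\<in>J. Z j \<omega>) (R \<omega> - 1)"
        unfolding it_def by (rule iterate_cong) (use elim in \<open>auto simp: J_def\<close>)
      ultimately show ?thesis by simp
    qed
    then show ?case
      using Hh elim by (simp add: \<Phi>_def ennreal_leI)
  qed
  also have "\<dots> = (\<integral>\<^sup>+\<omega>. \<integral>\<^sup>+\<omega>'. \<Phi> (R \<omega>) (\<lambda>j\<in>J. Z j \<omega>') \<partial>M \<partial>M)"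
    by (rule nn_integral_indep_set[OF RM ZM R(1)[folded J_def] \<Phi>_meas])
  also have "\<dots> = (\<integral>\<^sup>+r. (\<integral>\<^sup>+\<omega>'. \<Phi> r (\<lambda>j\<in>J. Z j \<omega>') \<partial>M) \<partial>measure_pmf (pmf_of_set {2..K + 1}))"
    unfolding R(2)[symmetric] by (rule nn_integral_distr[symmetric, OF RM]) simp
  also have "\<dots> = (\<Sum>r\<in>{2..K + 1}. \<integral>\<^sup>+\<omega>'. \<Phi> r (\<lambda>j\<in>J. Z j \<omega>') \<partial>M) / ennreal (real K)"
    using KM by (subst nn_integral_pmf_of_set) (auto simp: ennreal_of_nat_eq_real_of_nat)
  also have "(\<Sum>r\<in>{2..K + 1}. \<integral>\<^sup>+\<omega>'. \<Phi> r (\<lambda>j\<in>J. Z j \<omega>') \<partial>M)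
      = (\<Sum>k<K. \<integral>\<^sup>+\<omega>. ennreal (h k (\<lambda>j\<in>J. Z j \<omega>)) \<partial>M)"
    by (rule sum.reindex_bij_witness[of _ "\<lambda>k. k + 2" "\<lambda>r. r - 2"]) (auto simp: \<Phi>_def)
  also have "\<dots> / ennreal (real K) \<le> ennreal (c * \<Delta> + real K * s) / ennreal (real K)"
    by (rule divide_right_mono_ennreal[OF total])
  also have "\<dots> = ennreal (c * \<Delta> / real K + s)"
    using KM s0 \<Delta>0 nonneg by (subst divide_ennreal) (simp_all add: add_divide_distrib)
  finally show ?thesis
    by (simp add: it_def s_def)
qed

section \<open>Integration over a cube\<close>

text \<open>Overwriting a coordinate expresses averages over the remaining coordinates as integrals
  over the full cube, which is exactly how the finite difference discards
  \<open>u $ i\<close>.\<close>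

definition upd_coord :: "'n \<Rightarrow> real \<Rightarrow> real ^ 'n \<Rightarrow> real ^ 'n" where
  "upd_coord i b v = (\<chi> j. if j = i then b else v $ j)"

lemma upd_coord_nth: "upd_coord i b v $ j = (if j = i then b else v $ j)"
  by (simp add: upd_coord_def)

lemma continuous_on_upd_coord [continuous_intros]:
  assumes "continuous_on A f" "continuous_on A g"
  shows "continuous_on A (\<lambda>x. upd_coord i (f x) (g x))"
  unfolding upd_coord_def
proof (rule continuous_on_vec_lambda)
  show "continuous_on A (\<lambda>x. if j = i then f x else g x $ j)" for j
    using assms by (cases "j = i") (auto intro!: continuous_intros)
qed

lemma measurable_upd_coord [measurable (raw)]:
  fixes f :: "'b \<Rightarrow> real" and g :: "'b \<Rightarrow> real ^ 'n"
  assumes "f \<in> borel_measurable M" "g \<in> borel_measurable M"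
  shows "(\<lambda>x. upd_coord i (f x) (g x)) \<in> borel_measurable M"
proof -
  have "(\<lambda>p. upd_coord i (fst p) (snd p)) \<in> borel_measurable (borel :: (real \<times> (real ^ 'n)) measure)"
    by (intro borel_measurable_continuous_onI continuous_intros)
  then show ?thesis
    using measurable_compose[OF borel_measurable_Pair[OF assms], of "\<lambda>p. upd_coord i (fst p) (snd p)" borel]
    by simp
qed

text \<open>The map is affine and diagonal, stretching only direction \<open>i\<close>, so its
  Jacobian is \<open>r\<close>. A thin slab is rescaled to a full cube this way.\<close>

lemma lborel_integral_scale_coord:
  fixes \<psi> :: "real ^ 'n \<Rightarrow> real"
  assumes r: "r > 0" and \<psi>: "\<psi> \<in> borel_measurable borel"
  shows "(\<integral>v. \<psi> v \<partial>lborel) = r * (\<integral>v. \<psi> (upd_coord i (c + r * v $ i) v) \<partial>lborel)"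
proof -
  define s where "s b = (if b = axis i 1 then r else 1)" for b :: "real ^ 'n"
  define T where "T x = axis i c + (\<Sum>b\<in>Basis. (s b * (x \<bullet> b)) *\<^sub>R b)" for x :: "real ^ 'n"
  have T: "T x = upd_coord i (c + r * x $ i) x" for x
  proof -
    have "T x $ j = axis i c $ j + s (axis j 1) * x $ j" for j
    proof -
      have "T x \<bullet> axis j 1 = axis i c \<bullet> axis j 1 + s (axis j 1) * (x \<bullet> axis j 1)"
        unfolding T_def inner_add_left by (subst inner_sum_left_Basis) (auto simp: axis_in_Basis_iff)
      then show ?thesis by (simp flip: cart_eq_inner_axis)
    qed
    then show ?thesis
      by (auto simp: vec_eq_iff upd_coord_nth s_def axis_eq_axis axis_def)
  qed
  have meas: "T \<in> borel_measurable borel"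
    unfolding T by measurable
  have "(\<Prod>b\<in>(Basis :: (real ^ 'n) set). \<bar>s b\<bar>) = (\<Prod>b\<in>(Basis :: (real ^ 'n) set). if b = axis i 1 then r else 1)"
    using r by (intro prod.cong) (auto simp: s_def)
  also have "\<dots> = r"
    by (simp add: axis_in_Basis_iff)
  finally have prod: "(\<Prod>b\<in>(Basis :: (real ^ 'n) set). \<bar>s b\<bar>) = r" .
  have "lborel = density (distr lborel borel T) (\<lambda>_. (\<Prod>b\<in>Basis. \<bar>s b\<bar>))"
    unfolding T_def by (rule lborel_affine_euclidean) (use r in \<open>auto simp: s_def\<close>)
  then have "(\<integral>v. \<psi> v \<partial>lborel) = (\<integral>v. \<psi> v \<partial>density (distr lborel borel T) (\<lambda>_. ennreal r))"
    unfolding prod by simp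
  also have "\<dots> = (\<integral>v. r * \<psi> v \<partial>distr lborel borel T)"
    using r \<psi> by (subst integral_density) auto
  also have "\<dots> = (\<integral>v. r * \<psi> (T v) \<partial>lborel)"
    using \<psi> meas by (subst integral_distr) auto
  finally show ?thesis
    by (simp add: T)
qed

lemma cube_ereal: "cube (ereal a) = {z :: real ^ 'n. \<forall>i. \<bar>z $ i\<bar> \<le> a}"
  by (simp add: cube_def)

lemma abs_le_interval_iff: "\<bar>x\<bar> \<le> a \<longleftrightarrow> - a \<le> x \<and> x \<le> a" for x a :: real
  by auto

lemma cube_eq_cbox: "cube (ereal a) = cbox (\<chi> i. - a) (\<chi> i. a :: real ^ 'n)"
  by (auto simp: cube_ereal mem_box_cart abs_le_interval_iff)

lemma compact_cube [simp]: "compact (cube (ereal a))"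
  by (simp add: cube_eq_cbox)

lemma cube_borel [measurable]: "cube (ereal a) \<in> sets borel"
  by (simp add: cube_eq_cbox)

lemma measure_cube: "0 \<le> a \<Longrightarrow> measure lborel (cube (ereal a) :: (real ^ 'n) set) = (2 * a) ^ CARD('n)"
  by (simp add: cube_eq_cbox content_cbox_if_cart interval_eq_empty_cart)

text \<open>Moving the cube by \<open>t\<close> along a coordinate axis adds a slab of thickness \<open>t\<close> on one side and
  removes one on the other; both slabs are rescaled to the cube.\<close>

lemma cube_shift_difference:
  fixes \<psi> :: "real ^ 'n \<Rightarrow> real"
  assumes a: "a > 0" and t: "0 < t" "t \<le> 2 * a"
    and cont: "continuous_on {v. - a \<le> v $ i \<and> v $ i \<le> a + t \<and> (\<forall>j. j \<noteq> i \<longrightarrow> \<bar>v $ j\<bar> \<le> a)} \<psi>"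
  shows "(LINT v:cube (ereal a)|lborel. \<psi> (v + t *\<^sub>R axis i 1)) - (LINT v:cube (ereal a)|lborel. \<psi> v)
    = t / (2 * a) * ((LINT v:cube (ereal a)|lborel. \<psi> (upd_coord i (a + t / 2 + t / (2 * a) * v $ i) v))
        - (LINT v:cube (ereal a)|lborel. \<psi> (upd_coord i (- a + t / 2 + t / (2 * a) * v $ i) v)))"
proof -
  \<comment> \<open>The union of the cube and its translate, on which \<open>\<psi>\<close> is
    continuous; the extension by zero \<open>\<psi>0\<close> is then integrable on the whole
    space.\<close>
  define Y where "Y = {v :: real ^ 'n. - a \<le> v $ i \<and> v $ i \<le> a + t \<and> (\<forall>j. j \<noteq> i \<longrightarrow> \<bar>v $ j\<bar> \<le> a)}"
  let ?X = "cube (ereal a) :: (real ^ 'n) set"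
  define \<psi>0 where "\<psi>0 v = indicator Y v * \<psi> v" for v
  have Yeq: "Y = cbox (\<chi> j. - a) (\<chi> j. if j = i then a + t else a)"
    unfolding Y_def by (auto simp: mem_box_cart abs_le_interval_iff split: if_splits)
  have \<psi>0: "integrable lborel \<psi>0"
    using borel_integrable_compact[of Y \<psi>] cont
    unfolding \<psi>0_def by (simp add: Yeq[symmetric] Y_def[symmetric]) (simp add: Yeq)
  then have \<psi>0_meas[measurable]: "\<psi>0 \<in> borel_measurable borel"
    by auto
  define I where "I l u v = (indicator {l..u} (v $ i) :: real)" for l u and v :: "real ^ 'n"
  have I_meas[measurable]: "I l u \<in> borel_measurable borel" for l u
    unfolding I_def by measurable
  have intI: "integrable lborel (\<lambda>v. I l u v * \<psi>0 v)" for l u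
    by (rule Bochner_Integration.integrable_bound[OF \<psi>0]) (auto simp: I_def indicator_def)
  have slab: "(\<integral>v. I (c - t / 2) (c + t / 2) v * \<psi>0 v \<partial>lborel)
      = t / (2 * a) * (LINT v:?X|lborel. \<psi> (upd_coord i (c + t / (2 * a) * v $ i) v))"
    if c: "- a \<le> c - t / 2" "c + t / 2 \<le> a + t" for c
  proof -
    have "I (c - t / 2) (c + t / 2) (upd_coord i (c + t / (2 * a) * v $ i) v) * \<psi>0 (upd_coord i (c + t / (2 * a) * v $ i) v)
        = indicator ?X v *\<^sub>R \<psi> (upd_coord i (c + t / (2 * a) * v $ i) v)" for v :: "real ^ 'n"
    proof -
      have iff: "c - t / 2 \<le> c + t / (2 * a) * v $ i \<and> c + t / (2 * a) * v $ i \<le> c + t / 2 \<longleftrightarrow> \<bar>v $ i\<bar> \<le> a"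
      proof -
        define r where "r = t / (2 * a)"
        have r: "r > 0" "t / 2 = r * a"
          using t a by (auto simp: r_def)
        have "c - t / 2 \<le> c + r * v $ i \<longleftrightarrow> r * (- a) \<le> r * v $ i"
          unfolding r(2) by auto
        moreover have "c + r * v $ i \<le> c + t / 2 \<longleftrightarrow> r * v $ i \<le> r * a"
          unfolding r(2) by auto
        ultimately show ?thesis
          unfolding r_def[symmetric] mult_le_cancel_left_pos[OF r(1)] by auto
      qed
      have "v \<in> ?X \<longleftrightarrow> \<bar>v $ i\<bar> \<le> a \<and> (\<forall>j. j \<noteq> i \<longrightarrow> \<bar>v $ j\<bar> \<le> a)"
        by (auto simp: cube_ereal)
      moreover define p where "p = c + t / (2 * a) * v $ i"
      ultimately show ?thesis
        using iff c unfolding p_def[symmetric] by (auto simp: I_def \<psi>0_def Y_def upd_coord_nth indicator_def)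
    qed
    then show ?thesis
      using t a by (subst lborel_integral_scale_coord[of "t / (2 * a)" _ i c]) (auto simp: set_lebesgue_integral_def)
  qed
  have 1: "(LINT v:?X|lborel. \<psi> (v + t *\<^sub>R axis i 1)) = (\<integral>v. I (- a + t) (a + t) v * \<psi>0 v \<partial>lborel)"
  proof -
    have "(\<integral>v. I (- a + t) (a + t) v * \<psi>0 v \<partial>lborel)
        = (\<integral>v. I (- a + t) (a + t) v * \<psi>0 v \<partial>distr lborel borel (\<lambda>v. t *\<^sub>R axis i 1 + v))"
      by (simp add: lborel_distr_plus)
    also have "\<dots> = (\<integral>v. I (- a + t) (a + t) (t *\<^sub>R axis i 1 + v) * \<psi>0 (t *\<^sub>R axis i 1 + v) \<partial>lborel)"
      by (subst integral_distr) auto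
    also have "\<dots> = (LINT v:?X|lborel. \<psi> (v + t *\<^sub>R axis i 1))"
      unfolding set_lebesgue_integral_def
    proof (intro Bochner_Integration.integral_cong refl)
      fix v :: "real ^ 'n"
      have "v \<in> ?X \<longleftrightarrow> \<bar>v $ i\<bar> \<le> a \<and> (\<forall>j. j \<noteq> i \<longrightarrow> \<bar>v $ j\<bar> \<le> a)"
        by (auto simp: cube_ereal)
      moreover have "(t *\<^sub>R axis i 1 + v) $ j = (if j = i then t + v $ i else v $ j)" for j
        by (auto simp: axis_def)
      ultimately show "I (- a + t) (a + t) (t *\<^sub>R axis i 1 + v) * \<psi>0 (t *\<^sub>R axis i 1 + v)
          = indicator ?X v *\<^sub>R \<psi> (v + t *\<^sub>R axis i 1)"
        using t by (auto simp: I_def \<psi>0_def Y_def indicator_def add.commute abs_le_iff)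
    qed
    finally show ?thesis by simp
  qed
  have 2: "(LINT v:?X|lborel. \<psi> v) = (\<integral>v. I (- a) a v * \<psi>0 v \<partial>lborel)"
    unfolding set_lebesgue_integral_def
  proof (intro Bochner_Integration.integral_cong refl)
    fix v :: "real ^ 'n"
    have "v \<in> ?X \<longleftrightarrow> \<bar>v $ i\<bar> \<le> a \<and> (\<forall>j. j \<noteq> i \<longrightarrow> \<bar>v $ j\<bar> \<le> a)"
      by (auto simp: cube_ereal)
    then show "indicator ?X v *\<^sub>R \<psi> v = I (- a) a v * \<psi>0 v"
      using t by (auto simp: I_def \<psi>0_def Y_def indicator_def abs_le_iff)
  qed
  have null: "{v :: real ^ 'n. v $ i = c} \<in> null_sets lborel" for c
  proof -
    have "{v :: real ^ 'n. v $ i = c} \<in> sets borel"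
      by measurable
    moreover have "{v :: real ^ 'n. v $ i = c} \<in> null_sets lebesgue"
      using negligible_standard_hyperplane[of "axis i 1 :: real ^ 'n" c]
      by (simp add: negligible_iff_null_sets axis_in_Basis_iff Basis_real_def cart_eq_inner_axis)
    ultimately show ?thesis
      by (simp add: null_sets_def)
  qed
  \<comment> \<open>The slabs are closed and share faces with the cubes, so the identity of
    indicators fails on these two hyperplanes, which are null.\<close>
  have "AE v in lborel. v $ i \<noteq> a" "AE v in lborel. v $ i \<noteq> - a + t"
    using AE_not_in[OF null] by auto
  then have "AE v in lborel. I (- a + t) (a + t) v * \<psi>0 v - I (- a) a v * \<psi>0 v
      = I a (a + t) v * \<psi>0 v - I (- a) (- a + t) v * \<psi>0 v"
    by eventually_elim (use t a in \<open>auto simp: I_def indicator_def\<close>)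
  then have "(\<integral>v. I (- a + t) (a + t) v * \<psi>0 v \<partial>lborel) - (\<integral>v. I (- a) a v * \<psi>0 v \<partial>lborel)
      = (\<integral>v. I a (a + t) v * \<psi>0 v \<partial>lborel) - (\<integral>v. I (- a) (- a + t) v * \<psi>0 v \<partial>lborel)"
    unfolding Bochner_Integration.integral_diff[OF intI intI, symmetric]
    by (intro integral_cong_AE) auto
  moreover have "(\<integral>v. I a (a + t) v * \<psi>0 v \<partial>lborel)
      = t / (2 * a) * (LINT v:?X|lborel. \<psi> (upd_coord i (a + t / 2 + t / (2 * a) * v $ i) v))"
    using slab[of "a + t / 2"] a t by (simp add: add.commute)
  moreover have "(\<integral>v. I (- a) (- a + t) v * \<psi>0 v \<partial>lborel)
      = t / (2 * a) * (LINT v:?X|lborel. \<psi> (upd_coord i (- a + t / 2 + t / (2 * a) * v $ i) v))"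
    using slab[of "- a + t / 2"] a t by simp
  ultimately show ?thesis
    unfolding 1 2 by (simp add: right_diff_distrib)
qed

section \<open>The uniform law on a cube\<close>

context
  fixes \<alpha> :: real
  assumes \<alpha>: "\<alpha> > 0"
begin

lemma measure_cube_half: "measure lborel (cube (ereal (\<alpha> / 2)) :: (real ^ 'n) set) = \<alpha> ^ CARD('n)"
  using \<alpha> by (simp add: measure_cube)

lemma emeasure_cube_half: "emeasure lborel (cube (ereal (\<alpha> / 2)) :: (real ^ 'n) set) = ennreal (\<alpha> ^ CARD('n))"
  using measure_cube_half[where 'n = 'n] emeasure_eq_ennreal_measure[of lborel "cube (ereal (\<alpha> / 2)) :: (real ^ 'n) set"]
    emeasure_compact_finite[OF compact_cube, of "\<alpha> / 2"] by (simp add: top.not_eq_extremum)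

lemma sets_cube_law [simp, measurable_cong]: "sets (cube_law \<alpha>) = sets borel"
  and space_cube_law [simp]: "space (cube_law \<alpha>) = UNIV"
  by (simp_all add: cube_law_def)

lemma prob_space_cube_law: "prob_space (cube_law \<alpha> :: (real ^ 'n) measure)"
  unfolding cube_law_def using \<alpha> emeasure_cube_half[where 'n = 'n]
  by (intro prob_space_uniform_measure) auto

lemma AE_cube_law: "AE v in cube_law \<alpha>. v \<in> cube (ereal (\<alpha> / 2))"
  unfolding cube_law_def by (rule AE_uniform_measureI) auto

lemma cube_law_density:
  "cube_law \<alpha> = density lborel (\<lambda>v :: real ^ 'n. ennreal (indicator (cube (ereal (\<alpha> / 2))) v / \<alpha> ^ CARD('n)))"
  unfolding cube_law_def uniform_measure_def emeasure_cube_half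
  using \<alpha> by (intro density_cong) (auto simp: indicator_def divide_ennreal[of 1, simplified])

text \<open>The indicator in the integrand repeats the one in the density, so values of
  \<open>g\<close> off the cube do not enter and compactness gives integrability.\<close>

lemma set_integral_cube_law:
  fixes g :: "real ^ 'n \<Rightarrow> real"
  assumes g: "continuous_on (cube (ereal (\<alpha> / 2))) g"
  shows "(LINT v:cube (ereal (\<alpha> / 2))|cube_law \<alpha>. g v) = (LINT v:cube (ereal (\<alpha> / 2))|lborel. g v) / \<alpha> ^ CARD('n)"
    and "set_integrable (cube_law \<alpha>) (cube (ereal (\<alpha> / 2))) g"
proof -
  let ?X = "cube (ereal (\<alpha> / 2)) :: (real ^ 'n) set"
  have int: "integrable lborel (\<lambda>v. indicator ?X v *\<^sub>R g v)"
    by (rule borel_integrable_compact) (use g in auto)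
  then have [measurable]: "(\<lambda>v. indicator ?X v *\<^sub>R g v) \<in> borel_measurable borel"
    by auto
  have eq: "(indicator ?X v / \<alpha> ^ CARD('n)) *\<^sub>R (indicator ?X v *\<^sub>R g v) = (1 / \<alpha> ^ CARD('n)) * (indicator ?X v *\<^sub>R g v)"
    for v by (simp add: indicator_def)
  have dens: "(\<lambda>v. indicator ?X v / \<alpha> ^ CARD('n)) \<in> borel_measurable lborel"
    "AE v in lborel. 0 \<le> indicator ?X v / \<alpha> ^ CARD('n)"
    using \<alpha> by auto
  show "(LINT v:?X|cube_law \<alpha>. g v) = (LINT v:?X|lborel. g v) / \<alpha> ^ CARD('n)"
    unfolding set_lebesgue_integral_def cube_law_density
    by (subst integral_density[OF borel_measurable_integrable[OF int] dens]) (simp only: eq, simp)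
  show "set_integrable (cube_law \<alpha>) ?X g"
    unfolding set_integrable_def cube_law_density
    by (subst integrable_density[OF borel_measurable_integrable[OF int] dens]) (simp only: eq int integrable_mult_right)
qed

lemma cube_law_shift_difference:
  fixes \<psi> :: "real ^ 'n \<Rightarrow> real"
  assumes t: "0 < t" "t \<le> \<alpha>"
    and cont: "continuous_on {v. - (\<alpha> / 2) \<le> v $ i \<and> v $ i \<le> \<alpha> / 2 + t \<and> (\<forall>j. j \<noteq> i \<longrightarrow> \<bar>v $ j\<bar> \<le> \<alpha> / 2)} \<psi>"
  shows "(LINT v:cube (ereal (\<alpha> / 2))|cube_law \<alpha>. \<psi> (v + t *\<^sub>R axis i 1)) - (LINT v:cube (ereal (\<alpha> / 2))|cube_law \<alpha>. \<psi> v)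
    = t / \<alpha> * ((LINT v:cube (ereal (\<alpha> / 2))|cube_law \<alpha>. \<psi> (upd_coord i (\<alpha> / 2 + t / 2 + t / \<alpha> * v $ i) v))
        - (LINT v:cube (ereal (\<alpha> / 2))|cube_law \<alpha>. \<psi> (upd_coord i (- (\<alpha> / 2) + t / 2 + t / \<alpha> * v $ i) v)))"
proof -
  let ?X = "cube (ereal (\<alpha> / 2)) :: (real ^ 'n) set"
  let ?Y = "{v. - (\<alpha> / 2) \<le> v $ i \<and> v $ i \<le> \<alpha> / 2 + t \<and> (\<forall>j. j \<noteq> i \<longrightarrow> \<bar>v $ j\<bar> \<le> \<alpha> / 2)}"
  have X: "v \<in> ?X \<longleftrightarrow> (- (\<alpha> / 2) \<le> v $ i \<and> v $ i \<le> \<alpha> / 2) \<and> (\<forall>j. j \<noteq> i \<longrightarrow> \<bar>v $ j\<bar> \<le> \<alpha> / 2)" for v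
    unfolding cube_ereal mem_Collect_eq abs_le_interval_iff by metis
  have bd: "- (t / 2) \<le> t / \<alpha> * v $ i" "t / \<alpha> * v $ i \<le> t / 2" if "v \<in> ?X" for v
  proof -
    have "\<bar>t / \<alpha> * v $ i\<bar> \<le> t / \<alpha> * (\<alpha> / 2)"
      unfolding abs_mult using that t \<alpha> by (intro mult_mono) (auto simp: cube_ereal)
    then have "\<bar>t / \<alpha> * v $ i\<bar> \<le> t / 2"
      using \<alpha> by simp
    then show "- (t / 2) \<le> t / \<alpha> * v $ i" "t / \<alpha> * v $ i \<le> t / 2"
      by (simp_all only: abs_le_interval_iff)
  qed
  have ax: "(v + t *\<^sub>R axis i 1) $ j = (if j = i then v $ i + t else v $ j)" for v j
    by (auto simp: axis_def)
  have c1: "continuous_on ?X (\<lambda>v. \<psi> (v + t *\<^sub>R axis i 1))"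
  proof (rule continuous_on_compose2[OF cont])
    show "(\<lambda>v. v + t *\<^sub>R axis i 1) ` ?X \<subseteq> ?Y"
    proof safe
      fix v j assume v: "v \<in> ?X"
      show "- (\<alpha> / 2) \<le> (v + t *\<^sub>R axis i 1) $ i" "(v + t *\<^sub>R axis i 1) $ i \<le> \<alpha> / 2 + t"
        using v t unfolding ax X by auto
      assume "j \<noteq> i" then show "\<bar>(v + t *\<^sub>R axis i 1) $ j\<bar> \<le> \<alpha> / 2"
        using v X unfolding ax by simp
    qed
  qed (auto intro!: continuous_intros)
  have c2: "continuous_on ?X \<psi>"
    by (rule continuous_on_subset[OF cont]) (use t in \<open>auto simp: X\<close>)
  have c3: "continuous_on ?X (\<lambda>v. \<psi> (upd_coord i (c + t / 2 + t / \<alpha> * v $ i) v))"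
    if "c = \<alpha> / 2 \<or> c = - (\<alpha> / 2)" for c
  proof (rule continuous_on_compose2[OF cont])
    show "(\<lambda>v. upd_coord i (c + t / 2 + t / \<alpha> * v $ i) v) ` ?X \<subseteq> ?Y"
    proof safe
      fix v j assume v: "v \<in> ?X"
      have eq: "upd_coord i (c + t / 2 + t / \<alpha> * v $ i) v $ i = c + t / 2 + t / \<alpha> * v $ i"
        by (simp add: upd_coord_nth)
      show "- (\<alpha> / 2) \<le> upd_coord i (c + t / 2 + t / \<alpha> * v $ i) v $ i"
        "upd_coord i (c + t / 2 + t / \<alpha> * v $ i) v $ i \<le> \<alpha> / 2 + t"
        unfolding eq using that bd[OF v] t \<alpha> by (elim disjE; linarith)+
      assume "j \<noteq> i" then show "\<bar>upd_coord i (c + t / 2 + t / \<alpha> * v $ i) v $ j\<bar> \<le> \<alpha> / 2"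
        using v X by (simp add: upd_coord_nth)
    qed
  qed (use \<alpha> in \<open>auto intro!: continuous_intros\<close>)
  have "(LINT v:?X|lborel. \<psi> (v + t *\<^sub>R axis i 1)) - (LINT v:?X|lborel. \<psi> v)
    = t / \<alpha> * ((LINT v:?X|lborel. \<psi> (upd_coord i (\<alpha> / 2 + t / 2 + t / \<alpha> * v $ i) v))
        - (LINT v:?X|lborel. \<psi> (upd_coord i (- (\<alpha> / 2) + t / 2 + t / \<alpha> * v $ i) v)))"
    using cube_shift_difference[of "\<alpha> / 2" t i \<psi>] \<alpha> t cont by simp
  then show ?thesis
    unfolding set_integral_cube_law(1)[OF c1] set_integral_cube_law(1)[OF c2]
      set_integral_cube_law(1)[OF c3[of "\<alpha> / 2", OF disjI1[OF refl]]]
      set_integral_cube_law(1)[OF c3[of "- (\<alpha> / 2)", OF disjI2[OF refl]]]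
    by (simp flip: diff_divide_distrib)
qed

lemma cube_law_integral_eq:
  fixes g :: "real ^ 'n \<Rightarrow> real"
  assumes [measurable]: "g \<in> borel_measurable borel"
  shows "(LINT v:cube (ereal (\<alpha> / 2))|cube_law \<alpha>. g v) = (\<integral>v. g v \<partial>cube_law \<alpha>)"
  unfolding set_lebesgue_integral_def
  by (rule integral_cong_AE, measurable) (use AE_cube_law in \<open>auto elim!: eventually_mono\<close>)

text \<open>The shift identity replaces an iterated integral: taken with shift
  \<open>\<alpha> / 2\<close> for the square and the cube of a coordinate, it yields linear
  equations for the first two moments.\<close>

lemma cube_law_moments:
  fixes i :: "'n::finite"
  shows "integrable (cube_law \<alpha>) (\<lambda>v :: real ^ 'n. (v $ i) ^ k)"
    and "(\<integral>v. (v $ i) ^ 2 \<partial>cube_law \<alpha>) = \<alpha>\<^sup>2 / 12"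
proof -
  interpret prob_space "cube_law \<alpha> :: (real ^ 'n) measure" by (rule prob_space_cube_law)
  define a where "a = \<alpha> / 2"
  have a: "a > 0" "\<alpha> = 2 * a" using \<alpha> by (auto simp: a_def)
  have int: "integrable (cube_law \<alpha>) (\<lambda>v :: real ^ 'n. (v $ i) ^ k)" for k
  proof (rule integrable_const_bound[where B = "a ^ k"])
    show "AE v in cube_law \<alpha>. norm ((v $ i) ^ k) \<le> a ^ k"
      using AE_cube_law by eventually_elim (auto simp: cube_ereal a_def power_abs intro!: power_mono)
  qed measurable
  show "integrable (cube_law \<alpha>) (\<lambda>v :: real ^ 'n. (v $ i) ^ k)" by (rule int)
  define m where "m k = (\<integral>v. (v $ i) ^ k \<partial>(cube_law \<alpha> :: (real ^ 'n) measure))" for k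
  have cube_poly: "(\<integral>v. (c + b * v $ i) ^ 2 \<partial>(cube_law \<alpha> :: (real ^ 'n) measure)) = c\<^sup>2 + 2 * c * b * m 1 + b\<^sup>2 * m 2"
    and cube_poly3: "(\<integral>v. (c + b * v $ i) ^ 3 \<partial>(cube_law \<alpha> :: (real ^ 'n) measure))
      = c ^ 3 + 3 * c\<^sup>2 * b * m 1 + 3 * c * b\<^sup>2 * m 2 + b ^ 3 * m 3" for b c
  proof -
    have "(c + b * v $ i) ^ 2 = c\<^sup>2 + 2 * c * b * (v $ i) ^ 1 + b\<^sup>2 * (v $ i) ^ 2" for v :: "real ^ 'n"
      by (simp add: power2_eq_square algebra_simps)
    then show "(\<integral>v. (c + b * v $ i) ^ 2 \<partial>(cube_law \<alpha> :: (real ^ 'n) measure)) = c\<^sup>2 + 2 * c * b * m 1 + b\<^sup>2 * m 2"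
      using int[of 1] int[of 2] prob_space by (simp add: m_def)
    have "(c + b * v $ i) ^ 3 = c ^ 3 + 3 * c\<^sup>2 * b * (v $ i) ^ 1 + 3 * c * b\<^sup>2 * (v $ i) ^ 2 + b ^ 3 * (v $ i) ^ 3"
      for v :: "real ^ 'n"
      by (simp add: power2_eq_square power3_eq_cube algebra_simps)
    then show "(\<integral>v. (c + b * v $ i) ^ 3 \<partial>(cube_law \<alpha> :: (real ^ 'n) measure))
      = c ^ 3 + 3 * c\<^sup>2 * b * m 1 + 3 * c * b\<^sup>2 * m 2 + b ^ 3 * m 3"
      using int[of 1] int[of 2] int[of 3] prob_space by (simp add: m_def)
  qed
  have shift: "(\<integral>v. (a + 1 * v $ i) ^ k \<partial>(cube_law \<alpha> :: (real ^ 'n) measure)) - (\<integral>v. (0 + 1 * v $ i) ^ k \<partial>(cube_law \<alpha> :: (real ^ 'n) measure))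
    = 1 / 2 * ((\<integral>v. (3 / 2 * a + 1 / 2 * v $ i) ^ k \<partial>(cube_law \<alpha> :: (real ^ 'n) measure))
      - (\<integral>v. (- a / 2 + 1 / 2 * v $ i) ^ k \<partial>(cube_law \<alpha> :: (real ^ 'n) measure)))" for k
  proof -
    have L: "(LINT v:cube (ereal (\<alpha> / 2))|cube_law \<alpha>. (c + b * v $ i) ^ k) = (\<integral>v. (c + b * v $ i) ^ k \<partial>(cube_law \<alpha> :: (real ^ 'n) measure))"
      for c b by (rule cube_law_integral_eq) measurable
    have "continuous_on S (\<lambda>v. v $ i ^ k)" for S :: "(real ^ 'n) set"
      by (intro continuous_intros)
    from cube_law_shift_difference[of a i "\<lambda>v. v $ i ^ k", OF _ _ this]
    have "(LINT v:cube (ereal (\<alpha> / 2))|cube_law \<alpha>. ((v + a *\<^sub>R axis i 1) $ i) ^ k) - (LINT v:cube (ereal (\<alpha> / 2))|cube_law \<alpha>. (v $ i) ^ k)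
      = a / \<alpha> * ((LINT v:cube (ereal (\<alpha> / 2))|cube_law \<alpha>. (upd_coord i (\<alpha> / 2 + a / 2 + a / \<alpha> * v $ i) v $ i) ^ k)
        - (LINT v:cube (ereal (\<alpha> / 2))|cube_law \<alpha>. (upd_coord i (- (\<alpha> / 2) + a / 2 + a / \<alpha> * v $ i) v $ i) ^ k))"
      using a by simp
    moreover have "(v + a *\<^sub>R axis i 1) $ i = a + 1 * v $ i" "v $ i = 0 + 1 * v $ i"
      "upd_coord i (\<alpha> / 2 + a / 2 + a / \<alpha> * v $ i) v $ i = 3 / 2 * a + 1 / 2 * v $ i"
      "upd_coord i (- (\<alpha> / 2) + a / 2 + a / \<alpha> * v $ i) v $ i = - a / 2 + 1 / 2 * v $ i" for v :: "real ^ 'n"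
      using a by (auto simp: axis_def upd_coord_nth)
    moreover have "a / \<alpha> = 1 / 2"
      using a by simp
    ultimately show ?thesis
      unfolding L[symmetric] by (simp add: add.commute)
  qed
  \<comment> \<open>The highest moment cancels on each side of the shift identity, so degree 2
    determines \<open>m 1\<close> and degree 3 then determines \<open>m 2\<close>.\<close>
  have "2 * a * m 1 + a\<^sup>2 = a\<^sup>2 + a * m 1"
    using shift[of 2] unfolding cube_poly by (simp add: power2_eq_square field_simps)
  then have m1: "m 1 = 0"
    using a by simp
  have "3 * a * m 2 + a ^ 3 = a ^ 3 + 3 / 4 * a ^ 3 + 3 / 4 * a * m 2"
    using shift[of 3] m1 unfolding cube_poly3 by (simp add: power2_eq_square power3_eq_cube field_simps)
  moreover have "a * (9 / 4 * m 2) = 3 * a * m 2 - 3 / 4 * a * m 2" "a * (3 / 4 * a\<^sup>2) = 3 / 4 * a ^ 3"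
    by (simp_all add: power2_eq_square power3_eq_cube)
  ultimately have "a * (9 / 4 * m 2) = a * (3 / 4 * a\<^sup>2)"
    by linarith
  then have "9 / 4 * m 2 = 3 / 4 * a\<^sup>2"
    using a by (simp only: mult_cancel_left) simp
  then show "(\<integral>v. (v $ i) ^ 2 \<partial>(cube_law \<alpha> :: (real ^ 'n) measure)) = \<alpha>\<^sup>2 / 12"
    using a by (simp add: m_def power2_eq_square)
qed

text \<open>Nonnegativity of the variance of the norm bounds its mean by the root of
  \<open>CARD('n) * \<alpha>^2 / 12\<close>. Twice this bound, times the Lipschitz constant, is the
  last term of the estimate by \<open>f\<close>.\<close>

lemma cube_law_expected_norm:
  shows "integrable (cube_law \<alpha>) (\<lambda>v :: real ^ 'n. norm v)"
    and "(\<integral>v. norm v \<partial>(cube_law \<alpha> :: (real ^ 'n) measure)) \<le> \<alpha> / 2 * sqrt (CARD('n) / 3)"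
proof -
  interpret prob_space "cube_law \<alpha> :: (real ^ 'n) measure" by (rule prob_space_cube_law)
  have sq: "(norm v)\<^sup>2 = (\<Sum>i\<in>UNIV. (v $ i) ^ 2)" for v :: "real ^ 'n"
    unfolding power2_norm_eq_inner inner_vec_def by (simp add: power2_eq_square)
  have int: "integrable (cube_law \<alpha>) (\<lambda>v :: real ^ 'n. (norm v)\<^sup>2)"
    unfolding sq by (intro Bochner_Integration.integrable_sum cube_law_moments)
  have E: "(\<integral>v. (norm v)\<^sup>2 \<partial>(cube_law \<alpha> :: (real ^ 'n) measure)) = CARD('n) * (\<alpha>\<^sup>2 / 12)"
    unfolding sq by (subst Bochner_Integration.integral_sum) (simp_all add: cube_law_moments)
  show int1: "integrable (cube_law \<alpha>) (\<lambda>v :: real ^ 'n. norm v)"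
    by (rule square_integrable_imp_integrable) (use int in auto)
  have "(\<integral>v. norm v \<partial>(cube_law \<alpha> :: (real ^ 'n) measure))\<^sup>2 \<le> CARD('n) * (\<alpha>\<^sup>2 / 12)"
    using variance_positive[of norm] variance_eq[OF int1 int] unfolding E by linarith
  also have "\<dots> = (\<alpha> / 2 * sqrt (CARD('n) / 3))\<^sup>2"
    by (simp add: power_mult_distrib power_divide)
  finally show "(\<integral>v. norm v \<partial>(cube_law \<alpha> :: (real ^ 'n) measure)) \<le> \<alpha> / 2 * sqrt (CARD('n) / 3)"
    by (rule power2_le_imp_le) (use \<alpha> in simp)
qed

end

section \<open>Geometry of cubes\<close>

lemma cube_add:
  assumes "w \<in> cube r" "v \<in> cube s"
  shows "w + v \<in> cube (r + s)"
proof -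
  have "ereal \<bar>(w + v) $ i\<bar> \<le> ereal \<bar>w $ i\<bar> + ereal \<bar>v $ i\<bar>" for i
    by (simp add: abs_triangle_ineq)
  also have "ereal \<bar>w $ i\<bar> + ereal \<bar>v $ i\<bar> \<le> r + s" for i
    using assms by (intro add_mono) (auto simp: cube_def)
  finally show ?thesis
    by (simp add: cube_def)
qed

lemma cube_mono: "r \<le> s \<Longrightarrow> cube r \<subseteq> cube s"
  unfolding cube_def by (auto intro: order_trans)

lemma cube_infinity [simp]: "cube \<infinity> = UNIV"
  by (simp add: cube_def)

lemma closed_cube: "closed (cube r :: (real ^ 'n) set)"
proof (cases r)
  case MInf
  then have "cube r = ({} :: (real ^ 'n) set)" by (simp add: cube_def)
  then show ?thesis by simp
qed (simp_all add: compact_imp_closed)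

lemma convex_cube: "convex (cube r :: (real ^ 'n) set)"
proof (cases r)
  case (real x)
  then show ?thesis by (simp add: cube_eq_cbox)
next
  case MInf
  then have "cube r = ({} :: (real ^ 'n) set)" by (simp add: cube_def)
  then show ?thesis by simp
qed simp

lemma mem_cube_of_norm_le: "norm h \<le> e \<Longrightarrow> h \<in> cube (ereal e)"
  using component_le_norm_cart order_trans unfolding cube_ereal by blast

lemma norm_le_of_mem_cube:
  fixes v :: "real ^ 'n"
  assumes "v \<in> cube (ereal a)" "0 \<le> a"
  shows "norm v \<le> sqrt (CARD('n)) * a"
proof -
  have "(norm v)\<^sup>2 = (\<Sum>i\<in>UNIV. (v $ i)\<^sup>2)"
    unfolding power2_norm_eq_inner inner_vec_def by (simp add: power2_eq_square)
  also have "\<dots> \<le> (\<Sum>i\<in>(UNIV :: 'n set). a\<^sup>2)"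
    using assms by (intro sum_mono abs_le_square_iff[THEN iffD1]) (auto simp: cube_ereal)
  also have "\<dots> = (sqrt (CARD('n)) * a)\<^sup>2"
    by (simp add: power_mult_distrib)
  finally show ?thesis
    by (rule power2_le_imp_le) (use assms in simp)
qed

lemma upd_coord_mem_cube: "v \<in> cube (ereal a) \<Longrightarrow> \<bar>b\<bar> \<le> a \<Longrightarrow> upd_coord i b v \<in> cube (ereal a)"
  by (auto simp: cube_ereal upd_coord_nth)

lemma distr_pair_snd:
  assumes "prob_space M" "prob_space N"
  shows "distr (M \<Otimes>\<^sub>M N) N snd = N"
proof -
  interpret M: prob_space M by fact
  interpret N: prob_space N by fact
  show ?thesis
  proof (rule measure_eqI)
    fix A assume "A \<in> sets (distr (M \<Otimes>\<^sub>M N) N snd)"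
    then have A: "A \<in> sets N" by simp
    have "snd -` A \<inter> space (M \<Otimes>\<^sub>M N) = space M \<times> A"
      using sets.sets_into_space[OF A] by (auto simp: space_pair_measure)
    then show "emeasure (distr (M \<Otimes>\<^sub>M N) N snd) A = emeasure N A"
      using A by (simp add: emeasure_distr N.emeasure_pair_measure_Times M.emeasure_space_1)
  qed simp
qed

section \<open>Smoothing of an expected function\<close>

locale smoothed_expectation =
  fixes \<alpha> :: real and \<beta> \<kappa> :: ereal
    and P :: "(real ^ 'p) measure"
    and F :: "real ^ 'd \<Rightarrow> real ^ 'p \<Rightarrow> real"
    and G :: "real ^ 'd \<Rightarrow> real ^ 'p \<Rightarrow> real ^ 'd"
    and L :: "real ^ 'p \<Rightarrow> real"
  assumes \<alpha>: "\<alpha> > 0" and \<beta>: "\<beta> > 0"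
    and \<kappa>: "(\<beta> < \<infinity> \<and> \<beta> + ereal (\<alpha> / 2) < \<kappa> \<and> \<kappa> < \<infinity>) \<or> (\<beta> = \<infinity> \<and> \<kappa> = \<infinity>)"
    and P: "prob_space P" and sets_P [measurable_cong]: "sets P = sets borel"
    and F_meas: "(\<lambda>(w, x). F w x) \<in> borel_measurable (restrict_space (borel \<Otimes>\<^sub>M borel) (cube \<kappa> \<times> UNIV))"
    and F_int: "\<And>w. w \<in> cube \<kappa> \<Longrightarrow> integrable P (F w)"
    and L_meas [measurable]: "L \<in> borel_measurable borel"
    and F_lip: "AE x in P. \<forall>w\<in>cube \<kappa>. \<forall>w'\<in>cube \<kappa>. \<bar>F w x - F w' x\<bar> \<le> L x * norm (w - w')"
    and L_sq: "integrable P (\<lambda>x. (L x)\<^sup>2)"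
    and G_meas: "(\<lambda>(w, x). G w x) \<in> borel_measurable
           (restrict_space (borel \<Otimes>\<^sub>M borel) (cube (\<beta> + ereal (\<alpha> / 2)) \<times> UNIV))"
    and G_deriv: "\<And>w. w \<in> cube \<beta> \<Longrightarrow>
           AE (v, x) in cube_law \<alpha> \<Otimes>\<^sub>M P. GDERIV (\<lambda>z. F z x) (w + v) :> G (w + v) x"
begin

sublocale P: prob_space P by (rule P)
sublocale C: prob_space "cube_law \<alpha> :: (real ^ 'd) measure" by (rule prob_space_cube_law[OF \<alpha>])
sublocale N: pair_prob_space "cube_law \<alpha> :: (real ^ 'd) measure" P ..

declare sets_cube_law[OF \<alpha>, measurable_cong, simp] space_cube_law[OF \<alpha>, simp]

abbreviation "X \<equiv> cube (ereal (\<alpha> / 2)) :: (real ^ 'd) set"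
abbreviation "N \<equiv> (cube_law \<alpha> :: (real ^ 'd) measure) \<Otimes>\<^sub>M P"
abbreviation "f \<equiv> expected P F"
abbreviation "fs \<equiv> smoothed \<alpha> f"
abbreviation "L0 \<equiv> (\<integral>x. L x \<partial>P)"

text \<open>The given functions are Borel only on products with cubes; extension by zero makes them
  measurable on the whole product without changing them at the points where they are
  evaluated.\<close>

definition F0 where "F0 w x = indicator (cube \<kappa>) w * F w x"
definition G0 where "G0 w x = indicator (cube (\<beta> + ereal (\<alpha> / 2))) w *\<^sub>R G w x"
text \<open>The candidate for the gradient of \<open>fs\<close>: differentiation taken under both
  expectations.\<close>

definition gr where "gr w = (\<integral>z. G0 (w + fst z) (snd z) \<partial>N)"

lemma space_P [simp]: "space P = UNIV"
  using sets_eq_imp_space_eq[OF sets_P] by simp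

lemma sets_N [measurable_cong]: "sets N = sets (borel \<Otimes>\<^sub>M borel)"
  by (intro sets_pair_measure_cong) (simp_all add: sets_P)

lemma \<beta>\<alpha>_le_\<kappa>: "\<beta> + ereal (\<alpha> / 2) \<le> \<kappa>"
  using \<kappa> by auto

text \<open>The strict gap below \<kappa> puts every perturbed point in the interior of
  \<open>cube \<kappa>\<close>, so difference quotients there stay in the Lipschitz domain. With
  infinite radii any positive number works.\<close>

lemma room: obtains e where "e > 0" "\<beta> + ereal (\<alpha> / 2) + ereal e \<le> \<kappa>"
proof (cases "\<kappa> = \<infinity>")
  case True
  then show ?thesis using that[of 1] by simp
next
  case False
  with \<kappa> obtain b k where "\<beta> = ereal b" "\<kappa> = ereal k" "b + \<alpha> / 2 < k"
    using \<beta> by (cases \<beta>; cases \<kappa>) auto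
  then show ?thesis using that[of "k - (b + \<alpha> / 2)"] by simp
qed

lemma add_mem: "w \<in> cube \<beta> \<Longrightarrow> v \<in> X \<Longrightarrow> w + v \<in> cube (\<beta> + ereal (\<alpha> / 2))"
  by (rule cube_add)

lemma add_mem_\<kappa>: "w \<in> cube \<beta> \<Longrightarrow> v \<in> X \<Longrightarrow> w + v \<in> cube \<kappa>"
  using add_mem cube_mono[OF \<beta>\<alpha>_le_\<kappa>] by blast

lemma cube_\<beta>_subset: "cube \<beta> \<subseteq> cube \<kappa>"
proof (rule cube_mono)
  show "\<beta> \<le> \<kappa>" using \<kappa> \<alpha> \<beta> by (cases \<beta>; cases \<kappa>) auto
qed

lemma zero_mem: "0 \<in> cube \<beta>" "0 \<in> cube \<kappa>"
proof -
  show "0 \<in> cube \<beta>"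
    using \<beta> by (simp add: cube_def less_imp_le zero_ereal_def[symmetric])
  then show "0 \<in> cube \<kappa>"
    using cube_\<beta>_subset by blast
qed

lemma X_subset: "X \<subseteq> cube \<kappa>"
  using add_mem_\<kappa>[OF zero_mem(1)] by auto

lemma closed_borel: "(cube r :: (real ^ 'n) set) \<in> sets borel"
  by (intro borel_closed closed_cube)

lemma F0_meas: "(\<lambda>z. F0 (fst z) (snd z)) \<in> borel_measurable (borel \<Otimes>\<^sub>M borel)"
proof -
  have "cube \<kappa> \<times> UNIV \<inter> space (borel \<Otimes>\<^sub>M borel) \<in> sets (borel \<Otimes>\<^sub>M borel :: ((real ^ 'd) \<times> (real ^ 'p)) measure)"
    by (auto simp: space_pair_measure intro!: pair_measureI closed_borel)
  from borel_measurable_restrict_space_iff[OF this, THEN iffD1, OF F_meas]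
  show ?thesis
    by (simp add: F0_def case_prod_beta indicator_times)
qed

lemma G0_meas: "(\<lambda>z. G0 (fst z) (snd z)) \<in> borel_measurable (borel \<Otimes>\<^sub>M borel)"
proof -
  have "cube (\<beta> + ereal (\<alpha> / 2)) \<times> UNIV \<inter> space (borel \<Otimes>\<^sub>M borel)
      \<in> sets (borel \<Otimes>\<^sub>M borel :: ((real ^ 'd) \<times> (real ^ 'p)) measure)"
    by (auto simp: space_pair_measure intro!: pair_measureI closed_borel)
  from borel_measurable_restrict_space_iff[OF this, THEN iffD1, OF G_meas]
  show ?thesis
    by (simp add: G0_def case_prod_beta indicator_times)
qed

lemma F0_meas' [measurable (raw)]:
  assumes "g \<in> M \<rightarrow>\<^sub>M borel" "h \<in> M \<rightarrow>\<^sub>M borel"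
  shows "(\<lambda>z. F0 (g z) (h z)) \<in> borel_measurable M"
  using measurable_compose[OF measurable_Pair[OF assms] F0_meas] by simp

lemma G0_meas' [measurable (raw)]:
  assumes "g \<in> M \<rightarrow>\<^sub>M borel" "h \<in> M \<rightarrow>\<^sub>M borel"
  shows "(\<lambda>z. G0 (g z) (h z)) \<in> borel_measurable M"
  using measurable_compose[OF measurable_Pair[OF assms] G0_meas] by simp

lemma integrable_L: "integrable P L"
  by (rule P.square_integrable_imp_integrable) (use L_sq in auto)

lemma distr_snd: "distr N P snd = P"
  by (rule distr_pair_snd) unfold_locales

lemma snd_N:
  fixes h :: "real ^ 'p \<Rightarrow> real"
  assumes h: "integrable P h"
  shows "integrable N (\<lambda>z. h (snd z))" and "(\<integral>z. h (snd z) \<partial>N) = (\<integral>x. h x \<partial>P)"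
proof -
  show "integrable N (\<lambda>z. h (snd z))"
    using integrable_distr_eq[of snd N P h] h by (simp add: distr_snd)
  show "(\<integral>z. h (snd z) \<partial>N) = (\<integral>x. h x \<partial>P)"
    using integral_distr[of snd N P h] h by (simp add: distr_snd)
qed

definition Lipschitz_sample where
  "Lipschitz_sample x \<longleftrightarrow> 0 \<le> L x \<and> (\<forall>w\<in>cube \<kappa>. \<forall>w'\<in>cube \<kappa>. \<bar>F w x - F w' x\<bar> \<le> L x * norm (w - w'))"

text \<open>The sign of \<open>L x\<close> follows by testing the Lipschitz bound on two distinct
  points, the origin and a corner of the small cube.\<close>

lemma AE_Lipschitz_sample: "AE x in P. Lipschitz_sample x"
  using F_lip
proof eventually_elim
  case (elim x)
  define w where "w = (\<chi> i. \<alpha> / 2 :: real ^ 'd)"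
  have w: "w \<in> cube \<kappa>" "w \<noteq> 0"
    using X_subset \<alpha> by (auto simp: w_def cube_ereal vec_eq_iff)
  have "\<bar>F w x - F 0 x\<bar> \<le> L x * norm (w - 0)"
    using elim w(1) zero_mem(2) by blast
  then have "0 \<le> L x * norm w"
    using abs_ge_zero[of "F w x - F 0 x"] by simp
  then have "0 \<le> L x"
    using w(2) by (simp add: zero_le_mult_iff)
  with elim show ?case
    by (simp add: Lipschitz_sample_def)
qed

lemma AE_N: "AE z in N. fst z \<in> X \<and> Lipschitz_sample (snd z)"
proof -
  have "AE x in distr N P snd. Lipschitz_sample x"
    unfolding distr_snd by (rule AE_Lipschitz_sample)
  then have 1: "AE z in N. Lipschitz_sample (snd z)"
    by (rule AE_distrD[rotated]) simp
  have "AE z in N. fst z \<in> X"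
  proof (rule N.AE_pair_measure)
    have "{z \<in> space N. fst z \<in> X} = X \<times> UNIV"
      by (auto simp: space_pair_measure)
    then show "{z \<in> space N. fst z \<in> X} \<in> sets N"
      using cube_borel by (auto intro!: pair_measureI simp: sets_P)
    show "AE v in cube_law \<alpha>. AE x in P. fst (v, x) \<in> X"
      using AE_cube_law[OF \<alpha>] by simp
  qed
  with 1 show ?thesis by eventually_elim simp
qed

lemma F0_eq: "w \<in> cube \<kappa> \<Longrightarrow> F0 w = F w"
  by (simp add: F0_def fun_eq_iff)

text \<open>Fubini interchanges sampling and smoothing, with majorant the value at the origin plus
  \<open>L\<close> times the bound \<open>c\<close>. The general map \<open>y\<close> covers both
  plain perturbation and perturbation with one coordinate overwritten.\<close>

lemma integral_along:
  assumes [measurable]: "y \<in> borel_measurable borel"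
    and y: "\<And>v. v \<in> X \<Longrightarrow> y v \<in> cube \<kappa>" "\<And>v. v \<in> X \<Longrightarrow> norm (y v) \<le> c"
  shows "integrable N (\<lambda>z. F0 (y (fst z)) (snd z))"
    and "(\<integral>z. F0 (y (fst z)) (snd z) \<partial>N) = (LINT v:X|cube_law \<alpha>. f (y v))"
proof -
  have dom: "integrable N (\<lambda>z. \<bar>F 0 (snd z)\<bar> + L (snd z) * c)"
    using integrable_L F_int[OF zero_mem(2)] by (intro snd_N) auto
  show int: "integrable N (\<lambda>z. F0 (y (fst z)) (snd z))"
  proof (rule Bochner_Integration.integrable_bound[OF dom])
    show "AE z in N. norm (F0 (y (fst z)) (snd z)) \<le> norm (\<bar>F 0 (snd z)\<bar> + L (snd z) * c)"
      using AE_N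
    proof eventually_elim
      case (elim z)
      have "\<bar>F (y (fst z)) (snd z) - F 0 (snd z)\<bar> \<le> L (snd z) * norm (y (fst z) - 0)"
        using elim y(1) zero_mem(2) unfolding Lipschitz_sample_def by blast
      also have "\<dots> \<le> L (snd z) * c"
        using elim y(2) by (intro mult_left_mono) (auto simp: Lipschitz_sample_def)
      finally have "\<bar>F (y (fst z)) (snd z)\<bar> \<le> \<bar>F 0 (snd z)\<bar> + L (snd z) * c"
        by linarith
      then show ?case
        using elim y(1) by (simp add: F0_eq)
    qed
  qed measurable
  have "(\<integral>z. F0 (y (fst z)) (snd z) \<partial>N) = (\<integral>v. (\<integral>x. F0 (y v) x \<partial>P) \<partial>cube_law \<alpha>)"
    using N.integral_fst'[OF int] by simp
  also have "\<dots> = (\<integral>v. indicator X v *\<^sub>R (\<integral>x. F0 (y v) x \<partial>P) \<partial>cube_law \<alpha>)"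
    by (rule integral_cong_AE, measurable) (use AE_cube_law[OF \<alpha>] in \<open>auto elim!: eventually_mono\<close>)
  also have "\<dots> = (LINT v:X|cube_law \<alpha>. f (y v))"
    unfolding set_lebesgue_integral_def
    by (intro Bochner_Integration.integral_cong refl) (use y(1) in \<open>auto simp: F0_eq expected_def indicator_def\<close>)
  finally show "(\<integral>z. F0 (y (fst z)) (snd z) \<partial>N) = (LINT v:X|cube_law \<alpha>. f (y v))" .
qed

lemma f_Lipschitz:
  assumes w: "w \<in> cube \<kappa>" "w' \<in> cube \<kappa>"
  shows "\<bar>f w - f w'\<bar> \<le> L0 * norm (w - w')"
proof -
  have "f w - f w' = (\<integral>x. F w x - F w' x \<partial>P)"
    unfolding expected_def using F_int w by simp
  also have "\<bar>\<dots>\<bar> \<le> (\<integral>x. \<bar>F w x - F w' x\<bar> \<partial>P)"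
    by (rule integral_abs_bound)
  also have "\<dots> \<le> (\<integral>x. L x * norm (w - w') \<partial>P)"
    using F_int w integrable_L by (intro integral_mono_AE) (use F_lip w in \<open>auto elim!: eventually_mono\<close>)
  finally show ?thesis by simp
qed

lemma f_continuous: "continuous_on (cube \<kappa>) f"
proof -
  have "(max 0 L0)-lipschitz_on (cube \<kappa>) f"
  proof (rule lipschitz_onI)
    fix w w' :: "real ^ 'd" assume "w \<in> cube \<kappa>" "w' \<in> cube \<kappa>"
    from f_Lipschitz[OF this] show "dist (f w) (f w') \<le> max 0 L0 * dist w w'"
      unfolding dist_norm real_norm_def by (rule order_trans) (intro mult_right_mono; simp)
  qed simp
  then show ?thesis by (rule lipschitz_on_continuous_on)
qed

lemma set_integrable_f:
  assumes "continuous_on X y" "\<And>v. v \<in> X \<Longrightarrow> y v \<in> cube \<kappa>"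
  shows "set_integrable (cube_law \<alpha>) X (\<lambda>v. f (y v))"
  by (rule set_integral_cube_law(2)[OF \<alpha>], rule continuous_on_compose2[OF f_continuous])
    (use assms in auto)

text \<open>The common source of several estimates: \<open>b\<close> is the shift \<open>t\<close>
  for slabs against faces, the constant \<open>norm (w - w')\<close> for the Lipschitz bounds, and
  the norm of the perturbation for \<open>fs\<close> against \<open>f\<close>.\<close>

lemma set_integral_f_diff_le:
  assumes y: "continuous_on X y" "\<And>v. v \<in> X \<Longrightarrow> y v \<in> cube \<kappa>"
    and y': "continuous_on X y'" "\<And>v. v \<in> X \<Longrightarrow> y' v \<in> cube \<kappa>"
    and b: "integrable (cube_law \<alpha>) b" "\<And>v. v \<in> X \<Longrightarrow> norm (y v - y' v) \<le> b v"
    and L0: "0 \<le> L0"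
  shows "\<bar>(LINT v:X|cube_law \<alpha>. f (y v)) - (LINT v:X|cube_law \<alpha>. f (y' v))\<bar> \<le> L0 * (\<integral>v. b v \<partial>cube_law \<alpha>)"
proof -
  note int = set_integrable_f[OF y] set_integrable_f[OF y']
  have "(LINT v:X|cube_law \<alpha>. f (y v)) - (LINT v:X|cube_law \<alpha>. f (y' v))
      = (\<integral>v. indicator X v *\<^sub>R (f (y v) - f (y' v)) \<partial>cube_law \<alpha>)"
    using set_integral_diff(2)[OF int] by (simp add: set_lebesgue_integral_def)
  also have "\<bar>\<dots>\<bar> \<le> (\<integral>v. \<bar>indicator X v *\<^sub>R (f (y v) - f (y' v))\<bar> \<partial>cube_law \<alpha>)"
    by (rule integral_abs_bound)
  also have "\<dots> \<le> (\<integral>v. L0 * b v \<partial>cube_law \<alpha>)"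
  proof (rule integral_mono_AE)
    show "integrable (cube_law \<alpha>) (\<lambda>v. \<bar>indicator X v *\<^sub>R (f (y v) - f (y' v))\<bar>)"
      using set_integral_diff(1)[OF int] unfolding set_integrable_def by (rule integrable_abs)
    show "integrable (cube_law \<alpha>) (\<lambda>v. L0 * b v)"
      using b by simp
    show "AE v in cube_law \<alpha>. \<bar>indicator X v *\<^sub>R (f (y v) - f (y' v))\<bar> \<le> L0 * b v"
      using AE_cube_law[OF \<alpha>]
    proof eventually_elim
      case (elim v)
      then show ?case
        using f_Lipschitz[OF y(2) y'(2), OF elim elim] mult_left_mono[OF b(2)[OF elim] L0] by simp
    qed
  qed
  finally show ?thesis by simp
qed

end

section \<open>The gradient of the smoothed function\<close>

context smoothed_expectation
begin

lemma cube_law_UNIV [simp]: "measure (cube_law \<alpha> :: (real ^ 'd) measure) UNIV = 1"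
  using C.prob_space by simp

lemma L0_nonneg: "0 \<le> L0"
  using AE_Lipschitz_sample
  by (intro integral_nonneg_AE) (auto elim!: eventually_mono simp: Lipschitz_sample_def)

text \<open>The exceptional null set depends on \<open>w\<close>. This is harmless because all
  moments are computed at a fixed point, and random iterates are frozen by independence.\<close>

lemma AE_G0:
  assumes w: "w \<in> cube \<beta>"
  shows "AE z in N. fst z \<in> X \<and> Lipschitz_sample (snd z)
    \<and> GDERIV (\<lambda>y. F y (snd z)) (w + fst z) :> G0 (w + fst z) (snd z)"
  using AE_N G_deriv[OF w]
proof eventually_elim
  case (elim z)
  then have "w + fst z \<in> cube (\<beta> + ereal (\<alpha> / 2))"
    using add_mem[OF w] by blast
  with elim show ?case
    by (simp add: G0_def case_prod_beta)
qed

lemma shift_mem: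
  assumes "\<beta> + ereal (\<alpha> / 2) + ereal e \<le> \<kappa>" "w \<in> cube \<beta>" "v \<in> X" "norm h \<le> e"
  shows "w + v + h \<in> cube \<kappa>"
  using cube_add[OF add_mem[OF assms(2,3)] mem_cube_of_norm_le[OF assms(4)]] cube_mono[OF assms(1)] by blast

lemma norm_G0_le:
  assumes w: "w \<in> cube \<beta>" and v: "v \<in> X" and x: "Lipschitz_sample x"
    and D: "GDERIV (\<lambda>y. F y x) (w + v) :> D"
  shows "norm D \<le> L x"
proof -
  obtain e where e: "e > 0" "\<beta> + ereal (\<alpha> / 2) + ereal e \<le> \<kappa>" by (rule room)
  show ?thesis
  proof (rule GDERIV_norm_le[OF D open_ball])
    show "w + v \<in> ball (w + v) e" using e by simp
    show "0 \<le> L x" using x by (simp add: Lipschitz_sample_def)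
    fix y assume "y \<in> ball (w + v) e"
    then have "norm (y - (w + v)) \<le> e"
      by (simp add: dist_norm norm_minus_commute)
    from shift_mem[OF e(2) w v this] have "y \<in> cube \<kappa>" by simp
    then show "\<bar>F y x - F (w + v) x\<bar> \<le> L x * norm (y - (w + v))"
      using x add_mem_\<kappa>[OF w v] by (simp add: Lipschitz_sample_def)
  qed
qed

lemma AE_norm_G0_le:
  assumes w: "w \<in> cube \<beta>"
  shows "AE z in N. norm (G0 (w + fst z) (snd z)) \<le> L (snd z)"
  using AE_G0[OF w] by eventually_elim (auto intro: norm_G0_le[OF w])

lemma integrable_G0:
  assumes w: "w \<in> cube \<beta>"
  shows "integrable N (\<lambda>z. G0 (w + fst z) (snd z))"
proof (rule Bochner_Integration.integrable_bound[OF snd_N(1)[OF integrable_L]])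
  show "AE z in N. norm (G0 (w + fst z) (snd z)) \<le> norm (L (snd z))"
    using AE_norm_G0_le[OF w] by eventually_elim simp
qed measurable

lemma fs_eq_integral:
  assumes "\<And>v. v \<in> X \<Longrightarrow> w + v \<in> cube \<kappa>"
  shows "integrable N (\<lambda>z. F0 (w + fst z) (snd z))" and "fs w = (\<integral>z. F0 (w + fst z) (snd z) \<partial>N)"
proof -
  have "norm (w + v) \<le> norm w + sqrt CARD('d) * (\<alpha> / 2)" if "v \<in> X" for v
    using norm_triangle_ineq[of w v] norm_le_of_mem_cube[OF that] \<alpha> by simp
  note * = integral_along[of "\<lambda>v. w + v", OF _ assms this]
  show "integrable N (\<lambda>z. F0 (w + fst z) (snd z))"
    by (rule *) auto
  show "fs w = (\<integral>z. F0 (w + fst z) (snd z) \<partial>N)"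
    unfolding smoothed_def by (rule *(2)[symmetric]) auto
qed

text \<open>Dominated convergence for the remainder of the linear approximation divided by
  \<open>norm h\<close>. For fixed \<open>w\<close>, almost every perturbation lands at a point of
  differentiability, which is why the average is differentiable at every \<open>w\<close>.\<close>

lemma GDERIV_fs:
  assumes w: "w \<in> cube \<beta>"
  shows "GDERIV fs w :> gr w"
proof -
  obtain e where e: "e > 0" "\<beta> + ereal (\<alpha> / 2) + ereal e \<le> \<kappa>" by (rule room)
  have mem: "w + h + v \<in> cube \<kappa>" if "norm h \<le> e" "v \<in> X" for h v
    using shift_mem[OF e(2) w that(2,1)] by (simp add: add_ac)
  define q where "q h z = (F0 (w + h + fst z) (snd z) - F0 (w + fst z) (snd z)
    - h \<bullet> G0 (w + fst z) (snd z)) / norm h" for h z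
  have int: "integrable N (\<lambda>z. F0 (w + h + fst z) (snd z))" if "norm h \<le> e" for h
    using fs_eq_integral(1)[of "w + h"] mem that by blast
  have int0: "integrable N (\<lambda>z. F0 (w + fst z) (snd z))"
    using int[of 0] e by simp
  have intG: "integrable N (\<lambda>z. h \<bullet> G0 (w + fst z) (snd z))" for h
    by (rule integrable_inner_right) (rule integrable_G0[OF w])
  have q_int: "(\<integral>z. q h z \<partial>N) = (fs (w + h) - fs w - h \<bullet> gr w) / norm h" if "norm h \<le> e" for h
  proof -
    have "fs (w + h) = (\<integral>z. F0 (w + h + fst z) (snd z) \<partial>N)" "fs w = (\<integral>z. F0 (w + fst z) (snd z) \<partial>N)"
      using fs_eq_integral(2)[of "w + h"] fs_eq_integral(2)[of w] mem[OF that] mem[of 0] e by auto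
    moreover have "(\<integral>z. h \<bullet> G0 (w + fst z) (snd z) \<partial>N) = h \<bullet> gr w"
      unfolding gr_def by (rule integral_inner_right) (use integrable_G0[OF w] in simp)
    ultimately show ?thesis
      unfolding q_def using int[OF that] int0 intG by simp
  qed
  \<comment> \<open>The ball keeps all increments within the slack around the perturbed points; it
    is open and contains the origin, so the restriction disappears afterwards.\<close>
  have "((\<lambda>h. norm (fs (w + h) - fs w - h \<bullet> gr w) / norm h) \<longlongrightarrow> 0) (at 0 within ball 0 e)"
    unfolding tendsto_at_iff_sequentially o_def
  proof (intro allI impI)
    fix H :: "nat \<Rightarrow> real ^ 'd"
    assume H: "\<forall>n. H n \<in> ball 0 e - {0}" "H \<longlonglongrightarrow> 0"
    then have He: "norm (H n) \<le> e" and Hn: "H n \<noteq> 0" for n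
      by (auto simp: less_imp_le)
    have "(\<lambda>n. \<integral>z. q (H n) z \<partial>N) \<longlonglongrightarrow> (\<integral>z. 0 \<partial>N)"
    \<comment> \<open>One \<open>L\<close> bounds the difference quotient, the other the
      gradient.\<close>
    proof (rule integral_dominated_convergence[where w = "\<lambda>z. 2 * L (snd z)"])
      show "integrable N (\<lambda>z. 2 * L (snd z))"
        using snd_N(1)[OF integrable_L] by simp
      show "q (H n) \<in> borel_measurable N" for n
        unfolding q_def by measurable
      show "AE z in N. norm (q (H n) z) \<le> 2 * L (snd z)" for n
        using AE_G0[OF w]
      proof eventually_elim
        case (elim z)
        have "\<bar>F0 (w + H n + fst z) (snd z) - F0 (w + fst z) (snd z)\<bar> \<le> L (snd z) * norm (H n)"
        proof -
          have m: "w + H n + fst z \<in> cube \<kappa>" "w + fst z \<in> cube \<kappa>"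
            using mem[OF He] add_mem_\<kappa>[OF w] elim by auto
          have "\<bar>F (w + H n + fst z) (snd z) - F (w + fst z) (snd z)\<bar>
              \<le> L (snd z) * norm ((w + H n + fst z) - (w + fst z))"
            using elim m unfolding Lipschitz_sample_def by blast
          then show ?thesis
            using m by (simp add: F0_eq)
        qed
        moreover have "\<bar>H n \<bullet> G0 (w + fst z) (snd z)\<bar> \<le> norm (H n) * norm (G0 (w + fst z) (snd z))"
          by (rule Cauchy_Schwarz_ineq2)
        moreover have "norm (H n) * norm (G0 (w + fst z) (snd z)) \<le> L (snd z) * norm (H n)"
          using norm_G0_le[OF w, of "fst z" "snd z"] elim by (simp add: mult.commute[of _ "norm (H n)"] mult_left_mono)
        ultimately have "\<bar>F0 (w + H n + fst z) (snd z) - F0 (w + fst z) (snd z) - H n \<bullet> G0 (w + fst z) (snd z)\<bar>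
            \<le> 2 * L (snd z) * norm (H n)"
          by linarith
        then show ?case
          using Hn[of n] by (simp add: q_def abs_divide divide_le_eq)
      qed
      show "AE z in N. (\<lambda>n. q (H n) z) \<longlonglongrightarrow> 0"
        using AE_G0[OF w]
      proof eventually_elim
        case (elim z)
        then have lim: "((\<lambda>h. norm (F (w + fst z + h) (snd z) - F (w + fst z) (snd z) - h \<bullet> G0 (w + fst z) (snd z)) / norm h)
            \<longlongrightarrow> 0) (at 0)"
          by (simp add: gderiv_def has_derivative_at)
        have "filterlim H (at 0) sequentially"
          using H(2) Hn by (auto simp: filterlim_at)
        from filterlim_compose[OF lim this]
        have "(\<lambda>n. norm (F (w + fst z + H n) (snd z) - F (w + fst z) (snd z) - H n \<bullet> G0 (w + fst z) (snd z)) / norm (H n))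
            \<longlonglongrightarrow> 0" .
        moreover have "norm (F (w + fst z + H n) (snd z) - F (w + fst z) (snd z) - H n \<bullet> G0 (w + fst z) (snd z)) / norm (H n)
            = \<bar>q (H n) z\<bar>" for n
        proof -
          have "F0 (w + H n + fst z) (snd z) = F (w + fst z + H n) (snd z)" "F0 (w + fst z) (snd z) = F (w + fst z) (snd z)"
            using mem[OF He, of "fst z" n] add_mem_\<kappa>[OF w, of "fst z"] elim by (auto simp: F0_eq add_ac)
          then show ?thesis
            by (simp add: q_def abs_divide)
        qed
        ultimately show ?case
          by (simp add: tendsto_rabs_zero_iff)
      qed
    qed auto
    then have "(\<lambda>n. (fs (w + H n) - fs w - H n \<bullet> gr w) / norm (H n)) \<longlonglongrightarrow> 0"
      by (simp add: q_int[OF He])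
    then have "(\<lambda>n. \<bar>(fs (w + H n) - fs w - H n \<bullet> gr w) / norm (H n)\<bar>) \<longlonglongrightarrow> 0"
      by (rule tendsto_rabs_zero)
    then show "(\<lambda>n. norm (fs (w + H n) - fs w - H n \<bullet> gr w) / norm (H n)) \<longlonglongrightarrow> 0"
      by (simp add: abs_divide)
  qed
  then have "((\<lambda>h. norm (fs (w + h) - fs w - h \<bullet> gr w) / norm h) \<longlongrightarrow> 0) (at 0)"
    using e by (subst (asm) at_within_open) auto
  then show ?thesis
    by (simp add: gderiv_def has_derivative_at bounded_linear_inner_left)
qed

text \<open>The difference quotient of \<open>fs\<close> is an average of differences of \<open>f\<close> over two thin slabs.\<close>

lemma gr_nth:
  assumes w: "w \<in> cube \<beta>"
  shows "gr w $ i = 1 / \<alpha> * ((LINT v:X|cube_law \<alpha>. f (w + upd_coord i (\<alpha> / 2) v))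
      - (LINT v:X|cube_law \<alpha>. f (w + upd_coord i (- (\<alpha> / 2)) v)))" (is "_ = ?d")
proof -
  obtain e where e: "e > 0" "\<beta> + ereal (\<alpha> / 2) + ereal e \<le> \<kappa>" by (rule room)
  define Q where "Q = (\<lambda>t. (fs (w + t *\<^sub>R axis i 1) - fs w) / t)"
  have "((\<lambda>t. fs (w + t *\<^sub>R axis i 1)) has_real_derivative axis i 1 \<bullet> gr w) (at 0)"
    by (rule GDERIV_along_line) (use GDERIV_fs[OF w] in simp)
  then have "(Q \<longlongrightarrow> gr w $ i) (at 0)"
    by (simp add: has_field_derivative_iff Q_def cart_eq_inner_axis inner_commute)
  \<comment> \<open>The derivative is already known to exist, so a one-sided limit identifies it;
    the shift identity is stated for positive \<open>t\<close>.\<close>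
  then have lim: "(Q \<longlongrightarrow> gr w $ i) (at_right 0)"
    by (rule filterlim_mono) (auto simp: at_le)
  have bound: "\<bar>Q t - ?d\<bar> \<le> 2 * L0 / \<alpha> * t" if t: "0 < t" "t \<le> min e \<alpha>" for t
  proof -
    define T where "T c v = upd_coord i (c + t / 2 + t / \<alpha> * v $ i) v" for c and v :: "real ^ 'd"
    have wY: "w + v \<in> cube \<kappa>"
      if v: "- (\<alpha> / 2) \<le> v $ i" "v $ i \<le> \<alpha> / 2 + t" "\<forall>j. j \<noteq> i \<longrightarrow> \<bar>v $ j\<bar> \<le> \<alpha> / 2" for v
    proof -
      \<comment> \<open>The overshoot of \<open>v $ i\<close> past the cube. Removing it returns to
        the cube, and it is at most \<open>t\<close>, hence within the slack
        \<open>e\<close>.\<close>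
      define s where "s = max 0 (v $ i - \<alpha> / 2)"
      define v' where "v' = v - s *\<^sub>R axis i 1"
      have "v' \<in> X"
        unfolding cube_ereal
      proof safe
        fix j show "\<bar>v' $ j\<bar> \<le> \<alpha> / 2"
          using v \<alpha> by (cases "j = i") (auto simp: v'_def s_def axis_def max_def)
      qed
      moreover have "norm (s *\<^sub>R axis i 1 :: real ^ 'd) \<le> e"
        using v t by (simp add: s_def norm_axis_1)
      ultimately have "w + v' + s *\<^sub>R axis i 1 \<in> cube \<kappa>"
        by (intro shift_mem[OF e(2) w])
      then show ?thesis by (simp add: v'_def)
    qed
    have bd: "- (t / 2) \<le> t / \<alpha> * v $ i" "t / \<alpha> * v $ i \<le> t / 2" if "v \<in> X" for v
    proof -
      have "\<bar>t / \<alpha> * v $ i\<bar> \<le> t / \<alpha> * (\<alpha> / 2)"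
        unfolding abs_mult using that t \<alpha> by (intro mult_mono) (auto simp: cube_ereal)
      then have "\<bar>t / \<alpha> * v $ i\<bar> \<le> t / 2"
        using \<alpha> by simp
      then show "- (t / 2) \<le> t / \<alpha> * v $ i" "t / \<alpha> * v $ i \<le> t / 2"
        by (simp_all only: abs_le_interval_iff)
    qed
    have Tmem: "w + T c v \<in> cube \<kappa>" if "c = \<alpha> / 2 \<or> c = - (\<alpha> / 2)" "v \<in> X" for c v
    proof (rule wY)
      have eq: "T c v $ i = c + t / 2 + t / \<alpha> * v $ i"
        by (simp add: T_def upd_coord_nth)
      show "- (\<alpha> / 2) \<le> T c v $ i" "T c v $ i \<le> \<alpha> / 2 + t"
        unfolding eq using that(1) bd[OF that(2)] t \<alpha> by (elim disjE; linarith)+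
      show "\<forall>j. j \<noteq> i \<longrightarrow> \<bar>T c v $ j\<bar> \<le> \<alpha> / 2"
        using that(2) by (simp add: T_def upd_coord_nth cube_ereal)
    qed
    \<comment> \<open>A rescaled slab point and the corresponding face point differ only in
      coordinate \<open>i\<close>, by an amount between 0 and \<open>t\<close>.\<close>
    have near: "\<bar>(LINT v:X|cube_law \<alpha>. f (w + T c v)) - (LINT v:X|cube_law \<alpha>. f (w + upd_coord i c v))\<bar> \<le> L0 * t"
      if c: "c = \<alpha> / 2 \<or> c = - (\<alpha> / 2)" for c
    proof -
      have "\<bar>(LINT v:X|cube_law \<alpha>. f (w + T c v)) - (LINT v:X|cube_law \<alpha>. f (w + upd_coord i c v))\<bar>
          \<le> L0 * (\<integral>v. t \<partial>(cube_law \<alpha> :: (real ^ 'd) measure))"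
      proof (rule set_integral_f_diff_le[OF _ _ _ _ _ _ L0_nonneg])
        show "continuous_on X (\<lambda>v. w + T c v)" "continuous_on X (\<lambda>v. w + upd_coord i c v)"
          unfolding T_def using \<alpha> by (intro continuous_intros; simp)+
        show "w + T c v \<in> cube \<kappa>" if "v \<in> X" for v
          using Tmem[OF c that] .
        show "w + upd_coord i c v \<in> cube \<kappa>" if "v \<in> X" for v
          using add_mem_\<kappa>[OF w upd_coord_mem_cube[OF that]] c \<alpha> by auto
        show "norm ((w + T c v) - (w + upd_coord i c v)) \<le> t" if "v \<in> X" for v
        proof -
          have "(w + T c v) - (w + upd_coord i c v) = (t / 2 + t / \<alpha> * v $ i) *\<^sub>R axis i 1"
            by (auto simp: vec_eq_iff T_def upd_coord_nth axis_def)
          also have "norm \<dots> = \<bar>t / 2 + t / \<alpha> * v $ i\<bar>"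
            by (simp only: norm_scaleR norm_axis_1 mult_1_right)
          also have "\<dots> \<le> t"
            using bd[OF that] by linarith
          finally show ?thesis .
        qed
      qed simp
      then show ?thesis
        by simp
    qed
    define I where "I c = (LINT v:X|cube_law \<alpha>. f (w + T c v))" for c
    define J where "J c = (LINT v:X|cube_law \<alpha>. f (w + upd_coord i c v))" for c
    have "fs (w + t *\<^sub>R axis i 1) - fs w = t / \<alpha> * (I (\<alpha> / 2) - I (- (\<alpha> / 2)))"
    proof -
      have "(LINT v:X|cube_law \<alpha>. f (w + (v + t *\<^sub>R axis i 1))) - (LINT v:X|cube_law \<alpha>. f (w + v))
          = t / \<alpha> * (I (\<alpha> / 2) - I (- (\<alpha> / 2)))"
        unfolding I_def T_def
      proof (rule cube_law_shift_difference[OF \<alpha>])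
        show "continuous_on {v. - (\<alpha> / 2) \<le> v $ i \<and> v $ i \<le> \<alpha> / 2 + t \<and> (\<forall>j. j \<noteq> i \<longrightarrow> \<bar>v $ j\<bar> \<le> \<alpha> / 2)}
            (\<lambda>v. f (w + v))"
          by (rule continuous_on_compose2[OF f_continuous]) (auto intro!: continuous_intros wY)
      qed (use t in auto)
      moreover have "w + (v + t *\<^sub>R axis i 1) = w + t *\<^sub>R axis i 1 + v" for v
        by simp
      ultimately show ?thesis
        unfolding smoothed_def by simp
    qed
    then have "Q t = 1 / \<alpha> * (I (\<alpha> / 2) - I (- (\<alpha> / 2)))"
      using t by (simp add: Q_def)
    then have "Q t - ?d = 1 / \<alpha> * ((I (\<alpha> / 2) - J (\<alpha> / 2)) - (I (- (\<alpha> / 2)) - J (- (\<alpha> / 2))))"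
      by (simp add: J_def algebra_simps)
    also have "\<bar>\<dots>\<bar> = 1 / \<alpha> * \<bar>(I (\<alpha> / 2) - J (\<alpha> / 2)) - (I (- (\<alpha> / 2)) - J (- (\<alpha> / 2)))\<bar>"
      using \<alpha> by (simp add: abs_mult)
    also have "\<dots> \<le> 1 / \<alpha> * (L0 * t + L0 * t)"
    proof (rule mult_left_mono)
      show "\<bar>(I (\<alpha> / 2) - J (\<alpha> / 2)) - (I (- (\<alpha> / 2)) - J (- (\<alpha> / 2)))\<bar> \<le> L0 * t + L0 * t"
        using near[of "\<alpha> / 2"] near[of "- (\<alpha> / 2)"] unfolding I_def[symmetric] J_def[symmetric] by linarith
    qed (use \<alpha> in simp)
    finally show ?thesis by (simp add: mult_ac)
  qed
  have "((\<lambda>t. 2 * L0 / \<alpha> * t) \<longlongrightarrow> 2 * L0 / \<alpha> * 0) (at_right 0)"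
    by (intro tendsto_intros)
  then have lim0: "((\<lambda>t. 2 * L0 / \<alpha> * t) \<longlongrightarrow> 0) (at_right 0)"
    by simp
  have "\<forall>\<^sub>F t in at_right 0. 0 < t \<and> t \<le> min e \<alpha>"
    unfolding eventually_at_right_field using e \<alpha> by (intro exI[of _ "min e \<alpha>"]) auto
  then have "\<forall>\<^sub>F t in at_right 0. norm (Q t - ?d) \<le> 2 * L0 / \<alpha> * t"
    by eventually_elim (use bound in simp)
  then have "((\<lambda>t. Q t - ?d) \<longlongrightarrow> 0) (at_right 0)"
    by (rule Lim_null_comparison[OF _ lim0])
  then have "(Q \<longlongrightarrow> ?d) (at_right 0)"
    by (simp only: LIM_zero_iff)
  with lim show ?thesis
    by (intro tendsto_unique) (auto simp: trivial_limit_at_right_real)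
qed

lemma integral_diff_at:
  assumes w: "w \<in> cube \<beta>" and w': "w' \<in> cube \<beta>"
    and y: "continuous_on UNIV y" "\<And>v. v \<in> X \<Longrightarrow> y v \<in> X"
  shows "\<bar>(LINT v:X|cube_law \<alpha>. f (w + y v)) - (LINT v:X|cube_law \<alpha>. f (w' + y v))\<bar> \<le> L0 * norm (w - w')"
proof -
  have "\<bar>(LINT v:X|cube_law \<alpha>. f (w + y v)) - (LINT v:X|cube_law \<alpha>. f (w' + y v))\<bar>
      \<le> L0 * (\<integral>v. norm (w - w') \<partial>(cube_law \<alpha> :: (real ^ 'd) measure))"
    by (rule set_integral_f_diff_le[OF _ _ _ _ _ _ L0_nonneg])
      (use y add_mem_\<kappa>[OF w] add_mem_\<kappa>[OF w'] in \<open>auto intro!: continuous_intros intro: continuous_on_subset\<close>)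
  then show ?thesis
    by simp
qed

lemma fs_Lipschitz:
  assumes "w \<in> cube \<beta>" "w' \<in> cube \<beta>"
  shows "\<bar>fs w - fs w'\<bar> \<le> L0 * norm (w - w')"
  unfolding smoothed_def using integral_diff_at[OF assms, of "\<lambda>v. v"] by (simp add: continuous_on_id)

lemma fs_f_le:
  assumes w: "w \<in> cube \<beta>"
  shows "\<bar>fs w - f w\<bar> \<le> L0 * (\<alpha> / 2 * sqrt (CARD('d) / 3))"
proof -
  have w\<kappa>: "w \<in> cube \<kappa>"
    using w cube_\<beta>_subset by blast
  have "(LINT v:X|cube_law \<alpha>. f w) = f w"
    using cube_law_integral_eq[OF \<alpha>, of "\<lambda>_ :: real ^ 'd. f w"] by simp
  then have "\<bar>fs w - f w\<bar> = \<bar>(LINT v:X|cube_law \<alpha>. f (w + v)) - (LINT v:X|cube_law \<alpha>. f w)\<bar>"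
    by (simp add: smoothed_def)
  also have "\<dots> \<le> L0 * (\<integral>v. norm v \<partial>(cube_law \<alpha> :: (real ^ 'd) measure))"
    by (rule set_integral_f_diff_le[OF _ _ _ _ cube_law_expected_norm(1)[OF \<alpha>] _ L0_nonneg])
      (use add_mem_\<kappa>[OF w] w\<kappa> in \<open>auto intro!: continuous_intros\<close>)
  also have "\<dots> \<le> L0 * (\<alpha> / 2 * sqrt (CARD('d) / 3))"
    by (intro mult_left_mono cube_law_expected_norm(2)[OF \<alpha>] L0_nonneg)
  finally show ?thesis .
qed

lemma norm_le_of_nth_le:
  fixes x :: "real ^ 'n"
  assumes "\<And>i. \<bar>x $ i\<bar> \<le> c"
  shows "norm x \<le> sqrt (CARD('n)) * c"
  using assms order_trans[OF abs_ge_zero assms] by (intro norm_le_of_mem_cube) (auto simp: cube_ereal)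

text \<open>Each coordinate is \<open>1 / \<alpha>\<close> times the difference of two averages of
  \<open>f\<close> over opposite faces, both Lipschitz with constant \<open>L0\<close>; passing from
  coordinates to the Euclidean norm costs the root of the dimension.\<close>

lemma gr_Lipschitz:
  assumes w: "w \<in> cube \<beta>" and w': "w' \<in> cube \<beta>"
  shows "norm (gr w - gr w') \<le> 2 * inverse \<alpha> * sqrt (CARD('d)) * L0 * norm (w - w')"
proof -
  have "\<bar>(gr w - gr w') $ i\<bar> \<le> 2 / \<alpha> * (L0 * norm (w - w'))" for i
  proof -
    define I where "I c w = (LINT v:X|cube_law \<alpha>. f (w + upd_coord i c v))" for c w
    have I: "\<bar>I c w - I c w'\<bar> \<le> L0 * norm (w - w')" if "\<bar>c\<bar> \<le> \<alpha> / 2" for c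
      unfolding I_def
      by (rule integral_diff_at[OF w w']) (use that in \<open>auto intro!: continuous_intros upd_coord_mem_cube\<close>)
    have "(gr w - gr w') $ i = 1 / \<alpha> * ((I (\<alpha> / 2) w - I (\<alpha> / 2) w') - (I (- (\<alpha> / 2)) w - I (- (\<alpha> / 2)) w'))"
      using gr_nth[OF w, of i] gr_nth[OF w', of i] by (simp add: I_def algebra_simps)
    also have "\<bar>\<dots>\<bar> = 1 / \<alpha> * \<bar>(I (\<alpha> / 2) w - I (\<alpha> / 2) w') - (I (- (\<alpha> / 2)) w - I (- (\<alpha> / 2)) w')\<bar>"
      using \<alpha> by (simp add: abs_mult)
    also have "\<dots> \<le> 1 / \<alpha> * (L0 * norm (w - w') + L0 * norm (w - w'))"
    proof (rule mult_left_mono)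
      show "\<bar>(I (\<alpha> / 2) w - I (\<alpha> / 2) w') - (I (- (\<alpha> / 2)) w - I (- (\<alpha> / 2)) w')\<bar>
          \<le> L0 * norm (w - w') + L0 * norm (w - w')"
        using I[of "\<alpha> / 2"] I[of "- (\<alpha> / 2)"] \<alpha> by (simp only: abs_minus_cancel) linarith
    qed (use \<alpha> in simp)
    finally show ?thesis by simp
  qed
  from norm_le_of_nth_le[OF this] show ?thesis
    by (simp add: field_simps)
qed

section \<open>The two gradient estimators\<close>

text \<open>The factor \<open>1 / \<alpha>\<close> is included, so both updates are steps of length
  \<eta> along a batch average.\<close>

definition est :: "spa_update \<Rightarrow> real ^ 'd \<Rightarrow> (real ^ 'd) \<times> (real ^ 'p) \<Rightarrow> real ^ 'd" where
  "est upd w s = (case upd of Finite_Difference \<Rightarrow> (1 / \<alpha>) *\<^sub>R finite_diff \<alpha> F0 w (fst s) (snd s)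
    | Gradient_Estimate \<Rightarrow> G0 (w + fst s) (snd s))"

definition dim_factor :: "spa_update \<Rightarrow> real" where
  "dim_factor upd = (case upd of Finite_Difference \<Rightarrow> real CARD('d) | Gradient_Estimate \<Rightarrow> 1)"

lemma finite_diff_nth:
  "finite_diff \<alpha> H w v x $ i = H (w + upd_coord i (\<alpha> / 2) v) x - H (w + upd_coord i (- (\<alpha> / 2)) v) x"
proof -
  have "(\<chi> j. if j = i then w $ i + \<alpha> / 2 else w $ j + v $ j) = w + upd_coord i (\<alpha> / 2) v"
    "(\<chi> j. if j = i then w $ i - \<alpha> / 2 else w $ j + v $ j) = w + upd_coord i (- (\<alpha> / 2)) v"
    by (simp_all add: vec_eq_iff upd_coord_nth)
  then show ?thesis
    by (simp add: finite_diff_def)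
qed

lemma measurable_vecI:
  fixes h :: "'b \<Rightarrow> real ^ 'n"
  assumes "\<And>i. (\<lambda>x. h x $ i) \<in> borel_measurable M"
  shows "h \<in> borel_measurable M"
  unfolding borel_measurable_euclidean_space[of h]
  using assms by (auto simp: Basis_vec_def inner_axis)

lemma est_meas: "(\<lambda>(w, s). est upd w s) \<in> borel_measurable (borel \<Otimes>\<^sub>M (borel \<Otimes>\<^sub>M borel))"
proof (cases upd)
  case Finite_Difference
  then show ?thesis
    unfolding case_prod_beta by (intro measurable_vecI) (simp add: est_def finite_diff_nth)
next
  case Gradient_Estimate
  then show ?thesis
    by (simp add: est_def case_prod_beta)
qed

lemma est_meas_N: "est upd w \<in> borel_measurable N"
  using measurable_Pair2[OF est_meas, of w] by (simp add: measurable_cong_sets[OF sets_N refl])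

text \<open>Each entry of the finite difference compares points at distance \<alpha> and is bounded
  by \<open>L\<close> after division, so the \<open>d\<close> entries contribute \<open>d\<close>
  times its square. A gradient is bounded by \<open>L\<close> in norm, without a dimension
  factor.\<close>

lemma est_square_le:
  assumes w: "w \<in> cube \<beta>"
  shows "AE z in N. (norm (est upd w z))\<^sup>2 \<le> dim_factor upd * (L (snd z))\<^sup>2"
proof (cases upd)
  case Finite_Difference
  show ?thesis
    using AE_N
  proof eventually_elim
    case (elim z)
    have "\<bar>est upd w z $ i\<bar> \<le> L (snd z)" for i
    proof -
      have m: "w + upd_coord i c (fst z) \<in> cube \<kappa>" if "\<bar>c\<bar> \<le> \<alpha> / 2" for c
        using add_mem_\<kappa>[OF w upd_coord_mem_cube[OF _ that]] elim by blast
      have m1: "w + upd_coord i (\<alpha> / 2) (fst z) \<in> cube \<kappa>"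
        and m2: "w + upd_coord i (- (\<alpha> / 2)) (fst z) \<in> cube \<kappa>"
        using m[of "\<alpha> / 2"] m[of "- (\<alpha> / 2)"] \<alpha> by simp_all
      have "\<bar>F (w + upd_coord i (\<alpha> / 2) (fst z)) (snd z) - F (w + upd_coord i (- (\<alpha> / 2)) (fst z)) (snd z)\<bar>
          \<le> L (snd z) * norm ((w + upd_coord i (\<alpha> / 2) (fst z)) - (w + upd_coord i (- (\<alpha> / 2)) (fst z)))"
        using elim m1 m2 unfolding Lipschitz_sample_def by blast
      also have "(w + upd_coord i (\<alpha> / 2) (fst z)) - (w + upd_coord i (- (\<alpha> / 2)) (fst z)) = \<alpha> *\<^sub>R axis i 1"
        by (auto simp: vec_eq_iff upd_coord_nth axis_def)
      also have "norm (\<alpha> *\<^sub>R axis i 1 :: real ^ 'd) = \<alpha>"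
        using \<alpha> by (simp add: norm_axis_1)
      finally show ?thesis
        using m1 m2 \<alpha>
        by (simp add: est_def Finite_Difference finite_diff_nth F0_eq abs_mult divide_le_eq)
    qed
    then have "norm (est upd w z) \<le> sqrt (CARD('d)) * L (snd z)"
      by (rule norm_le_of_nth_le)
    then have "(norm (est upd w z))\<^sup>2 \<le> (sqrt (CARD('d)) * L (snd z))\<^sup>2"
      by (intro power_mono) auto
    then show ?case
      by (simp add: dim_factor_def Finite_Difference power_mult_distrib)
  qed
next
  case Gradient_Estimate
  show ?thesis
    using AE_norm_G0_le[OF w] by eventually_elim (simp add: est_def dim_factor_def Gradient_Estimate power_mono)
qed

lemma dim_factor_nonneg: "0 \<le> dim_factor upd"
  by (cases upd) (auto simp: dim_factor_def)

lemma est_square: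
  assumes w: "w \<in> cube \<beta>"
  shows "integrable N (\<lambda>z. (norm (est upd w z))\<^sup>2)"
    and "(\<integral>z. (norm (est upd w z))\<^sup>2 \<partial>N) \<le> dim_factor upd * (\<integral>x. (L x)\<^sup>2 \<partial>P)"
proof -
  note [measurable] = est_meas_N
  have int: "integrable N (\<lambda>z. dim_factor upd * (L (snd z))\<^sup>2)"
    using snd_N(1)[OF L_sq] by simp
  show int2: "integrable N (\<lambda>z. (norm (est upd w z))\<^sup>2)"
  proof (rule Bochner_Integration.integrable_bound[OF int])
    show "AE z in N. norm ((norm (est upd w z))\<^sup>2) \<le> norm (dim_factor upd * (L (snd z))\<^sup>2)"
      using est_square_le[OF w, of upd] by eventually_elim simp
  qed measurable
  have "(\<integral>z. (norm (est upd w z))\<^sup>2 \<partial>N) \<le> (\<integral>z. dim_factor upd * (L (snd z))\<^sup>2 \<partial>N)"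
    by (rule integral_mono_AE[OF int2 int est_square_le[OF w]])
  then show "(\<integral>z. (norm (est upd w z))\<^sup>2 \<partial>N) \<le> dim_factor upd * (\<integral>x. (L x)\<^sup>2 \<partial>P)"
    using snd_N[OF L_sq] by simp
qed

text \<open>For the gradient estimator this is how \<open>gr\<close> was defined; for the finite
  difference, Fubini reduces each coordinate to the formula \<open>gr_nth\<close>.\<close>

lemma est_mean:
  assumes w: "w \<in> cube \<beta>"
  shows "(\<integral>z. est upd w z \<partial>N) = gr w"
proof (cases upd)
  case Finite_Difference
  have "integrable N (est upd w)"
    by (rule N.integrable_of_square_norm[OF est_meas_N est_square(1)[OF w]])
  then have "(\<integral>z. est upd w z \<partial>N) $ i = (\<integral>z. est upd w z $ i \<partial>N)" for i
    by (rule integral_bounded_linear[OF bounded_linear_vec_nth, symmetric])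
  also have "(\<integral>z. est upd w z $ i \<partial>N) = gr w $ i" for i
  proof -
    have I: "integrable N (\<lambda>z. F0 (w + upd_coord i c (fst z)) (snd z))"
      "(\<integral>z. F0 (w + upd_coord i c (fst z)) (snd z) \<partial>N) = (LINT v:X|cube_law \<alpha>. f (w + upd_coord i c v))"
      if c: "\<bar>c\<bar> \<le> \<alpha> / 2" for c
    proof -
      have 1: "(\<lambda>v. w + upd_coord i c v) \<in> borel_measurable borel"
        by measurable
      have 2: "w + upd_coord i c v \<in> cube \<kappa>" if "v \<in> X" for v
        by (rule add_mem_\<kappa>[OF w upd_coord_mem_cube[OF that c]])
      have 3: "norm (w + upd_coord i c v) \<le> norm w + sqrt CARD('d) * (\<alpha> / 2)" if "v \<in> X" for v
      proof -
        have "norm (upd_coord i c v) \<le> sqrt CARD('d) * (\<alpha> / 2)"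
          by (rule norm_le_of_mem_cube[OF upd_coord_mem_cube[OF that c]]) (use \<alpha> in simp)
        then show ?thesis
          using norm_triangle_ineq[of w "upd_coord i c v"] by linarith
      qed
      show "integrable N (\<lambda>z. F0 (w + upd_coord i c (fst z)) (snd z))"
        "(\<integral>z. F0 (w + upd_coord i c (fst z)) (snd z) \<partial>N) = (LINT v:X|cube_law \<alpha>. f (w + upd_coord i c v))"
        by (rule integral_along[OF 1 2 3]; assumption)+
    qed
    show ?thesis
      using I[of "\<alpha> / 2"] I[of "- (\<alpha> / 2)"] \<alpha>
      by (simp add: est_def Finite_Difference finite_diff_nth gr_nth[OF w])
  qed
  finally show ?thesis
    by (simp add: vec_eq_iff)
next
  case Gradient_Estimate
  then show ?thesis
    by (simp add: est_def gr_def)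
qed

text \<open>Links the algorithm to its version with extended functions. The perturbations lie in the
  cube only almost surely, so the link is used off a null set.\<close>

lemma spa_step_eq:
  assumes w: "w \<in> cube \<beta>" and u: "\<And>i. i \<in> {1..M} \<Longrightarrow> u i \<in> X"
  shows "spa_step upd \<alpha> F G \<eta> M w u x = w - \<eta> *\<^sub>R avg M (est upd) w (\<lambda>i. (u i, x i))"
proof (cases upd)
  case Finite_Difference
  have "finite_diff \<alpha> F w (u i) (x i) = finite_diff \<alpha> F0 w (u i) (x i)" if "i \<in> {1..M}" for i
    using add_mem_\<kappa>[OF w upd_coord_mem_cube[OF u[OF that]]] \<alpha>
    by (simp add: vec_eq_iff finite_diff_nth F0_eq)
  then show ?thesis
    by (simp add: Finite_Difference avg_def est_def flip: scaleR_sum_right)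
next
  case Gradient_Estimate
  have "G (w + u i) (x i) = G0 (w + u i) (x i)" if "i \<in> {1..M}" for i
    using add_mem[OF w u[OF that]] by (simp add: G0_def)
  then show ?thesis
    by (simp add: Gradient_Estimate avg_def est_def)
qed

lemma projected_step:
  assumes A: "A \<subseteq> cube \<beta>" and v: "v \<in> A" and p: "p \<in> proj_set A (v - \<eta> *\<^sub>R g)"
    and L0: "0 < L0" and \<rho>: "\<rho> > 0" and \<tau>: "\<tau> \<ge> 0" "\<rho> + \<tau> > 1"
    and \<eta>: "\<eta> = \<alpha> / (3 * \<rho> * sqrt (real CARD('d)) * L0)"
  shows "(infdist 0 ((\<lambda>y. gr p + y) ` normal_cone p A))\<^sup>2
    \<le> (2 * (1 + 3 * \<rho>) / (\<tau> + \<rho> - 1) + 3 * \<rho>) * (2 * inverse \<alpha> * sqrt (CARD('d)) * L0) * (fs v - fs p)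
      + (2 * (1 + 3 * \<rho>) / (\<tau> + \<rho> - 1) + 3) * (norm (gr v - g))\<^sup>2
      + 2 * (1 + 3 * \<rho>) / (\<tau> + \<rho> - 1) * (4 / 3 * (\<tau> / \<rho>\<^sup>2)) * (norm g)\<^sup>2"
proof (rule projected_step_bound[OF p v _ _ _ _ \<rho> \<tau>])
  let ?l = "2 * inverse \<alpha> * sqrt (CARD('d)) * L0"
  have v\<beta>: "v \<in> cube \<beta>" and p\<beta>: "p \<in> cube \<beta>"
    using A v p by (auto simp: proj_set_def is_arg_min_def)
  show "fs p \<le> fs v + gr v \<bullet> (p - v) + ?l / 2 * (norm (p - v))\<^sup>2"
    \<comment> \<open>The segment from \<open>v\<close> to \<open>p\<close> lies in the convex
      \<open>cube \<beta>\<close>, although it may leave \<open>A\<close>.\<close>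
    by (rule GDERIV_Lipschitz_descent[OF convex_cube v\<beta> p\<beta> GDERIV_fs gr_Lipschitz])
  \<comment> \<open>The descent inequality for \<open>- fs\<close> based at \<open>p\<close> is the
    ascent inequality required at the new point.\<close>
  have "- fs v \<le> - fs p + (- gr p) \<bullet> (v - p) + ?l / 2 * (norm (v - p))\<^sup>2"
  proof (rule GDERIV_Lipschitz_descent[OF convex_cube p\<beta> v\<beta>, where f = "\<lambda>x. - fs x" and g = "\<lambda>x. - gr x"])
    show "GDERIV (\<lambda>x. - fs x) z :> - gr z" if "z \<in> cube \<beta>" for z
      by (rule GDERIV_minus[OF GDERIV_fs[OF that]])
    show "norm (- gr z - - gr z') \<le> ?l * norm (z - z')" if "z \<in> cube \<beta>" "z' \<in> cube \<beta>" for z z'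
      using gr_Lipschitz[OF that] by (simp add: norm_minus_commute)
  qed
  then show "fs p + gr p \<bullet> (v - p) \<le> fs v + ?l / 2 * (norm (p - v))\<^sup>2"
    by (simp add: norm_minus_commute)
  show "norm (gr p - gr v) \<le> ?l * norm (p - v)"
    by (rule gr_Lipschitz[OF p\<beta> v\<beta>])
  show "0 < ?l"
    using L0 \<alpha> by simp
  show "\<eta> = 2 / (3 * \<rho> * ?l)"
    using \<alpha> by (simp add: \<eta> divide_simps)
qed

end

section \<open>Convergence of the projected algorithm\<close>

text \<open>The random number of draws is modelled by a full array of \<open>K\<close> rows of
  samples, independent of \<open>R\<close>; the recursion for \<open>W\<close> is imposed only up to
  time \<open>R\<close>. This allows the proof to continue the path to all \<open>K\<close> steps
  and average over \<open>R\<close> afterwards.\<close>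

theorem theorem12:
  fixes \<alpha> \<rho> \<tau> \<eta> L0 Q \<Delta> C1 C2 \<upsilon> :: real
    and \<beta> \<kappa> :: ereal
    and P :: "(real ^ 'p) measure"
    and F :: "real ^ 'd \<Rightarrow> real ^ 'p \<Rightarrow> real"
    and G :: "real ^ 'd \<Rightarrow> real ^ 'p \<Rightarrow> real ^ 'd"
    and L :: "real ^ 'p \<Rightarrow> real"
    and f f\<alpha> :: "real ^ 'd \<Rightarrow> real"
    and S A :: "(real ^ 'd) set"
    and w1 w\<alpha> ws :: "real ^ 'd"
    and K M :: nat
    and upd :: spa_update
    and \<Omega> :: "'o measure"
    and R :: "'o \<Rightarrow> nat"
    and u :: "nat \<Rightarrow> nat \<Rightarrow> 'o \<Rightarrow> real ^ 'd"
    and \<xi> :: "nat \<Rightarrow> nat \<Rightarrow> 'o \<Rightarrow> real ^ 'p"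
    and sel :: "nat \<Rightarrow> real ^ 'd \<Rightarrow> real ^ 'd"
    and W :: "nat \<Rightarrow> 'o \<Rightarrow> real ^ 'd"
  assumes "\<alpha> > 0" and "\<beta> > 0"
    and "(\<beta> < \<infinity> \<and> \<beta> + ereal (\<alpha> / 2) < \<kappa> \<and> \<kappa> < \<infinity>) \<or> (\<beta> = \<infinity> \<and> \<kappa> = \<infinity>)"
    and "prob_space P" and "sets P = sets borel"
    and "(\<lambda>(w, x). F w x) \<in> borel_measurable (restrict_space (borel \<Otimes>\<^sub>M borel) (cube \<kappa> \<times> UNIV))"
    and "\<And>w. w \<in> cube \<kappa> \<Longrightarrow> integrable P (F w)"
    and "\<And>x. continuous_on (cube \<kappa>) (\<lambda>w. F w x)"
    and "L \<in> borel_measurable borel"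
    and "AE x in P. \<forall>w\<in>cube \<kappa>. \<forall>w'\<in>cube \<kappa>. \<bar>F w x - F w' x\<bar> \<le> L x * norm (w - w')"
    and "integrable P (\<lambda>x. (L x)\<^sup>2)"
    and "Q = (\<integral>x. (L x)\<^sup>2 \<partial>P)"
    and "L0 = (\<integral>x. L x \<partial>P)" and "L0 > 0"
    and "f = expected P F" and "f\<alpha> = smoothed \<alpha> f"
    and "(\<lambda>(w, x). G w x) \<in> borel_measurable
           (restrict_space (borel \<Otimes>\<^sub>M borel) (cube (\<beta> + ereal (\<alpha> / 2)) \<times> UNIV))"
    and "\<And>w. w \<in> cube \<beta> \<Longrightarrow>
           AE (v, x) in cube_law \<alpha> \<Otimes>\<^sub>M P. GDERIV (\<lambda>z. F z x) (w + v) :> G (w + v) x"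
    and "closed S" and "A = S \<inter> cube \<beta>"
    and "\<rho> > 0" and "\<tau> \<ge> 0" and "\<rho> + \<tau> > 1"
    and "\<eta> = \<alpha> / (3 * \<rho> * sqrt (real CARD('d)) * L0)"
    and "w1 \<in> A" and "K > 0" and "M > 0"
    and "prob_space \<Omega>"
    and "\<And>k i. k \<in> {1..K} \<Longrightarrow> i \<in> {1..M} \<Longrightarrow>
           distr \<Omega> (borel \<Otimes>\<^sub>M borel) (\<lambda>\<omega>. (u k i \<omega>, \<xi> k i \<omega>)) = cube_law \<alpha> \<Otimes>\<^sub>M P"
    and "prob_space.indep_vars \<Omega> (\<lambda>_. borel \<Otimes>\<^sub>M borel) (\<lambda>(k, i) \<omega>. (u k i \<omega>, \<xi> k i \<omega>))
           ({1..K} \<times> {1..M})"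
    and "distr \<Omega> (count_space UNIV) R = measure_pmf (pmf_of_set {2..K + 1})"
    and "prob_space.indep_set \<Omega>
           (sets (vimage_algebra (space \<Omega>) R (count_space UNIV)))
           (sets (vimage_algebra (space \<Omega>)
             (\<lambda>\<omega>. \<lambda>(k, i)\<in>{1..K} \<times> {1..M}. (u k i \<omega>, \<xi> k i \<omega>))
             (\<Pi>\<^sub>M j\<in>{1..K} \<times> {1..M}. borel \<Otimes>\<^sub>M borel)))"
    and "\<And>k. sel k \<in> borel_measurable borel"
    and "\<And>k x. sel k x \<in> proj_set A x"
    and "\<And>\<omega>. \<omega> \<in> space \<Omega> \<Longrightarrow> W 1 \<omega> = w1"
    and "\<And>k \<omega>. \<omega> \<in> space \<Omega> \<Longrightarrow> 1 \<le> k \<Longrightarrow> k \<le> R \<omega> - 1 \<Longrightarrow>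
           W (k + 1) \<omega> =
             sel k (spa_step upd \<alpha> F G \<eta> M (W k \<omega>) (\<lambda>i. u k i \<omega>) (\<lambda>i. \<xi> k i \<omega>))"
    and "is_arg_min f\<alpha> (\<lambda>w. w \<in> A) w\<alpha>"
    and "is_arg_min f (\<lambda>w. w \<in> A) ws"
    and "\<Delta> \<ge> f\<alpha> w1 - f\<alpha> w\<alpha>"
    and "C1 = 2 * (1 + 3 * \<rho>) / (\<tau> + \<rho> - 1) + 3 * \<rho>"
    and "C2 = 4 * (1 + 3 * \<rho>) / (\<tau> + \<rho> - 1) * (1 / 2 + 2 / 3 * (real M * \<tau> / \<rho>\<^sup>2)) + 3"
    and "\<upsilon> = (case upd of Finite_Difference \<Rightarrow> real CARD('d) | Gradient_Estimate \<Rightarrow> 1)"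
  shows "(\<integral>\<^sup>+\<omega>. ennreal ((infdist 0 ((\<lambda>y. gradient f\<alpha> (W (R \<omega>) \<omega>) + y) `
              normal_cone (W (R \<omega>) \<omega>) A))\<^sup>2) \<partial>\<Omega>)
           \<le> ennreal (C1 * (2 * inverse \<alpha> * sqrt (real CARD('d)) * L0 * \<Delta> / real K) + C2 * (\<upsilon> * Q / real M))
    \<and> ereal (f\<alpha> w1 - f\<alpha> w\<alpha>)
           \<le> min (2 * \<beta> * ereal (sqrt (real CARD('d)) * L0))
                 (ereal (f w1 - f ws + \<alpha> * L0 * sqrt (real CARD('d) / 3)))"
proof -
  interpret E: smoothed_expectation \<alpha> \<beta> \<kappa> P F G L
    by (rule smoothed_expectation.intro[OF assms(1-7,9-11,17,18)])
  interpret \<Omega>: prob_space \<Omega>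
    by (rule assms(28))
  define d where "d = real CARD('d)"
  define l where "l = 2 * inverse \<alpha> * sqrt d * L0"
  define c0 where "c0 = 2 * (1 + 3 * \<rho>) / (\<tau> + \<rho> - 1)"
  define I where "I = {1..K} \<times> {1..M}"
  define Z where "Z j \<omega> = (u (fst j) (snd j) \<omega>, \<xi> (fst j) (snd j) \<omega>)" for j \<omega>
  define e where "e = E.est upd"
  define H where "H p = (infdist 0 ((\<lambda>y. E.gr p + y) ` normal_cone p A))\<^sup>2" for p
  note \<alpha> = assms(1) and \<rho> = assms(21) and \<tau> = assms(22,23) and KM = assms(26,27)
  have L0: "L0 = E.L0" "0 < E.L0"
    using assms(13,14) by auto
  have f: "f = E.f" and f\<alpha>: "f\<alpha> = E.fs"
    using assms(15,16) by auto
  have \<upsilon>: "\<upsilon> = E.dim_factor upd"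
    by (simp add: assms(42) E.dim_factor_def)
  have A\<beta>: "A \<subseteq> cube \<beta>" and A: "closed A"
    using assms(19,20) closed_cube by auto
  have sel_A: "sel k x \<in> A" for k x
    using assms(34)[of k x] by (simp add: proj_set_def is_arg_min_def)
  have c0: "0 \<le> c0"
    using \<rho> \<tau> by (simp add: c0_def)
  have l0: "0 < l"
    using \<alpha> L0 by (simp add: l_def d_def)
  have Z_eq: "Z = (\<lambda>(k, i) \<omega>. (u k i \<omega>, \<xi> k i \<omega>))"
    by (auto simp: Z_def fun_eq_iff)
  have ind: "\<Omega>.indep_vars (\<lambda>_. borel \<Otimes>\<^sub>M borel) Z ({1..K} \<times> {1..M})"
    using assms(30) by (simp add: Z_eq)
  have Z_meas: "Z j \<in> \<Omega> \<rightarrow>\<^sub>M borel \<Otimes>\<^sub>M borel" if "j \<in> I" for j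
    using ind that by (auto simp: \<Omega>.indep_vars_def I_def)
  have Z_law: "distr \<Omega> (borel \<Otimes>\<^sub>M borel) (Z j) = E.N" if "j \<in> I" for j
    using assms(29)[of "fst j" "snd j"] that by (auto simp: I_def Z_def[abs_def])
  have transfer: "integrable \<Omega> (\<lambda>\<omega>. g (Z j \<omega>)) \<longleftrightarrow> integrable E.N g"
    "(\<integral>\<omega>. g (Z j \<omega>) \<partial>\<Omega>) = (\<integral>z. g z \<partial>E.N)"
    if "j \<in> I" "g \<in> borel_measurable E.N" for j and g :: "_ \<Rightarrow> 'x::{banach, second_countable_topology}"
  proof -
    have g: "g \<in> borel_measurable (borel \<Otimes>\<^sub>M borel)"
      using that(2) by (simp add: measurable_cong_sets[OF E.sets_N refl])
    show "integrable \<Omega> (\<lambda>\<omega>. g (Z j \<omega>)) \<longleftrightarrow> integrable E.N g"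
      using integrable_distr_eq[OF Z_meas[OF that(1)] g] by (simp add: Z_law[OF that(1)])
    show "(\<integral>\<omega>. g (Z j \<omega>) \<partial>\<Omega>) = (\<integral>z. g z \<partial>E.N)"
      using integral_distr[OF Z_meas[OF that(1)] g] by (simp add: Z_law[OF that(1)])
  qed
  have e_meas: "e v \<in> borel_measurable E.N" "(\<lambda>z. (norm (e v z))\<^sup>2) \<in> borel_measurable E.N" for v
    using E.est_meas_N[of upd v] by (auto simp: e_def)
  have bound: "(\<integral>\<^sup>+\<omega>. ennreal (H (iterate sel \<eta> M e w1 (\<lambda>j. Z j \<omega>) (R \<omega> - 1))) \<partial>\<Omega>)
    \<le> ennreal (C1 * l * \<Delta> / real K + ((c0 + 3) * (\<upsilon> * Q / real M) + c0 * (4 / 3 * (\<tau> / \<rho>\<^sup>2)) * (\<upsilon> * Q)))"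
  proof (rule \<Omega>.nn_integral_random_iterate_le[OF ind])
    show "(\<lambda>(w, s). e w s) \<in> borel_measurable (borel \<Otimes>\<^sub>M (borel \<Otimes>\<^sub>M borel))"
      unfolding e_def by (rule E.est_meas)
    show "continuous_on A E.fs"
      by (rule continuous_on_subset[OF _ A\<beta>], rule lipschitz_on_continuous_on[of E.L0])
        (use E.fs_Lipschitz E.L0_nonneg in \<open>auto intro!: lipschitz_onI simp: dist_norm\<close>)
    show "continuous_on A E.gr"
      by (rule continuous_on_subset[OF _ A\<beta>], rule lipschitz_on_continuous_on[of l])
        (use E.gr_Lipschitz l0 in \<open>auto intro!: lipschitz_onI simp: dist_norm l_def d_def L0(1)\<close>)
    fix v j assume v: "v \<in> A" and "j \<in> {1..K} \<times> {1..M}"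
    then have j: "j \<in> I" and v\<beta>: "v \<in> cube \<beta>"
      using A\<beta> by (auto simp: I_def)
    show "integrable \<Omega> (\<lambda>\<omega>. (norm (e v (Z j \<omega>)))\<^sup>2)"
      unfolding transfer(1)[OF j e_meas(2)] unfolding e_def by (rule E.est_square(1)[OF v\<beta>])
    show "(\<integral>\<omega>. (norm (e v (Z j \<omega>)))\<^sup>2 \<partial>\<Omega>) \<le> \<upsilon> * Q"
      unfolding transfer(2)[OF j e_meas(2)] unfolding e_def \<upsilon> assms(12) by (rule E.est_square(2)[OF v\<beta>])
    show "(\<integral>\<omega>. e v (Z j \<omega>) \<partial>\<Omega>) = E.gr v"
      unfolding transfer(2)[OF j e_meas(1)] unfolding e_def by (rule E.est_mean[OF v\<beta>])
  next
    fix k v g assume v: "v \<in> A"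
    show "H (sel k (v - \<eta> *\<^sub>R g))
        \<le> C1 * l * (E.fs v - E.fs (sel k (v - \<eta> *\<^sub>R g))) + (c0 + 3) * (norm (E.gr v - g))\<^sup>2
          + c0 * (4 / 3 * (\<tau> / \<rho>\<^sup>2)) * (norm g)\<^sup>2"
      unfolding H_def assms(40) l_def c0_def d_def L0(1)
      by (rule E.projected_step[OF A\<beta> v assms(34) L0(2) \<rho> \<tau>]) (use assms(24) L0 in simp)
  next
    fix v assume "v \<in> A"
    then have "f\<alpha> w\<alpha> \<le> f\<alpha> v"
      using assms(37) by (auto simp: is_arg_min_linorder)
    then show "E.fs w1 - E.fs v \<le> \<Delta>"
      using assms(39) by (simp add: f\<alpha>)
  next
    show "0 \<le> C1 * l" "0 \<le> c0 + 3" "0 \<le> c0 * (4 / 3 * (\<tau> / \<rho>\<^sup>2))"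
      using c0 \<rho> \<tau> l0 by (simp_all add: assms(40) flip: c0_def)
    show "0 \<le> \<upsilon> * Q"
      unfolding \<upsilon> assms(12) by (intro mult_nonneg_nonneg E.dim_factor_nonneg integral_nonneg) simp
    have "(\<lambda>\<omega>. \<lambda>j\<in>{1..K} \<times> {1..M}. Z j \<omega>) = (\<lambda>\<omega>. \<lambda>(k, i)\<in>{1..K} \<times> {1..M}. (u k i \<omega>, \<xi> k i \<omega>))"
      by (auto simp: Z_def fun_eq_iff)
    then show "\<Omega>.indep_set (sets (vimage_algebra (space \<Omega>) R (count_space UNIV)))
        (sets (vimage_algebra (space \<Omega>) (\<lambda>\<omega>. \<lambda>j\<in>{1..K} \<times> {1..M}. Z j \<omega>)
          (\<Pi>\<^sub>M j\<in>{1..K} \<times> {1..M}. borel \<Otimes>\<^sub>M borel)))"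
      using assms(32) by simp
  qed (use assms(25,31,33) sel_A A KM in \<open>auto simp: H_def\<close>)

  \<comment> \<open>Only the law of the samples is known; finiteness of the array gives one null set
    outside which every perturbation lies in the cube.\<close>
  have AE_u: "AE \<omega> in \<Omega>. \<forall>j\<in>I. fst (Z j \<omega>) \<in> E.X"
  proof (rule AE_finite_allI)
    fix j assume j: "j \<in> I"
    have "AE z in distr \<Omega> (borel \<Otimes>\<^sub>M borel) (Z j). fst z \<in> E.X"
      unfolding Z_law[OF j] using E.AE_N by eventually_elim simp
    then show "AE \<omega> in \<Omega>. fst (Z j \<omega>) \<in> E.X"
      by (rule AE_distrD[OF Z_meas[OF j]])
  qed (simp add: I_def)
  have R_meas: "R \<in> \<Omega> \<rightarrow>\<^sub>M count_space UNIV"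
    by (rule \<Omega>.random_variable_of_indep_set[OF assms(32)]) simp
  have AE_R: "AE \<omega> in \<Omega>. R \<omega> \<in> {2..K + 1}"
  proof -
    have "AE r in distr \<Omega> (count_space UNIV) R. r \<in> {2..K + 1}"
      unfolding assms(31) by (rule AE_pmfI) (use KM in simp)
    then show ?thesis
      by (rule AE_distrD[OF R_meas])
  qed
  have W_iterate: "W (R \<omega>) \<omega> = iterate sel \<eta> M e w1 (\<lambda>j. Z j \<omega>) (R \<omega> - 1)"
    if \<omega>: "\<omega> \<in> space \<Omega>" "\<forall>j\<in>I. fst (Z j \<omega>) \<in> E.X" "R \<omega> \<in> {2..K + 1}" for \<omega>
  proof -
    \<comment> \<open>Point number \<open>k + 1\<close> has completed \<open>k\<close> steps; the
      recursion is available only up to the random time.\<close>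
    have "W (k + 1) \<omega> = iterate sel \<eta> M e w1 (\<lambda>j. Z j \<omega>) k" if "k \<le> R \<omega> - 1" for k
      using that
    proof (induction k)
      case 0
      then show ?case using assms(35)[OF \<omega>(1)] by simp
    next
      case (Suc k)
      then have IH: "W (Suc k) \<omega> = iterate sel \<eta> M e w1 (\<lambda>j. Z j \<omega>) k"
        by simp
      have "W (Suc k) \<omega> \<in> cube \<beta>"
        unfolding IH using iterate_mem[of w1 A sel] assms(25) sel_A A\<beta> by blast
      moreover have "u (Suc k) i \<omega> \<in> E.X" if "i \<in> {1..M}" for i
        using \<omega>(2,3) Suc.prems that by (force simp: I_def Z_def)
      ultimately have "spa_step upd \<alpha> F G \<eta> M (W (Suc k) \<omega>) (\<lambda>i. u (Suc k) i \<omega>) (\<lambda>i. \<xi> (Suc k) i \<omega>)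
          = W (Suc k) \<omega> - \<eta> *\<^sub>R avg M e (W (Suc k) \<omega>) (\<lambda>i. Z (Suc k, i) \<omega>)"
        unfolding e_def Z_def by (subst E.spa_step_eq) auto
      then show ?case
        using assms(36)[OF \<omega>(1), of "Suc k"] Suc.prems IH by simp
    qed
    from this[of "R \<omega> - 1"] show ?thesis
      using \<omega>(3) by simp
  qed
  have "(\<integral>\<^sup>+\<omega>. ennreal ((infdist 0 ((\<lambda>y. gradient f\<alpha> (W (R \<omega>) \<omega>) + y) `
              normal_cone (W (R \<omega>) \<omega>) A))\<^sup>2) \<partial>\<Omega>)
      \<le> (\<integral>\<^sup>+\<omega>. ennreal (H (iterate sel \<eta> M e w1 (\<lambda>j. Z j \<omega>) (R \<omega> - 1))) \<partial>\<Omega>)"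
  proof (rule nn_integral_mono_AE)
    show "AE \<omega> in \<Omega>. ennreal ((infdist 0 ((\<lambda>y. gradient f\<alpha> (W (R \<omega>) \<omega>) + y) `
              normal_cone (W (R \<omega>) \<omega>) A))\<^sup>2)
      \<le> ennreal (H (iterate sel \<eta> M e w1 (\<lambda>j. Z j \<omega>) (R \<omega> - 1)))"
      using AE_u AE_R AE_space
    proof eventually_elim
      case (elim \<omega>)
      let ?p = "iterate sel \<eta> M e w1 (\<lambda>j. Z j \<omega>) (R \<omega> - 1)"
      have "?p \<in> cube \<beta>"
        using iterate_mem[of w1 A sel] assms(25) sel_A A\<beta> by blast
      then have "gradient f\<alpha> ?p = E.gr ?p"
        unfolding f\<alpha> by (intro gradient_eqI E.GDERIV_fs)
      then show ?case
        unfolding W_iterate[OF elim(3,1,2)] by (simp add: H_def)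
    qed
  qed
  also note bound
  also have "C1 * l * \<Delta> / real K + ((c0 + 3) * (\<upsilon> * Q / real M) + c0 * (4 / 3 * (\<tau> / \<rho>\<^sup>2)) * (\<upsilon> * Q))
      = C1 * (2 * inverse \<alpha> * sqrt (real CARD('d)) * L0 * \<Delta> / real K) + C2 * (\<upsilon> * Q / real M)"
  proof -
    \<comment> \<open>The second moment term carries no \<open>1 / M\<close>; writing it over
      \<open>M\<close> puts the factor \<open>M\<close> into \<open>C2\<close>.\<close>
    define y where "y = c0 * (4 / 3 * (\<tau> / \<rho>\<^sup>2))"
    have "C2 = c0 + 3 + y * real M"
      unfolding assms(41) c0_def y_def by (simp add: algebra_simps)
    then have "C2 * (\<upsilon> * Q / real M) = (c0 + 3) * (\<upsilon> * Q / real M) + y * (\<upsilon> * Q)"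
      using KM by (simp only: distrib_right) simp
    then show ?thesis
      unfolding y_def[symmetric] by (simp add: l_def d_def)
  qed
  finally have part1: "(\<integral>\<^sup>+\<omega>. ennreal ((infdist 0 ((\<lambda>y. gradient f\<alpha> (W (R \<omega>) \<omega>) + y) `
              normal_cone (W (R \<omega>) \<omega>) A))\<^sup>2) \<partial>\<Omega>)
      \<le> ennreal (C1 * (2 * inverse \<alpha> * sqrt (real CARD('d)) * L0 * \<Delta> / real K) + C2 * (\<upsilon> * Q / real M))" .

  have w\<alpha>: "w\<alpha> \<in> A" and ws: "f ws \<le> f w\<alpha>"
    using assms(37,38) by (auto simp: is_arg_min_linorder)
  have \<beta>_mem: "w1 \<in> cube \<beta>" "w\<alpha> \<in> cube \<beta>"
    using A\<beta> w\<alpha> assms(25) by auto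
  have "ereal (f\<alpha> w1 - f\<alpha> w\<alpha>) \<le> 2 * \<beta> * ereal (sqrt (real CARD('d)) * L0)"
  proof (cases \<beta>)
    case (real b)
    have "w1 - w\<alpha> \<in> cube (ereal (2 * b))"
      using cube_add[of w1 \<beta> "- w\<alpha>" \<beta>] \<beta>_mem by (simp add: real cube_def)
    then have "norm (w1 - w\<alpha>) \<le> sqrt (CARD('d)) * (2 * b)"
      using assms(2) real by (intro norm_le_of_mem_cube) auto
    then have "L0 * norm (w1 - w\<alpha>) \<le> L0 * (sqrt (CARD('d)) * (2 * b))"
      using L0 by (intro mult_left_mono) auto
    then have "f\<alpha> w1 - f\<alpha> w\<alpha> \<le> 2 * b * (sqrt (CARD('d)) * L0)"
      using E.fs_Lipschitz[OF \<beta>_mem] unfolding f\<alpha> L0(1) by (simp add: mult_ac)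
    then show ?thesis
      by (simp add: real)
  next
    \<comment> \<open>Here the bound is infinite because \<open>L0\<close> is positive.\<close>
    case PInf
    then show ?thesis
      using assms(14) by simp
  qed (use assms(2) in simp)
  \<comment> \<open>Smoothing error enters at \<open>w1\<close> and at \<open>w\<alpha>\<close>,
    doubling the bound; at \<open>w\<alpha>\<close> the function \<open>f\<close> is at least its
    minimum \<open>f ws\<close>.\<close>
  moreover have "f\<alpha> w1 - f\<alpha> w\<alpha> \<le> f w1 - f ws + \<alpha> * L0 * sqrt (real CARD('d) / 3)"
  proof -
    have "\<alpha> * E.L0 * sqrt (real CARD('d) / 3) = 2 * (E.L0 * (\<alpha> / 2 * sqrt (real CARD('d) / 3)))"
      by simp
    then show ?thesis
      using E.fs_f_le[OF \<beta>_mem(1)] E.fs_f_le[OF \<beta>_mem(2)] ws unfolding f f\<alpha> L0(1) by linarith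
  qed
  ultimately have part2: "ereal (f\<alpha> w1 - f\<alpha> w\<alpha>)
           \<le> min (2 * \<beta> * ereal (sqrt (real CARD('d)) * L0))
                 (ereal (f w1 - f ws + \<alpha> * L0 * sqrt (real CARD('d) / 3)))"
    by simp
  show ?thesis
    using part1 part2 by blast
qed

end
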